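(* Let $x:M^n\to A^{n+1}$ be a locally strongly convex (in particular non-degenerate) hypersurface in the affine space $A^{n+1}$. Then $x$ is equiaffine isoparametric if and only if it is of constant affine principal curvature, i.e. all its affine principal curvatures $\lambda_1,\dots,\lambda_n$ are constant on $M^n$.
   Context: $A^{n+1}$ is $\mathbb{R}^{n+1}$ with its canonical flat connection $d$ (componentwise differentiation) and the volume form $\mathrm{Vol}$ given by the determinant. A hypersurface is a smooth immersion $x:M^n\to A^{n+1}$ of a connected $n$-manifold. Indices $i,j,k,\dots$ run from $1$ to $n$. Affine invariants. For a local frame $\{e_1,\dots,e_n\}$ on $M$ write $x_i=e_i(x)$, $x_{ij}=e_j(e_i(x))$, $Y_i=e_i(Y)$, and choose a transversal field $e_{n+1}$ along $x$ with $\mathrm{Vol}(x_1,\dots,x_n,e_{n+1})=1$. Write $x_{ij}=\sum_k\Gamma_{ij}^k x_k+h_{ij}e_{n+1}$. The hypersurface is non-degenerate if $(h_{ij})$ is non-singular everywhere, and locally strongly convex if $(h_{ij})$ is definite everywhere; in the latter case the orientation is chosen so that $(h_{ij})$ is positive definite. With $H=|\det(h_{ij})|$, the Blaschke (affine) metric is $G=\sum G_{ij}\omega^i\omega^j$, $G_{ij}=H^{-1/(n+2)}h_{ij}$, where $\{\omega^i\}$ is the dual coframe (this does not depend on choices). The affine normal vector is $Y=\frac1n\Delta_G x$. The affine normal line at $u\in M$ is the line through $x(u)$ parallel to $Y(u)$. The affine shape operator $(B_i^j)$ is defined by $Y_i=-\sum_j B_i^j x_j$; its eigenvalues $\lambda_1,\dots,\lambda_n$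 are the affine principal curvatures, and the affine mean curvature is $L_1=\frac1n\sum_i B_i^i=\frac1n\sum_i\lambda_i$. Equiaffine parallel hypersurfaces. Let $x$ be locally strongly convex with affine normal $Y$ and let $\mu\in C^\infty(M)$. The hypersurface ${}^\mu x:=x+\mu Y$ is affine parallel to $x$ if ${}^\mu x$ is locally strongly convex and the tangent spaces ${}^\mu x_*(T_uM)$ and $x_*(T_uM)$ are parallel for all $u\in M$. It is equiaffine parallel to $x$ if it is affine parallel to $x$ and, in addition, the affine normal line of ${}^\mu x$ at $u$ is parallel to that of $x$ at $u$ for every $u\in M$. Equiaffine isoparametric hypersurface: a locally strongly convex hypersurface $x$ that is among a family of equiaffine parallel hypersurfaces of constant affine mean curvature; that is, there is $\delta>0$ such that for every constant $\mu\in(-\delta,\delta)$ the hypersurface ${}^\mu x=x+\mu Y$ is equiaffine parallel to $x$ and has constant affine mean curvature (as a function on $M$). *)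

theory Defs
  imports "HOL-Analysis.Analysis" "HOL-Computational_Algebra.Computational_Algebra"
begin

text \<open>Smooth maps on open subsets of normed spaces. \<open>Ck_on k S f\<close> says that \<open>f\<close> is \<open>k\<close> times
  continuously differentiable on the open set \<open>S\<close>, through iterated directional derivatives.\<close>

fun Ck_on :: "nat \<Rightarrow> 'a::real_normed_vector set \<Rightarrow> ('a \<Rightarrow> 'b::real_normed_vector) \<Rightarrow> bool" where
  "Ck_on 0 S f \<longleftrightarrow> continuous_on S f"
| "Ck_on (Suc k) S f \<longleftrightarrow>
     (\<forall>p\<in>S. f differentiable (at p)) \<and> (\<forall>v. Ck_on k S (\<lambda>p. frechet_derivative f (at p) v))"

definition smooth_on :: "'a::real_normed_vector set \<Rightarrow> ('a \<Rightarrow> 'b::real_normed_vector) \<Rightarrow> bool" where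
  "smooth_on S f \<longleftrightarrow> (\<forall>k. Ck_on k S f)"

text \<open>A chart is a pair of its domain \<open>U\<close> and its coordinate map, which is only relevant on \<open>U\<close>.
  A manifold is a space \<open>M\<close> with a smooth atlas \<open>A\<close>; the atlas need not be maximal. Connectedness
  is a separate hypothesis.\<close>

type_synonym ('a, 'n) chart = "'a set \<times> ('a \<Rightarrow> real ^ 'n)"

definition in_chart :: "('a, 'n::finite) chart \<Rightarrow> ('a \<Rightarrow> 'b) \<Rightarrow> real ^ 'n \<Rightarrow> 'b" where
  "in_chart c f = f \<circ> inv_into (fst c) (snd c)"

definition smooth_manifold :: "'a topology \<Rightarrow> ('a, 'n::finite) chart set \<Rightarrow> bool" where
  "smooth_manifold M A \<longleftrightarrow>
     Hausdorff_space M \<and> second_countable M \<and>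
     (\<Union>c\<in>A. fst c) = topspace M \<and>
     (\<forall>(U, \<phi>)\<in>A. openin M U \<and> open (\<phi> ` U) \<and>
        homeomorphic_map (subtopology M U) (top_of_set (\<phi> ` U)) \<phi>) \<and>
     (\<forall>(U, \<phi>)\<in>A. \<forall>(V, \<psi>)\<in>A. smooth_on (\<phi> ` (U \<inter> V)) (in_chart (U, \<phi>) \<psi>))"

definition smooth_map :: "('a, 'n::finite) chart set \<Rightarrow> ('a \<Rightarrow> 'b::real_normed_vector) \<Rightarrow> bool" where
  "smooth_map A f \<longleftrightarrow> (\<forall>c\<in>A. smooth_on (snd c ` fst c) (in_chart c f))"

text \<open>Some chart around \<open>u\<close>. It is used to define objects at \<open>u\<close> that do not depend on the chart.\<close>

definition chart_at :: "('a, 'n::finite) chart set \<Rightarrow> 'a \<Rightarrow> ('a, 'n) chart" where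
  "chart_at A u = (SOME c. c \<in> A \<and> u \<in> fst c)"

definition differential ::
  "('a, 'n::finite) chart \<Rightarrow> ('a \<Rightarrow> 'b::real_normed_vector) \<Rightarrow> 'a \<Rightarrow> real ^ 'n \<Rightarrow> 'b" where
  "differential c f u = frechet_derivative (in_chart c f) (at (snd c u))"

text \<open>The local frame is the coordinate frame \<open>e\<^sub>i = \<partial>\<^sub>i\<close> of a chart; \<open>frame_deriv c i f\<close> is \<open>e\<^sub>i(f)\<close>.\<close>

definition frame_deriv ::
  "('a, 'n::finite) chart \<Rightarrow> 'n \<Rightarrow> ('a \<Rightarrow> 'b::real_normed_vector) \<Rightarrow> 'a \<Rightarrow> 'b" where
  "frame_deriv c i f u = differential c f u (axis i 1)"

text \<open>The \<open>(n+1)\<close>-dimensional space is \<open>real ^ ('n option)\<close>: the index \<open>None\<close> is the additional one.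
  \<open>Vol X e\<close> is the determinant of the vectors \<open>X 1, \<dots>, X n, e\<close>.\<close>

definition Vol :: "('n::finite \<Rightarrow> real ^ ('n option)) \<Rightarrow> real ^ ('n option) \<Rightarrow> real" where
  "Vol X e = det (\<chi> r s. (case s of None \<Rightarrow> e | Some i \<Rightarrow> X i) $ r)"

definition hypersurface :: "('a, 'n::finite) chart set \<Rightarrow> ('a \<Rightarrow> real ^ ('n option)) \<Rightarrow> bool" where
  "hypersurface A x \<longleftrightarrow> smooth_map A x \<and> (\<forall>c\<in>A. \<forall>u\<in>fst c. inj (differential c x u))"

text \<open>The matrix \<open>(h\<^sub>i\<^sub>j)\<close>: it is the same for every transversal vector \<open>e\<close> of unit volume, so it is
  determined by the existence of \<open>e\<close> and of the coefficients \<open>\<Gamma>\<close>.\<close>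

definition second_form ::
  "('a, 'n::finite) chart \<Rightarrow> ('a \<Rightarrow> real ^ ('n option)) \<Rightarrow> 'a \<Rightarrow> real ^ 'n ^ 'n" where
  "second_form c x u = (THE h. \<exists>e \<Gamma>. Vol (\<lambda>i. frame_deriv c i x u) e = 1 \<and>
     (\<forall>i j. frame_deriv c j (frame_deriv c i x) u =
        (\<Sum>k\<in>UNIV. \<Gamma> i j k *\<^sub>R frame_deriv c k x u) + h $ i $ j *\<^sub>R e))"

definition positive_definite :: "real ^ 'n ^ 'n \<Rightarrow> bool" where
  "positive_definite h \<longleftrightarrow> (\<forall>v. v \<noteq> 0 \<longrightarrow> v \<bullet> (h *v v) > 0)"

definition locally_strongly_convex ::
  "('a, 'n::finite) chart set \<Rightarrow> ('a \<Rightarrow> real ^ ('n option)) \<Rightarrow> bool" where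
  "locally_strongly_convex A x \<longleftrightarrow> hypersurface A x \<and>
     (\<forall>c\<in>A. \<forall>u\<in>fst c. positive_definite (second_form c x u) \<or>
        positive_definite (- second_form c x u))"

text \<open>Reversing the orientation (equivalently, using \<open>Vol = -1\<close> for the transversal vector) changes
  the sign of \<open>(h\<^sub>i\<^sub>j)\<close>. The charts are not assumed to be oriented, so the orientation that makes
  \<open>(h\<^sub>i\<^sub>j)\<close> positive definite is implemented by this sign.\<close>

definition oriented_second_form ::
  "('a, 'n::finite) chart \<Rightarrow> ('a \<Rightarrow> real ^ ('n option)) \<Rightarrow> 'a \<Rightarrow> real ^ 'n ^ 'n" where
  "oriented_second_form c x u =
     (if positive_definite (second_form c x u) then second_form c x u else - second_form c x u)"

definition blaschke_metric ::
  "('a, 'n::finite) chart \<Rightarrow> ('a \<Rightarrow> real ^ ('n option)) \<Rightarrow> 'a \<Rightarrow> real ^ 'n ^ 'n" where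
  "blaschke_metric c x u =
     (\<bar>det (oriented_second_form c x u)\<bar> powr (- 1 / (real CARD('n) + 2))) *\<^sub>R
       oriented_second_form c x u"

text \<open>The Laplace-Beltrami operator of a metric given by its matrix \<open>g\<close> in the chart \<open>c\<close>.\<close>

definition laplacian ::
  "('a, 'n::finite) chart \<Rightarrow> ('a \<Rightarrow> real ^ 'n ^ 'n) \<Rightarrow> ('a \<Rightarrow> 'b::real_normed_vector) \<Rightarrow> 'a \<Rightarrow> 'b" where
  "laplacian c g f u = (1 / sqrt \<bar>det (g u)\<bar>) *\<^sub>R
     (\<Sum>i\<in>UNIV. frame_deriv c i (\<lambda>v. sqrt \<bar>det (g v)\<bar> *\<^sub>R
        (\<Sum>j\<in>UNIV. matrix_inv (g v) $ i $ j *\<^sub>R frame_deriv c j f v)) u)"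

definition affine_normal ::
  "('a, 'n::finite) chart set \<Rightarrow> ('a \<Rightarrow> real ^ ('n option)) \<Rightarrow> 'a \<Rightarrow> real ^ ('n option)" where
  "affine_normal A x u = (1 / real CARD('n)) *\<^sub>R
     (let c = chart_at A u in laplacian c (blaschke_metric c x) x u)"

definition affine_normal_line ::
  "('a, 'n::finite) chart set \<Rightarrow> ('a \<Rightarrow> real ^ ('n option)) \<Rightarrow> 'a \<Rightarrow> (real ^ ('n option)) set" where
  "affine_normal_line A x u = {x u + t *\<^sub>R affine_normal A x u | t. True}"

text \<open>The matrix of the affine shape operator: the entry \<open>B $ i $ j\<close> is \<open>B\<^sub>i\<^sup>j\<close>. It depends on the
  chart only up to conjugation.\<close>

definition shape_matrix ::
  "('a, 'n::finite) chart set \<Rightarrow> ('a, 'n) chart \<Rightarrow> ('a \<Rightarrow> real ^ ('n option)) \<Rightarrow> 'a \<Rightarrow> real ^ 'n ^ 'n" where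
  "shape_matrix A c x u = (THE B. \<forall>i. frame_deriv c i (affine_normal A x) u =
     - (\<Sum>j\<in>UNIV. B $ i $ j *\<^sub>R frame_deriv c j x u))"

definition charpoly :: "real ^ 'n ^ 'n \<Rightarrow> real poly" where
  "charpoly B = det (\<chi> i j. (if i = j then [:0, 1:] else 0) - [:B $ i $ j:])"

text \<open>The eigenvalues with their algebraic multiplicities. All eigenvalues of the shape operator of a
  locally strongly convex hypersurface are real, since it is self-adjoint for the Blaschke metric.\<close>

definition affine_principal_curvatures ::
  "('a, 'n::finite) chart set \<Rightarrow> ('a \<Rightarrow> real ^ ('n option)) \<Rightarrow> 'a \<Rightarrow> real multiset" where
  "affine_principal_curvatures A x u = proots (charpoly (shape_matrix A (chart_at A u) x u))"

definition affine_mean_curvature ::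
  "('a, 'n::finite) chart set \<Rightarrow> ('a \<Rightarrow> real ^ ('n option)) \<Rightarrow> 'a \<Rightarrow> real" where
  "affine_mean_curvature A x u = trace (shape_matrix A (chart_at A u) x u) / real CARD('n)"

definition parallel_map ::
  "('a, 'n::finite) chart set \<Rightarrow> ('a \<Rightarrow> real ^ ('n option)) \<Rightarrow> ('a \<Rightarrow> real) \<Rightarrow> 'a \<Rightarrow> real ^ ('n option)" where
  "parallel_map A x \<mu> u = x u + \<mu> u *\<^sub>R affine_normal A x u"

definition tangent_space ::
  "('a, 'n::finite) chart set \<Rightarrow> ('a \<Rightarrow> real ^ ('n option)) \<Rightarrow> 'a \<Rightarrow> (real ^ ('n option)) set" where
  "tangent_space A x u = range (differential (chart_at A u) x u)"

text \<open>Parallelism of tangent spaces and of lines is \<^const>\<open>affine_parallel\<close>, i.e. equality up to a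
  translation.\<close>

definition affine_parallel_hypersurface ::
  "'a topology \<Rightarrow> ('a, 'n::finite) chart set \<Rightarrow> ('a \<Rightarrow> real ^ ('n option)) \<Rightarrow> ('a \<Rightarrow> real) \<Rightarrow> bool" where
  "affine_parallel_hypersurface M A x \<mu> \<longleftrightarrow> smooth_map A \<mu> \<and>
     locally_strongly_convex A (parallel_map A x \<mu>) \<and>
     (\<forall>u\<in>topspace M. affine_parallel (tangent_space A (parallel_map A x \<mu>) u) (tangent_space A x u))"

definition equiaffine_parallel_hypersurface ::
  "'a topology \<Rightarrow> ('a, 'n::finite) chart set \<Rightarrow> ('a \<Rightarrow> real ^ ('n option)) \<Rightarrow> ('a \<Rightarrow> real) \<Rightarrow> bool" where
  "equiaffine_parallel_hypersurface M A x \<mu> \<longleftrightarrow> affine_parallel_hypersurface M A x \<mu> \<and>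
     (\<forall>u\<in>topspace M.
        affine_parallel (affine_normal_line A (parallel_map A x \<mu>) u) (affine_normal_line A x u))"

definition equiaffine_isoparametric ::
  "'a topology \<Rightarrow> ('a, 'n::finite) chart set \<Rightarrow> ('a \<Rightarrow> real ^ ('n option)) \<Rightarrow> bool" where
  "equiaffine_isoparametric M A x \<longleftrightarrow> locally_strongly_convex A x \<and>
     (\<exists>\<delta>>0. \<forall>m. - \<delta> < m \<and> m < \<delta> \<longrightarrow>
        equiaffine_parallel_hypersurface M A x (\<lambda>_. m) \<and>
        (\<exists>L. \<forall>u\<in>topspace M. affine_mean_curvature A (parallel_map A x (\<lambda>_. m)) u = L))"

text \<open>The curvatures \<open>\<lambda>\<^sub>1, \<dots>, \<lambda>\<^sub>n\<close> are constant on \<open>M\<close> when the same \<open>n\<close> real numbers are the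
  eigenvalues, with multiplicity, at every point.\<close>

definition constant_affine_principal_curvatures ::
  "'a topology \<Rightarrow> ('a, 'n::finite) chart set \<Rightarrow> ('a \<Rightarrow> real ^ ('n option)) \<Rightarrow> bool" where
  "constant_affine_principal_curvatures M A x \<longleftrightarrow>
     (\<exists>\<Lambda> :: 'n \<Rightarrow> real. \<forall>u\<in>topspace M.
        affine_principal_curvatures A x u = image_mset \<Lambda> (mset_set UNIV))"

end

theory Submission
  imports Defs
begin

text \<open>Let \<open>N\<close> be the conormal field, \<open>N \<bullet> w = Vol(x\<^sub>1,\<dots>,x\<^sub>n,w)\<close>, and \<open>\<nu> = N \<bullet> Y\<close>. The affine normal is
  the only field \<open>Y\<close> with \<open>\<nu> h\<close> positive definite, \<open>det h = \<nu>\<^sup>n\<^sup>+\<^sup>2\<close> and \<open>dY\<close> tangential: two such fields differ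
  by a tangential \<open>T\<close> with \<open>h(T,\<cdot>) = 0\<close>. Passing from \<open>x\<close> to \<open>x + mY\<close> multiplies the frame by \<open>P = 1 - mB\<close>,
  hence \<open>N\<close> by \<open>det P\<close> and \<open>h\<close> by \<open>(det P) P\<close>. So a normal \<open>\<rho>Y\<close> of \<open>x + mY\<close> satisfies \<open>det P \<cdot> \<rho>\<^sup>n\<^sup>+\<^sup>2 = 1\<close>,
  and its derivative is tangential iff \<open>\<rho>\<close>, equivalently \<open>det (1 - mB)\<close>, is locally constant. For an
  isoparametric \<open>x\<close> this holds for infinitely many \<open>m\<close> and fixes the characteristic polynomial of \<open>B\<close>.
  Conversely, constant curvatures make \<open>det (1 - mB)\<close> constant, and the shape operator \<open>\<rho>B(1 - mB)\<^sup>-\<^sup>1\<close> of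
  \<open>x + mY\<close> has constant trace because \<open>B\<close> is diagonalizable, being self-adjoint for \<open>\<nu> h\<close>.\<close>

text \<open>The affine normal is a Laplacian whose chart is chosen anew at every point, so not even
  its differentiability is visible, and for \<open>x + mY\<close> that Laplacian would involve the
  inverse and the derivatives of a metric built from \<open>B\<close>. The characterization removes
  both obstacles: uniqueness on overlaps glues the chartwise Laplacians, and a candidate normal of
  \<open>x + mY\<close> is merely tested. The price is to show that the Laplacian itself passes the
  test; tangency of \<open>dY\<close> is the hard condition. The exponent n+2 is forced by
  invariance. Under a change of frame by J, \<nu> gains the factor det J and h becomes det J times J
  h J^T, so det h gains (det J)^(n+2). Derivatives of \<open>B\<close> never occur, because h_ij =
  -<N_j, x_i> and the conormal of \<open>x\<close> also annihilates the frame of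
  \<open>x + mY\<close>. With p the characteristic polynomial of \<open>B\<close>, det(1 - mB) = m^n
  p(1/m) for m \<noteq> 0, so small m correspond to large arguments of p. Only real roots count as
  curvatures, hence self-adjointness of \<open>B\<close> matters in both directions.\<close>

no_notation fps_nth (infixl "$" 75)

section \<open>Smooth maps on open sets\<close>

lemma frechet_derivative_cong_open:
  assumes "open S" "p \<in> S" "\<And>q. q \<in> S \<Longrightarrow> f q = g q"
  shows "frechet_derivative f (at p) = frechet_derivative g (at p)"
proof -
  have "(f has_derivative D) (at p) \<longleftrightarrow> (g has_derivative D) (at p)" for D
    using has_derivative_transform_within_open[OF _ assms(1,2)] assms(3) by metis
  then show ?thesis by (simp add: frechet_derivative_def)
qed

lemma differentiable_cong_open:
  assumes "open S" "p \<in> S" "\<And>q. q \<in> S \<Longrightarrow> f q = g q" "f differentiable at p"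
  shows "g differentiable at p"
  using assms has_derivative_transform_within_open unfolding differentiable_def by metis

lemma Ck_on_cong:
  assumes "open S" "\<And>p. p \<in> S \<Longrightarrow> f p = g p" "Ck_on k S f"
  shows "Ck_on k S g"
  using assms(2,3)
proof (induction k arbitrary: f g)
  case 0
  then show ?case using continuous_on_eq[of S f g] by simp
next
  case (Suc k)
  have "frechet_derivative f (at p) v = frechet_derivative g (at p) v" if "p \<in> S" for p v
    using frechet_derivative_cong_open[OF assms(1) that, of f g] Suc.prems(1) by simp
  then have "Ck_on k S (\<lambda>p. frechet_derivative g (at p) v)" for v
    using Suc.IH[of "\<lambda>p. frechet_derivative f (at p) v"] Suc.prems(2) by simp
  moreover have "g differentiable at p" if "p \<in> S" for p
    using differentiable_cong_open[OF assms(1) that, of f g] Suc.prems that by simp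
  ultimately show ?case by simp
qed

text \<open>\<open>frechet_derivative\<close> is a chosen derivative. By uniqueness, any explicit
  formula \<open>D\<close> may replace it on the open set; the inductions below rest on
  this.\<close>

lemma Ck_on_SucI:
  assumes "open S" "\<And>p. p \<in> S \<Longrightarrow> (f has_derivative D p) (at p)"
    "\<And>v. Ck_on k S (\<lambda>p. D p v)"
  shows "Ck_on (Suc k) S f"
proof -
  have "D p v = frechet_derivative f (at p) v" if "p \<in> S" for p v
    using frechet_derivative_at[OF assms(2)[OF that]] by simp
  then have "Ck_on k S (\<lambda>p. frechet_derivative f (at p) v)" for v
    by (rule Ck_on_cong[OF assms(1) _ assms(3)])
  then show ?thesis using assms(2) by (auto simp: differentiable_def)
qed

text \<open>The definition at level \<open>Suc k\<close> does not mention continuity of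
  \<open>f\<close>; it comes from differentiability at the bottom of the induction.\<close>

lemma Ck_on_SucD: "Ck_on (Suc k) S f \<Longrightarrow> Ck_on k S f"
proof (induction k arbitrary: f)
  case 0
  then show ?case
    by (auto intro!: continuous_at_imp_continuous_on differentiable_imp_continuous_within)
next
  case (Suc k)
  then show ?case using Ck_on.simps(2)[of k S f] Ck_on.simps(2)[of "Suc k" S f] by blast
qed

lemma Ck_on_has_derivative:
  "Ck_on (Suc k) S f \<Longrightarrow> p \<in> S \<Longrightarrow> (f has_derivative frechet_derivative f (at p)) (at p)"
  using frechet_derivative_works by auto

lemma Ck_on_const: "open S \<Longrightarrow> Ck_on k S (\<lambda>_. c)"
proof (induction k arbitrary: c)
  case (Suc k)
  show ?case by (rule Ck_on_SucI[OF Suc.prems has_derivative_const]) (use Suc in auto)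
qed auto

lemma Ck_on_bounded_linear:
  assumes "bounded_linear L" "open S" "Ck_on k S f"
  shows "Ck_on k S (\<lambda>p. L (f p))"
  using assms(3)
proof (induction k arbitrary: f)
  case 0
  then show ?case using assms(1) by (simp add: bounded_linear.continuous_on)
next
  case (Suc k)
  show ?case
    by (rule Ck_on_SucI[OF assms(2) bounded_linear.has_derivative[OF assms(1)
          Ck_on_has_derivative[OF Suc.prems]]]) (use Suc in auto)
qed

lemma Ck_on_add:
  assumes "open S" "Ck_on k S f" "Ck_on k S g"
  shows "Ck_on k S (\<lambda>p. f p + g p)"
  using assms(2,3)
proof (induction k arbitrary: f g)
  case 0
  then show ?case by (simp add: continuous_on_add)
next
  case (Suc k)
  show ?case
    by (rule Ck_on_SucI[OF assms(1) has_derivative_add[OF Ck_on_has_derivative[OF Suc.prems(1)]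
          Ck_on_has_derivative[OF Suc.prems(2)]]]) (use Suc in auto)
qed

lemma Ck_on_bounded_bilinear:
  assumes "bounded_bilinear B" "open S" "Ck_on k S f" "Ck_on k S g"
  shows "Ck_on k S (\<lambda>p. B (f p) (g p))"
  using assms(3,4)
proof (induction k arbitrary: f g)
  case 0
  then show ?case using assms(1) by (simp add: bounded_bilinear.continuous_on)
next
  case (Suc k)
  show ?case
    by (rule Ck_on_SucI[OF assms(2) bounded_bilinear.FDERIV[OF assms(1)
          Ck_on_has_derivative[OF Suc.prems(1)] Ck_on_has_derivative[OF Suc.prems(2)]]])
      (use Suc Ck_on_SucD[OF Suc.prems(1)] Ck_on_SucD[OF Suc.prems(2)] in
        \<open>auto intro!: Ck_on_add assms(2)\<close>)
qed

text \<open>Real powers are the source of every non-polynomial scalar operation used later: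
  reciprocals, square roots, absolute values and signs are all written through powers of a positive
  square. The exponent varies in the induction because differentiation lowers it.\<close>

lemma Ck_on_powr:
  fixes f :: "'a::real_normed_vector \<Rightarrow> real"
  assumes "open S" "Ck_on k S f" "\<And>p. p \<in> S \<Longrightarrow> 0 < f p"
  shows "Ck_on k S (\<lambda>p. f p powr a)"
  using assms(2)
proof (induction k arbitrary: a)
  case 0
  then show ?case using assms(3) by (force intro: continuous_on_powr)
next
  case (Suc k)
  have "((\<lambda>p. f p powr a) has_derivative
      (\<lambda>v. (a * f p powr (a - 1)) * frechet_derivative f (at p) v)) (at p)" if "p \<in> S" for p
    using has_derivative_powr[OF Ck_on_has_derivative[OF Suc.prems that] has_derivative_const[of a]]
      assms(3)[OF that] by (simp add: powr_diff field_simps)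
  moreover have "Ck_on k S (\<lambda>p. (a * f p powr (a - 1)) * frechet_derivative f (at p) v)" for v
    using Suc Ck_on_SucD[OF Suc.prems]
    by (intro Ck_on_bounded_bilinear[OF bounded_bilinear_mult assms(1)] Ck_on_const assms(1)) auto
  ultimately show ?case by (intro Ck_on_SucI[OF assms(1)])
qed

section \<open>Closure properties of smooth maps and symmetry of second derivatives\<close>

lemma smooth_on_cong:
  "open S \<Longrightarrow> (\<And>p. p \<in> S \<Longrightarrow> f p = g p) \<Longrightarrow> smooth_on S f \<Longrightarrow> smooth_on S g"
  unfolding smooth_on_def by (blast intro: Ck_on_cong)

lemma smooth_on_const: "open S \<Longrightarrow> smooth_on S (\<lambda>_. c)"
  by (simp add: smooth_on_def Ck_on_const)

lemma smooth_on_bounded_linear: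
  "bounded_linear L \<Longrightarrow> open S \<Longrightarrow> smooth_on S f \<Longrightarrow> smooth_on S (\<lambda>p. L (f p))"
  by (simp add: smooth_on_def Ck_on_bounded_linear)

lemma smooth_on_bounded_bilinear:
  "bounded_bilinear B \<Longrightarrow> open S \<Longrightarrow> smooth_on S f \<Longrightarrow> smooth_on S g \<Longrightarrow>
    smooth_on S (\<lambda>p. B (f p) (g p))"
  by (simp add: smooth_on_def Ck_on_bounded_bilinear)

lemma smooth_on_add:
  "open S \<Longrightarrow> smooth_on S f \<Longrightarrow> smooth_on S g \<Longrightarrow> smooth_on S (\<lambda>p. f p + g p)"
  by (simp add: smooth_on_def Ck_on_add)

lemma smooth_on_powr:
  fixes f :: "'a::real_normed_vector \<Rightarrow> real"
  shows "open S \<Longrightarrow> smooth_on S f \<Longrightarrow> (\<And>p. p \<in> S \<Longrightarrow> 0 < f p) \<Longrightarrow> smooth_on S (\<lambda>p. f p powr a)"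
  by (simp add: smooth_on_def Ck_on_powr)

lemma smooth_on_differentiable: "smooth_on S f \<Longrightarrow> p \<in> S \<Longrightarrow> f differentiable at p"
  unfolding smooth_on_def by (metis Ck_on.simps(2))

lemma smooth_on_frechet_derivative:
  "smooth_on S f \<Longrightarrow> smooth_on S (\<lambda>p. frechet_derivative f (at p) v)"
  unfolding smooth_on_def by (metis Ck_on.simps(2))

text \<open>The mean value theorem is applied twice: along \<open>v\<close> to the increment of
  \<open>f\<close> in direction \<open>t w\<close>, then along \<open>w\<close> to the derivative in
  direction \<open>v\<close>. The left-hand side is symmetric in \<open>v\<close> and
  \<open>w\<close>, which is what makes it useful.\<close>

lemma second_difference_mean_value:
  fixes f :: "'a::real_normed_vector \<Rightarrow> real"
  assumes f: "Ck_on 2 S f" and t: "0 < t"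
    and mem: "\<And>a b. 0 \<le> a \<Longrightarrow> a \<le> t \<Longrightarrow> 0 \<le> b \<Longrightarrow> b \<le> t \<Longrightarrow> p + a *\<^sub>R v + b *\<^sub>R w \<in> S"
  obtains a b where "0 \<le> a" "a \<le> t" "0 \<le> b" "b \<le> t"
    "f (p + t *\<^sub>R v + t *\<^sub>R w) - f (p + t *\<^sub>R v) - f (p + t *\<^sub>R w) + f p =
      t * t * frechet_derivative (\<lambda>q. frechet_derivative f (at q) v) (at (p + a *\<^sub>R v + b *\<^sub>R w)) w"
proof -
  define D where "D q = frechet_derivative f (at q)" for q
  define E where "E q = frechet_derivative (\<lambda>q. D q v) (at q)" for q
  have f2: "Ck_on (Suc (Suc 0)) S f" using f by (simp add: numeral_2_eq_2)
  have D: "(f has_derivative D q) (at q)" if "q \<in> S" for q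
    unfolding D_def using Ck_on_has_derivative[OF f2 that] .
  have E: "((\<lambda>q. D q v) has_derivative E q) (at q)" if "q \<in> S" for q
  proof -
    have "Ck_on (Suc 0) S (\<lambda>q. D q v)" using f2 unfolding D_def by (metis Ck_on.simps(2))
    then show ?thesis unfolding E_def using Ck_on_has_derivative[OF _ that] by blast
  qed
  have D': "D q (c *\<^sub>R u) = c *\<^sub>R D q u" if "q \<in> S" for q c u
    using D[OF that] has_derivative_bounded_linear linear_simps(5) by blast
  have E': "E q (c *\<^sub>R u) = c *\<^sub>R E q u" if "q \<in> S" for q c u
    using E[OF that] has_derivative_bounded_linear linear_simps(5) by blast
  let ?phi = "\<lambda>a. f (p + a *\<^sub>R v + t *\<^sub>R w) - f (p + a *\<^sub>R v)"
  have "(?phi has_real_derivative D (p + a *\<^sub>R v + t *\<^sub>R w) v - D (p + a *\<^sub>R v) v) (at a)"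
    if "0 \<le> a" "a \<le> t" for a
  proof -
    have 1: "p + a *\<^sub>R v + t *\<^sub>R w \<in> S" using mem that t by simp
    have 2: "p + a *\<^sub>R v \<in> S" using mem[of a 0] that t by simp
    have "((\<lambda>a. f (p + a *\<^sub>R v + t *\<^sub>R w)) has_derivative
        (\<lambda>s. D (p + a *\<^sub>R v + t *\<^sub>R w) (s *\<^sub>R v))) (at a)"
      by (rule has_derivative_compose[where f = "\<lambda>a. p + a *\<^sub>R v + t *\<^sub>R w" and g = f, OF _ D[OF 1]]) (auto intro!: derivative_eq_intros)
    moreover have "((\<lambda>a. f (p + a *\<^sub>R v)) has_derivative (\<lambda>s. D (p + a *\<^sub>R v) (s *\<^sub>R v))) (at a)"
      by (rule has_derivative_compose[where f = "\<lambda>a. p + a *\<^sub>R v" and g = f, OF _ D[OF 2]]) (auto intro!: derivative_eq_intros)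
    ultimately have "(?phi has_derivative
        (\<lambda>s. D (p + a *\<^sub>R v + t *\<^sub>R w) (s *\<^sub>R v) - D (p + a *\<^sub>R v) (s *\<^sub>R v))) (at a)"
      by (rule has_derivative_diff)
    then show ?thesis unfolding has_field_derivative_def
      by (rule has_derivative_eq_rhs) (auto simp: D'[OF 1] D'[OF 2] fun_eq_iff left_diff_distrib)
  qed
  from MVT2[OF t this] obtain a where a: "0 < a" "a < t"
    "?phi t - ?phi 0 = t * (D (p + a *\<^sub>R v + t *\<^sub>R w) v - D (p + a *\<^sub>R v) v)" by auto
  let ?psi = "\<lambda>b. D (p + a *\<^sub>R v + b *\<^sub>R w) v"
  have "(?psi has_real_derivative E (p + a *\<^sub>R v + b *\<^sub>R w) w) (at b)" if "0 \<le> b" "b \<le> t" for b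
  proof -
    have 1: "p + a *\<^sub>R v + b *\<^sub>R w \<in> S" using mem that a by simp
    have "(?psi has_derivative (\<lambda>s. E (p + a *\<^sub>R v + b *\<^sub>R w) (s *\<^sub>R w))) (at b)"
      by (rule has_derivative_compose[where f = "\<lambda>b. p + a *\<^sub>R v + b *\<^sub>R w" and g = "\<lambda>q. D q v", OF _ E[OF 1]]) (auto intro!: derivative_eq_intros)
    then show ?thesis unfolding has_field_derivative_def
      by (rule has_derivative_eq_rhs) (auto simp: E'[OF 1] fun_eq_iff)
  qed
  from MVT2[OF t this] obtain b where b: "0 < b" "b < t"
    "?psi t - ?psi 0 = t * E (p + a *\<^sub>R v + b *\<^sub>R w) w" by auto
  have "f (p + t *\<^sub>R v + t *\<^sub>R w) - f (p + t *\<^sub>R v) - f (p + t *\<^sub>R w) + f p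
      = t * t * E (p + a *\<^sub>R v + b *\<^sub>R w) w"
    using a(3) b(3) by simp
  then show ?thesis using that[of a b] a b by (simp add: E_def D_def)
qed

text \<open>Both orders of differentiation represent the same second difference, at two points of a
  small parallelogram; continuity of both second derivatives at \<open>p\<close> moves these points
  to \<open>p\<close>.\<close>

lemma mixed_derivatives_commute_real:
  fixes f :: "'a::real_normed_vector \<Rightarrow> real"
  assumes S: "open S" and p: "p \<in> S" and f: "Ck_on 2 S f"
  shows "frechet_derivative (\<lambda>q. frechet_derivative f (at q) v) (at p) w =
    frechet_derivative (\<lambda>q. frechet_derivative f (at q) w) (at p) v"
proof -
  define F where "F v w q = frechet_derivative (\<lambda>q. frechet_derivative f (at q) v) (at q) w" for v w q
  have cont: "isCont (F v w) p" for v w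
  proof -
    have "continuous_on S (F v w)" unfolding F_def using f by (simp add: numeral_2_eq_2)
    then show ?thesis using S p by (simp add: continuous_on_eq_continuous_at)
  qed
  have "\<bar>F v w p - F w v p\<bar> < e" if e: "e > 0" for e
  proof -
    obtain d1 where d1: "d1 > 0" "\<And>q. dist q p < d1 \<Longrightarrow> dist (F v w q) (F v w p) < e / 2"
      using cont[of v w] e unfolding continuous_at_eps_delta by (meson half_gt_zero)
    obtain d2 where d2: "d2 > 0" "\<And>q. dist q p < d2 \<Longrightarrow> dist (F w v q) (F w v p) < e / 2"
      using cont[of w v] e unfolding continuous_at_eps_delta by (meson half_gt_zero)
    obtain d3 where d3: "d3 > 0" "\<And>q. dist q p < d3 \<Longrightarrow> q \<in> S"
      using S p unfolding open_dist by blast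
    define d where "d = min d1 (min d2 d3)"
    \<comment> \<open>With this \<open>t\<close> the parallelogram spanned by \<open>t v\<close> and
      \<open>t w\<close> at \<open>p\<close> lies within distance \<open>d\<close>; the summand 1
      keeps the denominator positive and the inequality strict.\<close>
    define t where "t = d / (norm v + norm w + 1)"
    have d: "d > 0" and t: "t > 0" unfolding t_def d_def using d1 d2 d3
      by (auto intro!: divide_pos_pos add_nonneg_pos)
    have near: "dist (p + a *\<^sub>R v + b *\<^sub>R w) p < d"
      if "0 \<le> a" "a \<le> t" "0 \<le> b" "b \<le> t" for a b
    proof -
      have "dist (p + a *\<^sub>R v + b *\<^sub>R w) p \<le> norm (a *\<^sub>R v) + norm (b *\<^sub>R w)"
        using norm_triangle_ineq[of "a *\<^sub>R v" "b *\<^sub>R w"] by (simp add: dist_norm add.assoc)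
      also have "\<dots> \<le> t * norm v + t * norm w"
        using that by (auto intro!: add_mono mult_right_mono)
      also have "\<dots> < t * (norm v + norm w + 1)" using t by (simp add: algebra_simps)
      also have "\<dots> = d" unfolding t_def by (simp add: add_nonneg_eq_0_iff)
      finally show ?thesis .
    qed
    have mem: "p + a *\<^sub>R v + b *\<^sub>R w \<in> S" if "0 \<le> a" "a \<le> t" "0 \<le> b" "b \<le> t" for a b
      using d3(2) near[OF that] by (simp add: d_def)
    obtain a b where ab: "0 \<le> a" "a \<le> t" "0 \<le> b" "b \<le> t"
      "f (p + t *\<^sub>R v + t *\<^sub>R w) - f (p + t *\<^sub>R v) - f (p + t *\<^sub>R w) + f p =
        t * t * F v w (p + a *\<^sub>R v + b *\<^sub>R w)"
      using second_difference_mean_value[OF f t mem, folded F_def] by blast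
    have mem': "p + a *\<^sub>R w + b *\<^sub>R v \<in> S" if "0 \<le> a" "a \<le> t" "0 \<le> b" "b \<le> t" for a b
      using mem[of b a] that by (simp add: algebra_simps)
    obtain a' b' where ab': "0 \<le> a'" "a' \<le> t" "0 \<le> b'" "b' \<le> t"
      "f (p + t *\<^sub>R w + t *\<^sub>R v) - f (p + t *\<^sub>R w) - f (p + t *\<^sub>R v) + f p =
        t * t * F w v (p + a' *\<^sub>R w + b' *\<^sub>R v)"
      using second_difference_mean_value[OF f t mem', folded F_def] by blast
    have "t * t * F v w (p + a *\<^sub>R v + b *\<^sub>R w) = t * t * F w v (p + b' *\<^sub>R v + a' *\<^sub>R w)"
      using ab(5) ab'(5) by (simp add: algebra_simps)
    then have "F v w (p + a *\<^sub>R v + b *\<^sub>R w) = F w v (p + b' *\<^sub>R v + a' *\<^sub>R w)" using t by simp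
    moreover have "dist (F v w (p + a *\<^sub>R v + b *\<^sub>R w)) (F v w p) < e / 2"
      using d1(2) near[OF ab(1-4)] by (simp add: d_def)
    moreover have "dist (F w v (p + b' *\<^sub>R v + a' *\<^sub>R w)) (F w v p) < e / 2"
      using d2(2) near[OF ab'(3,4,1,2)] by (simp add: d_def)
    ultimately show ?thesis unfolding dist_real_def by linarith
  qed
  then have "F v w p = F w v p" by (metis less_irrefl zero_less_abs_iff right_minus_eq)
  then show ?thesis by (simp add: F_def)
qed

text \<open>A vector is determined by its inner products with all \<open>b\<close>, so the scalar
  case applies to each function \<open>f p \<bullet> b\<close>.\<close>

lemma mixed_derivatives_commute:
  fixes f :: "'a::real_normed_vector \<Rightarrow> 'b::real_inner"
  assumes S: "open S" and p: "p \<in> S" and f: "Ck_on 2 S f"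
  shows "frechet_derivative (\<lambda>q. frechet_derivative f (at q) v) (at p) w =
    frechet_derivative (\<lambda>q. frechet_derivative f (at q) w) (at p) v"
proof -
  have f2: "Ck_on (Suc (Suc 0)) S f" using f by (simp add: numeral_2_eq_2)
  have *: "frechet_derivative (\<lambda>q. frechet_derivative (\<lambda>p. f p \<bullet> b) (at q) v) (at p) w =
      frechet_derivative (\<lambda>q. frechet_derivative f (at q) v) (at p) w \<bullet> b" for b v w
  proof -
    have 1: "frechet_derivative f (at q) v \<bullet> b = frechet_derivative (\<lambda>p. f p \<bullet> b) (at q) v"
      if "q \<in> S" for q
      using frechet_derivative_at[OF has_derivative_inner_left[OF Ck_on_has_derivative[OF f2 that]]]
      by metis
    have "Ck_on (Suc 0) S (\<lambda>q. frechet_derivative f (at q) v)" using f2 by (metis Ck_on.simps(2))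
    note has_derivative_inner_left[OF Ck_on_has_derivative[OF this p], of b]
    from has_derivative_transform_within_open[OF this S p 1] show ?thesis
      using frechet_derivative_at by metis
  qed
  have "Ck_on 2 S (\<lambda>p. f p \<bullet> b)" for b
    using Ck_on_bounded_linear[OF bounded_linear_inner_left S f] .
  then show ?thesis
    using mixed_derivatives_commute_real[OF S p, of "\<lambda>p. f p \<bullet> b" v w for b] *
    by (metis vector_eq_rdot)
qed

section \<open>Symmetric matrices and determinants\<close>

text \<open>A maximizer of the quadratic form on the unit sphere of \<open>W\<close> is an
  eigenvector. The invariant subspace \<open>W\<close> is there so that the argument can be repeated
  on orthogonal complements.\<close>

lemma self_adjoint_eigenvector_exists:
  fixes f :: "'a::euclidean_space \<Rightarrow> 'a"
  assumes f: "linear f" "\<And>x y. x \<bullet> f y = f x \<bullet> y"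
    and W: "subspace W" "\<And>x. x \<in> W \<Longrightarrow> f x \<in> W" "x0 \<in> W" "x0 \<noteq> 0"
  obtains v c where "v \<in> W" "norm v = 1" "f v = c *\<^sub>R v"
proof -
  let ?S = "sphere 0 1 \<inter> W"
  have cf: "continuous_on X f" for X using f(1) linear_continuous_on linear_conv_bounded_linear by blast
  have "compact ?S" by (intro compact_Int_closed closed_subspace W) auto
  moreover have "x0 /\<^sub>R norm x0 \<in> ?S" using W by (simp add: subspace_scale)
  ultimately obtain v where v: "v \<in> ?S" "\<And>y. y \<in> ?S \<Longrightarrow> y \<bullet> f y \<le> v \<bullet> f v"
    using continuous_attains_sup[of ?S "\<lambda>x. x \<bullet> f x"] continuous_on_inner[OF continuous_on_id cf, of ?S]
    by blast
  define c where "c = v \<bullet> f v"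
  have max: "y \<bullet> f y \<le> c * (y \<bullet> y)" if "y \<in> W" for y
  proof (cases "y = 0")
    case True
    then show ?thesis by simp
  next
    case False
    then have "y /\<^sub>R norm y \<in> ?S" using that W by (simp add: subspace_scale)
    from v(2)[OF this] have "(y \<bullet> f y) / (norm y)^2 \<le> c"
      using f(1) by (simp add: c_def linear_scale power2_eq_square divide_inverse ac_simps)
    then show ?thesis using False by (simp add: divide_le_eq power2_norm_eq_inner)
  qed
  define r where "r = f v - c *\<^sub>R v"
  have vv: "v \<bullet> v = 1" "v \<in> W" using v(1) by (auto simp: norm_eq_1)
  have r: "r \<in> W" using vv W by (simp add: r_def subspace_diff subspace_scale)
  define b where "b = r \<bullet> f r - c * (r \<bullet> r)"
  \<comment> \<open>Maximality is tested at \<open>v + t r\<close> with the residual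
    \<open>r = f v - c v\<close>, which stays in \<open>W\<close>. The coefficient of
    \<open>t\<close> is 2 <r, f v - c v>, that is 2 <r, r>.\<close>
  have ineq: "2 * t * (r \<bullet> r) + t * t * b \<le> 0" for t
  proof -
    have "v + t *\<^sub>R r \<in> W" using vv r W by (simp add: subspace_add subspace_scale)
    moreover have "f (v + t *\<^sub>R r) = f v + t *\<^sub>R f r" using f(1) by (simp add: linear_add linear_scale)
    moreover have "v \<bullet> f r = r \<bullet> f v" using f(2)[of v r] by (simp add: inner_commute)
    ultimately have "v \<bullet> f v + 2 * t * (r \<bullet> f v) + t * t * (r \<bullet> f r)
        \<le> c * (v \<bullet> v + 2 * t * (r \<bullet> v) + t * t * (r \<bullet> r))"
      using max[of "v + t *\<^sub>R r"]
      by (simp add: inner_add_left inner_add_right inner_commute[of v r] distrib_left)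
    then have "2 * t * (r \<bullet> f v - c * (r \<bullet> v)) + t * t * b \<le> 0"
      using vv unfolding b_def c_def by (simp add: algebra_simps)
    then show ?thesis by (simp add: r_def inner_diff_right)
  qed
  have "r \<bullet> r = 0"
  proof (rule ccontr)
    assume "r \<bullet> r \<noteq> 0"
    then have a: "r \<bullet> r > 0" by (simp add: less_le)
    \<comment> \<open>Small enough that the quadratic term cannot outweigh the linear one, whatever
      the sign of \<open>b\<close>.\<close>
    define t where "t = (r \<bullet> r) / (\<bar>b\<bar> + 1)"
    have t: "t > 0" "t * \<bar>b\<bar> \<le> r \<bullet> r" using a by (auto simp: t_def field_simps intro!: divide_pos_pos)
    have "0 < t * (r \<bullet> r)" using t a by simp
    also have "\<dots> \<le> t * (2 * (r \<bullet> r) - t * \<bar>b\<bar>)" using t by (intro mult_left_mono) auto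
    also have "t * t * (- \<bar>b\<bar>) \<le> t * t * b" by (intro mult_left_mono) auto
    then have "t * (2 * (r \<bullet> r) - t * \<bar>b\<bar>) \<le> 2 * t * (r \<bullet> r) + t * t * b"
      by (simp add: algebra_simps)
    finally show False using ineq[of t] by simp
  qed
  then have "f v = c *\<^sub>R v" by (simp add: r_def)
  then show ?thesis using that vv by (simp add: norm_eq_1)
qed

text \<open>Self-adjointness makes the orthogonal complement of the eigenvectors found so far
  invariant, and for fewer than \<open>DIM('a)\<close> of them it contains a nonzero vector.\<close>

lemma self_adjoint_orthonormal_eigenvectors:
  fixes f :: "'a::euclidean_space \<Rightarrow> 'a"
  assumes f: "linear f" "\<And>x y. x \<bullet> f y = f x \<bullet> y" and k: "k \<le> DIM('a)"
  shows "\<exists>B. finite B \<and> card B = k \<and> pairwise orthogonal B \<and> (\<forall>b\<in>B. norm b = 1 \<and> (\<exists>c. f b = c *\<^sub>R b))"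
  using k
proof (induction k)
  case 0
  show ?case by (intro exI[of _ "{}"]) auto
next
  case (Suc k)
  then obtain B where B: "finite B" "card B = k" "pairwise orthogonal B"
    "\<And>b. b \<in> B \<Longrightarrow> norm b = 1" "\<And>b. b \<in> B \<Longrightarrow> \<exists>c. f b = c *\<^sub>R b" by auto
  let ?W = "{x. \<forall>b\<in>B. x \<bullet> b = 0}"
  have W: "subspace ?W" by (auto simp: subspace_def inner_add_left)
  have inv: "f x \<in> ?W" if "x \<in> ?W" for x
  proof (intro CollectI ballI)
    fix b assume b: "b \<in> B"
    obtain c where "f b = c *\<^sub>R b" using B(5)[OF b] by blast
    then show "f x \<bullet> b = 0" using that b f(2)[of x b] by simp
  qed
  have "dim B < DIM('a)" using dim_le_card[OF _ B(1), of B] B(2) Suc.prems span_superset by force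
  then obtain x0 where x0: "x0 \<noteq> 0" "\<And>y. y \<in> span B \<Longrightarrow> orthogonal x0 y"
    using orthogonal_to_subspace_exists by blast
  have "x0 \<in> ?W" using x0(2) by (auto simp: orthogonal_def span_base)
  from self_adjoint_eigenvector_exists[OF f W inv this x0(1)]
  obtain v c where v: "v \<in> ?W" "norm v = 1" "f v = c *\<^sub>R v" by blast
  have "v \<notin> B" using v(1,2) by (auto simp: norm_eq_1)
  then show ?case
    using B v by (intro exI[of _ "insert v B"])
      (auto simp: pairwise_insert orthogonal_def[of v] orthogonal_def[of _ v] inner_commute)
qed

section \<open>Diagonalization by orthogonal matrices and by congruence\<close>

definition diag :: "('n \<Rightarrow> 'a::zero) \<Rightarrow> 'a ^ 'n ^ 'n" where
  "diag d = (\<chi> i j. if i = j then d i else 0)"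

lemma det_diag: "det (diag d) = (\<Prod>i\<in>UNIV. d i)"
  by (simp add: diag_def det_diagonal)

text \<open>The orthonormal eigenvectors are the rows of \<open>Q\<close>, so the conjugation reads
  \<open>Q ** K ** transpose Q\<close>, with entries <g_i, K g_j>.\<close>

lemma symmetric_matrix_diagonalizable:
  fixes K :: "real ^ 'n::finite ^ 'n"
  assumes "transpose K = K"
  obtains Q :: "real ^ 'n ^ 'n" and d where "Q ** transpose Q = mat 1" "Q ** K ** transpose Q = diag d"
proof -
  have sa: "x \<bullet> (K *v y) = (K *v x) \<bullet> y" for x y
    using assms by (metis dot_lmul_matrix transpose_matrix_vector)
  obtain B where B: "finite B" "card B = CARD('n)" "pairwise orthogonal B"
    "\<And>b. b \<in> B \<Longrightarrow> norm b = 1" "\<And>b. b \<in> B \<Longrightarrow> \<exists>c. K *v b = c *\<^sub>R b"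
    using self_adjoint_orthonormal_eigenvectors[of "(*v) K" "DIM(real^'n)"] sa by auto
  obtain g :: "'n \<Rightarrow> real ^ 'n" where g: "bij_betw g UNIV B"
    using B(1,2) finite_same_card_bij[of "UNIV :: 'n set" B] by auto
  have gB: "g i \<in> B" for i using g by (auto simp: bij_betw_def)
  obtain d where d: "\<And>i. K *v g i = d i *\<^sub>R g i" using B(5)[OF gB] by metis
  have orth: "g i \<bullet> g j = (if i = j then 1 else 0)" for i j
  proof (cases "i = j")
    case True
    then show ?thesis using B(4)[OF gB] by (simp add: norm_eq_1)
  next
    case False
    then have "g i \<noteq> g j" using g by (metis UNIV_I bij_betw_def inj_on_def)
    then show ?thesis using B(3) gB False by (auto simp: pairwise_def orthogonal_def)
  qed
  have "(\<chi> i. g i) ** transpose (\<chi> i. g i) = mat 1"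
    using orth by (simp add: vec_eq_iff matrix_matrix_mult_def transpose_def mat_def inner_vec_def)
  moreover have "(\<chi> i. g i) ** K ** transpose (\<chi> i. g i) = diag d"
  proof -
    have "((\<chi> i. g i) ** (K ** transpose (\<chi> i. g i))) $ i $ j = g i \<bullet> (K *v g j)" for i j
      by (simp add: matrix_matrix_mult_def transpose_def inner_vec_def matrix_vector_mult_def)
    then show ?thesis using orth d by (simp add: vec_eq_iff diag_def matrix_mul_assoc)
  qed
  ultimately show ?thesis using that by blast
qed

lemma positive_definite_congruence:
  fixes K S :: "real ^ 'n::finite ^ 'n"
  assumes "invertible S"
  shows "positive_definite (S ** K ** transpose S) \<longleftrightarrow> positive_definite K"
proof -
  have key: "positive_definite (S ** K ** transpose S)"
    if K: "positive_definite K" and S: "invertible S" for S K :: "real ^ 'n ^ 'n"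
    unfolding positive_definite_def
  proof (intro allI impI)
    fix v :: "real ^ 'n" assume "v \<noteq> 0"
    then have "transpose S *v v \<noteq> 0"
      using S by (metis invertible_left_inverse transpose_invertible matrix_left_invertible_ker)
    then have "(transpose S *v v) \<bullet> (K *v (transpose S *v v)) > 0"
      using K by (simp add: positive_definite_def)
    then show "v \<bullet> ((S ** K ** transpose S) *v v) > 0"
      by (metis dot_lmul_matrix matrix_vector_mul_assoc transpose_matrix_vector transpose_transpose)
  qed
  from assms obtain T where T: "S ** T = mat 1" "T ** S = mat 1" by (auto simp: invertible_def)
  have "T ** (S ** K ** transpose S) ** transpose T = (T ** S) ** K ** transpose (T ** S)"
    by (simp add: matrix_mul_assoc matrix_transpose_mul)
  then have "T ** (S ** K ** transpose S) ** transpose T = K" by (simp add: T)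
  then show ?thesis using key[of K S] key[of "S ** K ** transpose S" T] assms T
    by (metis invertible_def)
qed

lemma positive_definite_diag: "positive_definite (diag d) \<longleftrightarrow> (\<forall>i. 0 < d i)"
proof -
  have *: "v \<bullet> (diag d *v v) = (\<Sum>i\<in>UNIV. d i * (v $ i)\<^sup>2)" for v :: "real ^ 'a"
    by (simp add: inner_vec_def matrix_vector_mult_def diag_def if_distrib if_distribR
        power2_eq_square ac_simps cong: if_cong)
  show ?thesis
  proof
    assume pd: "positive_definite (diag d)"
    show "\<forall>i. 0 < d i"
    proof
      fix i
      have "(\<Sum>j\<in>UNIV. d j * (axis i 1 $ j)\<^sup>2) = d i"
        by (simp add: axis_def if_distrib if_distribR cong: if_cong)
      then show "0 < d i"
        using pd *[of "axis i 1"] unfolding positive_definite_def by (metis axis_eq_0_iff zero_neq_one)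
    qed
  next
    assume d: "\<forall>i. 0 < d i"
    show "positive_definite (diag d)" unfolding positive_definite_def *
    proof (intro allI impI)
      fix v :: "real ^ 'a" assume "v \<noteq> 0"
      then obtain i where "v $ i \<noteq> 0" by (auto simp: vec_eq_iff)
      then show "0 < (\<Sum>i\<in>UNIV. d i * (v $ i)\<^sup>2)"
        using d by (intro sum_pos2[of _ i]) (auto simp: less_imp_le)
    qed
  qed
qed

text \<open>\<open>K\<close> is an inner product for which \<open>B\<close> is self-adjoint. A first
  congruence \<open>R\<close> turns \<open>K\<close> into the identity; an orthogonal
  \<open>U\<close> then diagonalizes the symmetric matrix
  \<open>R ** (B ** K) ** transpose R\<close> without disturbing the identity. The product
  \<open>B ** K\<close> appears in this order because the lower index of the shape operator is the
  row index.\<close>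

lemma simultaneous_diagonalization:
  fixes K :: "real ^ 'n::finite ^ 'n"
  assumes K: "transpose K = K" "positive_definite K" and BK: "transpose (B ** K) = B ** K"
  obtains S :: "real ^ 'n ^ 'n" and d where "invertible S" "S ** K ** transpose S = mat 1" "S ** B = diag d ** S"
proof -
  obtain Q :: "real ^ 'n ^ 'n" and e where Q: "Q ** transpose Q = mat 1" "Q ** K ** transpose Q = diag e"
    by (rule symmetric_matrix_diagonalizable[OF K(1)])
  have "invertible Q" using Q(1) by (auto simp: invertible_right_inverse)
  then have e: "0 < e i" for i
    using positive_definite_congruence[of Q K] K(2) positive_definite_diag[of e] by (simp add: Q(2))
  \<comment> \<open>Dividing by the square roots of the eigenvalues, positive by definiteness,
    normalizes \<open>K\<close> to \<open>mat 1\<close>.\<close>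
  define R where "R = diag (\<lambda>i. 1 / sqrt (e i)) ** Q"
  have tD: "transpose (diag a) = diag a" for a :: "'n \<Rightarrow> real"
    by (auto simp: diag_def transpose_def vec_eq_iff)
  have DD: "diag a ** diag b = diag (\<lambda>i. a i * b i)" for a b :: "'n \<Rightarrow> real"
  proof -
    have "(\<Sum>k\<in>UNIV. diag a $ i $ k * diag b $ k $ j) =
        (\<Sum>k\<in>UNIV. if k = i then a i * diag b $ i $ j else 0)" for i j
      by (rule sum.cong) (auto simp: diag_def)
    then have "(diag a ** diag b) $ i $ j = a i * diag b $ i $ j" for i j
      by (simp add: matrix_matrix_mult_def)
    then show ?thesis by (simp add: vec_eq_iff diag_def)
  qed
  have D1: "diag (\<lambda>_. 1) = (mat 1 :: real ^ 'n ^ 'n)" by (simp add: diag_def mat_def)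
  have "R ** K ** transpose R =
      diag (\<lambda>i. 1 / sqrt (e i)) ** (Q ** K ** transpose Q) ** diag (\<lambda>i. 1 / sqrt (e i))"
    by (simp add: R_def matrix_transpose_mul tD matrix_mul_assoc)
  also have "\<dots> = diag (\<lambda>i. 1 / sqrt (e i) * e i * (1 / sqrt (e i)))"
    by (simp add: Q DD)
  also have "\<dots> = mat 1"
  proof -
    have "1 / sqrt (e i) * e i * (1 / sqrt (e i)) = 1" for i
      using e[of i] by (simp add: field_simps)
    then show ?thesis using D1 by presburger
  qed
  finally have R: "R ** K ** transpose R = mat 1" .
  have "transpose (R ** (B ** K) ** transpose R) = R ** (B ** K) ** transpose R"
    by (metis BK matrix_mul_assoc matrix_transpose_mul transpose_transpose)
  then obtain U :: "real ^ 'n ^ 'n" and d where U: "U ** transpose U = mat 1"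
    "U ** (R ** (B ** K) ** transpose R) ** transpose U = diag d"
    by (rule symmetric_matrix_diagonalizable)
  define S where "S = U ** R"
  have "S ** K ** transpose S = U ** (R ** K ** transpose R) ** transpose U"
    by (simp add: S_def matrix_transpose_mul matrix_mul_assoc)
  then have 1: "S ** K ** transpose S = mat 1" by (simp add: R U)
  \<comment> \<open>This exhibits \<open>K ** transpose S\<close> as the two-sided inverse of
    \<open>S\<close>, which converts the congruence diagonalizing \<open>B ** K\<close> into a
    similarity diagonalizing \<open>B\<close>.\<close>
  have "S ** (K ** transpose S) = mat 1" using 1 by (simp add: matrix_mul_assoc)
  then have inv: "(K ** transpose S) ** S = mat 1" and "invertible S"
    using matrix_left_right_inverse[of S "K ** transpose S"]
    by (auto simp: invertible_right_inverse)
  moreover have "S ** B ** K ** transpose S = diag d"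
    using U(2) by (simp add: S_def matrix_transpose_mul matrix_mul_assoc)
  then have "S ** B ** ((K ** transpose S) ** S) = diag d ** S"
    by (simp add: matrix_mul_assoc)
  ultimately show ?thesis using that 1 by simp
qed

section \<open>Characteristic polynomials under similarity\<close>

lemma poly_charpoly: "poly (charpoly B) t = det (t *\<^sub>R mat 1 - B)"
proof -
  have "poly (charpoly B) t = (\<Sum>p | p permutes UNIV. of_int (sign p) *
      (\<Prod>i\<in>UNIV. poly ((if i = p i then [:0, 1:] else 0) - [:B $ i $ p i:]) t))"
    by (simp add: charpoly_def det_def poly_sum poly_prod)
  also have "\<dots> = det (t *\<^sub>R mat 1 - B)"
    unfolding det_def
    by (intro sum.cong arg_cong2[where f = "(*)"] refl prod.cong) (auto simp: mat_def)
  finally show ?thesis .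
qed

text \<open>Two scalars cover both uses: \<open>a = t\<close>, \<open>b = 1\<close> gives the
  characteristic polynomial, and \<open>a = 1\<close>, \<open>b = m\<close> gives the determinant of
  the frame change to the parallel hypersurface.\<close>

lemma det_similar:
  fixes B D S :: "real ^ 'n::finite ^ 'n"
  assumes "invertible S" "S ** B = D ** S"
  shows "det (a *\<^sub>R mat 1 - b *\<^sub>R B) = det (a *\<^sub>R mat 1 - b *\<^sub>R D)"
proof -
  have s: "S ** (b *\<^sub>R B) = b *\<^sub>R (S ** B)" for S B :: "real ^ 'n ^ 'n" and b
    by (simp add: vec_eq_iff matrix_matrix_mult_def sum_distrib_left mult.left_commute)
  have s': "(b *\<^sub>R B) ** S = b *\<^sub>R (B ** S)" for S B :: "real ^ 'n ^ 'n" and b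
    by (simp add: vec_eq_iff matrix_matrix_mult_def sum_distrib_left mult.assoc)
  have l: "S ** (B - C) = S ** B - S ** C" and r: "(B - C) ** S = B ** S - C ** S"
    for S B C :: "real ^ 'n ^ 'n"
    by (simp_all add: vec_eq_iff matrix_matrix_mult_def sum_subtractf algebra_simps)
  have "S ** (a *\<^sub>R mat 1 - b *\<^sub>R B) = (a *\<^sub>R mat 1 - b *\<^sub>R D) ** S"
    by (simp add: l r s s' assms(2))
  then have "det S * det (a *\<^sub>R mat 1 - b *\<^sub>R B) = det (a *\<^sub>R mat 1 - b *\<^sub>R D) * det S"
    by (metis det_mul)
  moreover have "det S \<noteq> 0" using assms(1) invertible_det_nz by blast
  ultimately show ?thesis by simp
qed

lemma det_diag_combination:
  "det (a *\<^sub>R mat 1 - b *\<^sub>R diag d) = (\<Prod>i\<in>UNIV. a - b * d i)"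
proof -
  have "a *\<^sub>R mat 1 - b *\<^sub>R diag d = diag (\<lambda>i. a - b * d i)"
    by (simp add: diag_def mat_def vec_eq_iff)
  then show ?thesis by (simp add: det_diag)
qed

lemma charpoly_similar_diag:
  fixes B S :: "real ^ 'n::finite ^ 'n"
  assumes "invertible S" "S ** B = diag d ** S"
  shows "charpoly B = (\<Prod>i\<in>UNIV. [:- d i, 1:])"
proof (rule poly_ext)
  fix t
  show "poly (charpoly B) t = poly (\<Prod>i\<in>UNIV. [:- d i, 1:]) t"
    using det_similar[OF assms, of t 1] det_diag_combination[of t 1 d]
    by (simp add: poly_charpoly poly_prod)
qed

lemma proots_linear_factors: "proots (\<Prod>i\<in>UNIV. [:- d i, 1::real:]) = image_mset d (mset_set (UNIV :: 'n::finite set))"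
proof -
  have "proots (\<Prod>i\<in>S. [:- d i, 1:]) = image_mset d (mset_set S)" if "finite S" for S :: "'n set"
    using that
  proof (induction S)
    case (insert i S)
    have "(\<Prod>i\<in>S. [:- d i, 1:]) \<noteq> 0" by (simp add: insert prod_zero_iff)
    then show ?case using insert by (simp add: proots_mult del: mult_pCons_left mult_pCons_right)
  qed auto
  then show ?thesis by simp
qed

text \<open>Jacobi's formula for a derivative written as \<open>C v ** A p0\<close>. Replacing row i
  of A by row i of C A leaves C_ii det A, since the other rows of A in that combination occur twice.
  This form fits moving frames, whose derivatives are combinations of the frame.\<close>

lemma has_derivative_det:
  fixes A :: "'a::real_normed_vector \<Rightarrow> real ^ 'n::finite ^ 'n"
  assumes A: "\<And>i j. ((\<lambda>p. A p $ i $ j) has_derivative (\<lambda>v. (C v ** A p0) $ i $ j)) (at p0)"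
  shows "((\<lambda>p. det (A p)) has_derivative (\<lambda>v. trace (C v) * det (A p0))) (at p0)"
proof -
  have "((\<lambda>p. det (A p)) has_derivative (\<lambda>v. \<Sum>\<pi> | \<pi> permutes UNIV. of_int (sign \<pi>) *
      (\<Sum>i\<in>UNIV. (C v ** A p0) $ i $ \<pi> i * (\<Prod>j\<in>UNIV - {i}. A p0 $ j $ \<pi> j)))) (at p0)"
    unfolding det_def
    by (intro has_derivative_sum has_derivative_mult_right has_derivative_prod A)
  moreover have "(\<Sum>\<pi> | \<pi> permutes UNIV. of_int (sign \<pi>) *
      (\<Sum>i\<in>UNIV. (C v ** A p0) $ i $ \<pi> i * (\<Prod>j\<in>UNIV - {i}. A p0 $ j $ \<pi> j)))
      = trace (C v) * det (A p0)" for v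
  proof -
    let ?A = "A p0"
    have prod: "(C v ** ?A) $ i $ \<pi> i * (\<Prod>j\<in>UNIV - {i}. ?A $ j $ \<pi> j) =
        (\<Prod>j\<in>UNIV. (\<chi> k. if k = i then (C v ** ?A) $ i else ?A $ k) $ j $ \<pi> j)" for i \<pi>
      by (subst prod.remove[of UNIV i]) (auto intro!: prod.cong)
    have "(\<Sum>\<pi> | \<pi> permutes UNIV. of_int (sign \<pi>) *
        (\<Sum>i\<in>UNIV. (C v ** ?A) $ i $ \<pi> i * (\<Prod>j\<in>UNIV - {i}. ?A $ j $ \<pi> j)))
        = (\<Sum>i\<in>UNIV. det (\<chi> k. if k = i then (C v ** ?A) $ i else ?A $ k))"
      unfolding det_def prod sum_distrib_left by (rule sum.swap)
    also have "\<dots> = (\<Sum>i\<in>UNIV. C v $ i $ i * det ?A)"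
    proof (rule sum.cong[OF refl])
      fix i
      have row: "(C v ** ?A) $ i = (\<Sum>l\<in>UNIV. C v $ i $ l *s ?A $ l)"
        by (simp add: vec_eq_iff matrix_matrix_mult_def)
      have "det (\<chi> k. if k = i then (C v ** ?A) $ i else ?A $ k)
          = (\<Sum>l\<in>UNIV. C v $ i $ l * det (\<chi> k. if k = i then ?A $ l else ?A $ k))"
        unfolding row det_linear_row_sum[OF finite_class.finite_UNIV, of i "\<lambda>_ l. C v $ i $ l *s ?A $ l"]
        by (simp add: det_row_mul)
      also have "\<dots> = (\<Sum>l\<in>UNIV. if l = i then C v $ i $ i * det ?A else 0)"
      proof (rule sum.cong[OF refl])
        fix l
        show "C v $ i $ l * det (\<chi> k. if k = i then ?A $ l else ?A $ k) =
            (if l = i then C v $ i $ i * det ?A else 0)"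
        proof (cases "l = i")
          case True
          have "(\<chi> k. if k = i then ?A $ i else ?A $ k) = ?A" by (simp add: vec_eq_iff)
          then show ?thesis unfolding True by simp
        next
          case False
          have "det (\<chi> k. if k = i then ?A $ l else ?A $ k) = 0"
            by (rule det_identical_rows[of i l]) (use False in \<open>auto simp: row_def\<close>)
          then show ?thesis using False by simp
        qed
      qed
      finally show "det (\<chi> k. if k = i then (C v ** ?A) $ i else ?A $ k) = C v $ i $ i * det ?A"
        by simp
    qed
    finally show ?thesis by (simp add: trace_def sum_distrib_right)
  qed
  ultimately show ?thesis by simp
qed

section \<open>Scaling, definiteness and inverses of matrices\<close>

lemma det_scaleR: "det (a *\<^sub>R A) = a ^ CARD('n) * det A" for A :: "real ^ 'n::finite ^ 'n"
  by (simp add: det_def prod.distrib sum_distrib_left mult.left_commute)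

lemma positive_definite_diagonal_entry:
  assumes "positive_definite (K :: real ^ 'n::finite ^ 'n)"
  shows "0 < K $ i $ i"
proof -
  have "axis i 1 \<bullet> (K *v axis i 1) > 0"
    using assms by (simp add: positive_definite_def axis_eq_0_iff)
  then show ?thesis by (simp add: inner_axis' matrix_vector_mul_component inner_axis)
qed

lemma positive_definite_det:
  assumes "positive_definite (K :: real ^ 'n::finite ^ 'n)" "transpose K = K"
  shows "0 < det K"
proof -
  obtain Q :: "real ^ 'n ^ 'n" and e where
    Q: "Q ** transpose Q = mat 1" "Q ** K ** transpose Q = diag e"
    using symmetric_matrix_diagonalizable[OF assms(2)] by metis
  have "invertible Q" using Q(1) by (auto simp: invertible_right_inverse)
  then have "0 < e i" for i
    using positive_definite_congruence[of Q K] assms(1) positive_definite_diag[of e] by (simp add: Q(2))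
  then have "0 < (\<Prod>i\<in>UNIV. e i)" by (simp add: prod_pos)
  also have "\<dots> = det (Q ** transpose Q) * det K"
    using arg_cong[OF Q(2), of det] by (simp add: det_diag det_mul mult_ac)
  finally show ?thesis by (simp add: Q(1))
qed

lemma positive_definite_scaleR:
  "0 < a \<Longrightarrow> positive_definite (a *\<^sub>R K) \<longleftrightarrow> positive_definite K" for K :: "real ^ 'n::finite ^ 'n"
  by (simp add: positive_definite_def zero_less_mult_iff flip: scaleR_matrix_vector_assoc)

text \<open>Both scalars carry the sign of any diagonal entry of \<open>K\<close>;
  \<open>undefined\<close> merely names some index.\<close>

lemma positive_definite_scaleR_unique_sign:
  fixes K :: "real ^ 'n::finite ^ 'n"
  assumes "positive_definite (a *\<^sub>R K)" "positive_definite (b *\<^sub>R K)"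
  shows "0 < a * b"
  using positive_definite_diagonal_entry[OF assms(1), of undefined]
    positive_definite_diagonal_entry[OF assms(2), of undefined]
  by (auto simp: zero_less_mult_iff)

lemma matrix_inv_mult:
  assumes "invertible A"
  shows "A ** matrix_inv A = mat 1" "matrix_inv A ** A = mat 1"
  using someI_ex[OF assms[unfolded invertible_def]] unfolding matrix_inv_def by auto

text \<open>Cramer's rule displays each entry as a polynomial in the entries of \<open>G\<close>
  over \<open>det G\<close>, from which smoothness of the inverse is read off.\<close>

lemma matrix_inv_nth:
  fixes G :: "real ^ 'n::finite ^ 'n"
  assumes "det G \<noteq> 0"
  shows "matrix_inv G $ i $ j =
    det (\<chi> k l. if l = i then (if k = j then 1 else 0) else G $ k $ l) * inverse (det G)"
proof -
  have inv: "G ** matrix_inv G = mat 1"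
    using assms invertible_det_nz matrix_inv_mult(1) by blast
  have "G *v (matrix_inv G *v axis j 1) = axis j 1"
    by (simp add: matrix_vector_mul_assoc inv)
  then have "matrix_inv G *v axis j 1 =
      (\<chi> i. det (\<chi> k l. if l = i then axis j 1 $ k else G $ k $ l) / det G)"
    using cramer[OF assms] by blast
  then have "(matrix_inv G *v axis j 1) $ i = det (\<chi> k l. if l = i then axis j 1 $ k else G $ k $ l) / det G"
    by simp
  moreover have "(matrix_inv G *v axis j 1) $ i = matrix_inv G $ i $ j"
    by (simp add: matrix_vector_mult_basis column_def)
  moreover have ax: "axis j (1::real) $ k = (if k = j then 1 else 0)" for k by (simp add: axis_def)
  ultimately show ?thesis by (simp only: divide_inverse ax)
qed

lemma diag_mult_nth: "(diag a ** T) $ i $ j = a i * T $ i $ j" for T :: "real ^ 'm ^ 'n::finite"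
  by (simp add: matrix_matrix_mult_def diag_def if_distrib[of "\<lambda>a. a * _"] cong: if_cong)

lemma mult_mat_1_minus: "S ** (mat 1 - m *\<^sub>R B) = S - m *\<^sub>R (S ** B)"
  for S :: "real ^ 'n::finite ^ 'm"
  by (simp add: vec_eq_iff matrix_matrix_mult_def algebra_simps sum_subtractf sum_distrib_left mat_def
      if_distrib[of "\<lambda>a. _ * a"] if_distrib[of "\<lambda>a. a * _"] cong: if_cong)

section \<open>The conormal of a frame\<close>

lemma sum_option_UNIV:
  fixes g :: "'n::finite option \<Rightarrow> 'b::comm_monoid_add"
  shows "(\<Sum>s\<in>UNIV. g s) = g None + (\<Sum>i\<in>UNIV. g (Some i))"
  by (simp add: UNIV_option_conv sum.reindex)

text \<open>The transpose of the matrix inside \<open>Vol\<close>. With the frame as rows, a change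
  of frame is a left multiplication and the facts about linear independence of rows apply
  directly.\<close>

definition frame_rows :: "('n::finite \<Rightarrow> 'b ^ 'm) \<Rightarrow> 'b ^ 'm \<Rightarrow> 'b ^ 'm ^ ('n option)" where
  "frame_rows X e = (\<chi> s. case s of None \<Rightarrow> e | Some i \<Rightarrow> X i)"

text \<open>The generalized cross product of the frame, representing the functional
  \<open>Vol X\<close>. It serves as the algebraic test for independence: it vanishes exactly when
  the frame is dependent.\<close>

definition conormal :: "('n::finite \<Rightarrow> real ^ ('n option)) \<Rightarrow> real ^ ('n option)" where
  "conormal X = (\<chi> r. Vol X (axis r 1))"

lemma Vol_eq_det_frame_rows: "Vol X e = det (frame_rows X e)"
proof -
  have "transpose (frame_rows X e) = (\<chi> r s. (case s of None \<Rightarrow> e | Some i \<Rightarrow> X i) $ r)"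
    by (simp add: transpose_def frame_rows_def)
  then show ?thesis unfolding Vol_def by (metis det_transpose)
qed

lemma Vol_eq_conormal: "Vol X w = conormal X \<bullet> w"
proof -
  have fr: "frame_rows X e = (\<chi> s. if s = None then e else frame_rows X 0 $ s)" for e
    by (auto simp: frame_rows_def vec_eq_iff split: option.split)
  have w: "w = (\<Sum>r\<in>UNIV. w $ r *s axis r 1)" by (simp add: basis_expansion)
  have "Vol X w = det (\<chi> s. if s = None then (\<Sum>r\<in>UNIV. w $ r *s axis r 1) else frame_rows X 0 $ s)"
    unfolding Vol_eq_det_frame_rows fr[of w] using w by metis
  also have "\<dots> = (\<Sum>r\<in>UNIV. w $ r * det (\<chi> s. if s = None then axis r 1 else frame_rows X 0 $ s))"
    unfolding det_linear_row_sum[OF finite_class.finite_UNIV, of None "\<lambda>_ r. w $ r *s axis r 1"]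
    by (simp add: det_row_mul)
  also have "\<dots> = conormal X \<bullet> w"
    by (simp add: conormal_def inner_vec_def Vol_eq_det_frame_rows flip: fr) (simp add: mult.commute)
  finally show ?thesis .
qed

lemma conormal_orthogonal_frame: "conormal X \<bullet> X i = 0"
  unfolding Vol_eq_conormal[symmetric] Vol_eq_det_frame_rows
  by (rule det_identical_rows[of None "Some i"]) (auto simp: row_def frame_rows_def)

lemma sum_frame_rows:
  "(\<Sum>s\<in>UNIV. c s *s row s (frame_rows X e)) = c None *\<^sub>R e + (\<Sum>i\<in>UNIV. c (Some i) *\<^sub>R X i)"
  for X :: "'n::finite \<Rightarrow> real ^ 'm"
  by (simp add: sum_option_UNIV row_def frame_rows_def vec_eq_iff)

lemma frame_independent:
  assumes "conormal X \<noteq> 0" "(\<Sum>i\<in>UNIV. a i *\<^sub>R X i) = 0"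
  shows "a i = 0"
proof -
  obtain r where "conormal X $ r \<noteq> 0" using assms(1) by (auto simp: vec_eq_iff)
  then have "det (frame_rows X (axis r 1)) \<noteq> 0"
    by (simp add: conormal_def Vol_eq_det_frame_rows)
  then have "\<exists>B. frame_rows X (axis r 1) ** B = mat 1"
    using invertible_det_nz invertible_right_inverse by blast
  then have "(\<Sum>s\<in>UNIV. c s *s row s (frame_rows X (axis r 1))) = 0 \<Longrightarrow> c s = 0" for c s
    unfolding matrix_right_invertible_independent_rows by blast
  from this[of "\<lambda>s. case s of None \<Rightarrow> 0 | Some i \<Rightarrow> a i" "Some i"] show ?thesis
    using assms(2) unfolding sum_frame_rows by simp
qed

text \<open>The rows of an invertible matrix span the space, and pairing with the conormal, which
  annihilates the frame, identifies the coefficient of \<open>e\<close>.\<close>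

lemma frame_decomposition:
  assumes "conormal X \<bullet> e \<noteq> 0"
  obtains a where "w = (\<Sum>i\<in>UNIV. a i *\<^sub>R X i) + (conormal X \<bullet> w / (conormal X \<bullet> e)) *\<^sub>R e"
proof -
  have "det (frame_rows X e) \<noteq> 0" using assms by (metis Vol_eq_conormal Vol_eq_det_frame_rows)
  then have "\<exists>B. B ** frame_rows X e = mat 1"
    using invertible_det_nz invertible_left_inverse by blast
  then obtain B where "B ** frame_rows X e = mat 1" by blast
  then have "w v* (B ** frame_rows X e) = w" by simp
  then have "(w v* B) v* frame_rows X e = w" by (metis vector_matrix_mul_assoc)
  then have "w = (\<Sum>s\<in>UNIV. (w v* B) $ s *s row s (frame_rows X e))"
    by (simp add: vec_eq_iff vector_matrix_mult_def row_def mult.commute)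
  then obtain c where c: "w = (\<Sum>s\<in>UNIV. c s *s row s (frame_rows X e))" by blast
  then have w: "w = c None *\<^sub>R e + (\<Sum>i\<in>UNIV. c (Some i) *\<^sub>R X i)" unfolding sum_frame_rows .
  then have "conormal X \<bullet> w = c None * (conormal X \<bullet> e)"
    by (simp add: inner_add_right inner_sum_right conormal_orthogonal_frame)
  then have "c None = conormal X \<bullet> w / (conormal X \<bullet> e)" using assms by simp
  then show ?thesis using that[of "\<lambda>i. c (Some i)"] w by (simp add: add.commute)
qed

text \<open>The conormal is itself a transversal vector, since its product with itself is
  nonzero.\<close>

lemma tangent_decomposition:
  assumes "conormal X \<noteq> 0" "conormal X \<bullet> w = 0"
  obtains a where "w = (\<Sum>i\<in>UNIV. a i *\<^sub>R X i)"
proof -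
  have "conormal X \<bullet> conormal X \<noteq> 0" using assms(1) by simp
  from frame_decomposition[OF this, of w] assms(2) show ?thesis using that by auto
qed

text \<open>In dimension n+1 some nonzero \<open>e\<close> is orthogonal to the n frame vectors; it
  completes an independent frame to an invertible matrix, so the conormal pairs nontrivially with
  it.\<close>

lemma conormal_nonzero:
  fixes X :: "'n::finite \<Rightarrow> real ^ ('n option)"
  assumes "\<And>a i. (\<Sum>i\<in>UNIV. a i *\<^sub>R X i) = 0 \<Longrightarrow> a i = 0"
  shows "conormal X \<noteq> 0"
proof -
  have "dim (range X) \<le> CARD('n)"
    using dim_le_card'[of "range X"] card_image_le[of UNIV X] by simp
  also have "\<dots> < DIM(real ^ ('n option))" by (simp add: card_UNIV_option)
  finally obtain e where e: "e \<noteq> 0" "\<And>y. y \<in> span (range X) \<Longrightarrow> orthogonal e y"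
    using orthogonal_to_subspace_exists by blast
  have "\<exists>B. frame_rows X e ** B = mat 1"
    unfolding matrix_right_invertible_independent_rows
  proof (intro allI impI)
    fix c s assume "(\<Sum>s\<in>UNIV. c s *s row s (frame_rows X e)) = 0"
    then have 0: "c None *\<^sub>R e + (\<Sum>i\<in>UNIV. c (Some i) *\<^sub>R X i) = 0" unfolding sum_frame_rows .
    then have "e \<bullet> (c None *\<^sub>R e + (\<Sum>i\<in>UNIV. c (Some i) *\<^sub>R X i)) = 0" by simp
    moreover have "e \<bullet> X i = 0" for i using e(2)[of "X i"] by (simp add: span_base orthogonal_def)
    ultimately have n: "c None = 0" using e(1) by (simp add: inner_add_right inner_sum_right)
    show "c s = 0"
    proof (cases s)
      case (Some i)
      show ?thesis using assms[of "\<lambda>i. c (Some i)" i] 0 n Some by simp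
    qed (use n in simp)
  qed
  then have "det (frame_rows X e) \<noteq> 0" using invertible_det_nz invertible_right_inverse by blast
  then have "conormal X \<bullet> e \<noteq> 0" by (metis Vol_eq_conormal Vol_eq_det_frame_rows)
  then show ?thesis by auto
qed

text \<open>The block matrix with blocks 1 and \<open>P\<close>: a change of frame that leaves the
  transversal vector fixed.\<close>

definition border :: "real ^ 'n::finite ^ 'n \<Rightarrow> real ^ ('n option) ^ ('n option)" where
  "border P = (\<chi> r s. case r of None \<Rightarrow> if s = None then 1 else 0
     | Some i \<Rightarrow> (case s of None \<Rightarrow> 0 | Some j \<Rightarrow> P $ i $ j))"

lemma border_nth [simp]:
  "border P $ None $ None = 1" "border P $ None $ Some j = 0" "border P $ Some i $ None = 0"
  "border P $ Some i $ Some j = P $ i $ j"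
  by (simp_all add: border_def)

lemma option_vec_eqI:
  fixes A B :: "'b ^ 'm::finite option ^ 'n::finite option"
  assumes "A $ None $ None = B $ None $ None" "\<And>j. A $ None $ Some j = B $ None $ Some j"
    "\<And>i. A $ Some i $ None = B $ Some i $ None" "\<And>i j. A $ Some i $ Some j = B $ Some i $ Some j"
  shows "A = B"
  unfolding vec_eq_iff by (metis assms not_None_eq)

lemma border_mult: "border (A ** B) = border A ** border B"
  by (rule option_vec_eqI) (simp_all add: matrix_matrix_mult_def sum_option_UNIV)

lemma det_transposition_matrix:
  assumes "m \<noteq> n"
  shows "det (\<chi> i j. mat 1 $ i $ Transposition.transpose m n j :: real ^ 'n::finite ^ 'n) = -1"
  using det_permute_columns[of "Transposition.transpose m n" "mat 1 :: real ^ 'n ^ 'n"] assms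
  by (simp add: permutes_swap_id sign_swap_id)

lemma det_row_addition_matrix:
  assumes "m \<noteq> n"
  shows "det (\<chi> i j. if i = m \<and> j = n then c else of_bool (i = j) :: real ^ 'n::finite ^ 'n) = 1"
proof -
  have "(\<chi> i j. if i = m \<and> j = n then c else of_bool (i = j) :: real ^ 'n ^ 'n)
      = (\<chi> k. if k = m then row m (mat 1) + c *s row n (mat 1) else row k (mat 1))"
    using assms by (auto simp: vec_eq_iff row_def mat_def)
  then show ?thesis using det_row_operation[OF assms, of "mat 1" c] by (simp add: det_I)
qed

text \<open>Both sides are multiplicative, so it suffices to compare them on matrices with a zero
  row, diagonal matrices, transpositions and row additions, which generate all matrices.\<close>

lemma det_border: "det (border P) = det P"
proof (induction P rule: induct_matrix_elementary)
  case (1 A B)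
  then show ?case by (simp add: border_mult det_mul)
next
  case (2 A i)
  have "row (Some i) (border A) = 0"
  proof -
    have "border A $ Some i $ s = 0" for s
      using 2 by (cases s) (auto simp: row_def vec_eq_iff)
    then show ?thesis by (simp add: row_def vec_eq_iff)
  qed
  then show ?case using 2 det_zero_row by metis
next
  case (3 A)
  have "border A $ r $ s = 0" if "r \<noteq> s" for r s
    using that 3 by (cases r; cases s) auto
  then have "det (border A) = (\<Prod>s\<in>UNIV. border A $ s $ s)" by (rule det_diagonal)
  also have "\<dots> = (\<Prod>i\<in>UNIV. A $ i $ i)"
    by (simp add: UNIV_option_conv prod.reindex)
  finally show ?case using det_diagonal[of A] 3 by simp
next
  case (4 m n)
  have "border (\<chi> i j. mat 1 $ i $ Transposition.transpose m n j :: real ^ 'a ^ 'a)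
      = (\<chi> r s. mat 1 $ r $ Transposition.transpose (Some m) (Some n) s)"
    by (rule option_vec_eqI) (auto simp: mat_def Transposition.transpose_def)
  then show ?case using 4 by (simp add: det_transposition_matrix)
next
  case (5 m n c)
  have "border (\<chi> i j. if i = m \<and> j = n then c else of_bool (i = j) :: real ^ 'a ^ 'a)
      = (\<chi> r s. if r = Some m \<and> s = Some n then c else of_bool (r = s))"
    by (rule option_vec_eqI) auto
  then show ?case using 5 by (simp add: det_row_addition_matrix)
qed

text \<open>The common source of two transformation laws: \<open>P\<close> will be the Jacobian
  matrix of a change of chart, or \<open>1 - mB\<close> for a parallel hypersurface.\<close>

lemma conormal_frame_change:
  assumes "\<And>i. X i = (\<Sum>k\<in>UNIV. P $ i $ k *\<^sub>R Z k)"
  shows "conormal X = det P *\<^sub>R conormal Z"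
proof -
  have "Vol X e = det P * Vol Z e" for e
  proof -
    have "frame_rows X e $ r $ s = (border P ** frame_rows Z e) $ r $ s" for r s
      by (cases r) (simp_all add: matrix_matrix_mult_def sum_option_UNIV frame_rows_def assms)
    then have "frame_rows X e = border P ** frame_rows Z e" by (simp add: vec_eq_iff)
    then show ?thesis by (simp add: Vol_eq_det_frame_rows det_mul det_border)
  qed
  then show ?thesis by (simp add: conormal_def vec_eq_iff)
qed

section \<open>Frame derivatives in a chart\<close>

definition chart_smooth :: "('a, 'n::finite) chart \<Rightarrow> ('a \<Rightarrow> 'b::real_normed_vector) \<Rightarrow> bool" where
  "chart_smooth c f \<longleftrightarrow> smooth_on (snd c ` fst c) (in_chart c f)"

definition chart_differentiable ::
  "('a, 'n::finite) chart \<Rightarrow> ('a \<Rightarrow> 'b::real_normed_vector) \<Rightarrow> 'a \<Rightarrow> bool" where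
  "chart_differentiable c f u \<longleftrightarrow> in_chart c f differentiable at (snd c u)"

lemma smooth_map_iff_chart_smooth: "smooth_map A f \<longleftrightarrow> (\<forall>c\<in>A. chart_smooth c f)"
  by (simp add: smooth_map_def chart_smooth_def)

lemma differential_works:
  "chart_differentiable c f u \<Longrightarrow> (in_chart c f has_derivative differential c f u) (at (snd c u))"
  by (simp add: chart_differentiable_def differential_def frechet_derivative_works)

lemma differential_eqI:
  "(in_chart c f has_derivative D) (at (snd c u)) \<Longrightarrow> differential c f u = D"
  unfolding differential_def using frechet_derivative_at by metis

lemma chart_differentiableI:
  "(in_chart c f has_derivative D) (at (snd c u)) \<Longrightarrow> chart_differentiable c f u"
  unfolding chart_differentiable_def differentiable_def by blast

lemma differential_frame:
  assumes "chart_differentiable c f u"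
  shows "differential c f u v = (\<Sum>i\<in>UNIV. v $ i *\<^sub>R frame_deriv c i f u)"
proof -
  have lin: "linear (differential c f u)"
    using assms by (simp add: chart_differentiable_def differential_def linear_frechet_derivative)
  have "v = (\<Sum>i\<in>UNIV. v $ i *\<^sub>R axis i 1)"
    using basis_expansion[of v] by (simp add: scalar_mult_eq_scaleR)
  then have "differential c f u v = differential c f u (\<Sum>i\<in>UNIV. v $ i *\<^sub>R axis i 1)" by simp
  then show ?thesis by (simp add: linear_sum[OF lin] linear_scale[OF lin] frame_deriv_def)
qed

text \<open>The calculus in one chart rests on these two facts, so the topology of the manifold
  enters it only through openness of coordinate images.\<close>

locale chart_domain =
  fixes c :: "('a, 'n::finite) chart"
  assumes inj: "inj_on (snd c) (fst c)" and open_image: "open (snd c ` fst c)"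
begin

lemma in_chart_apply [simp]: "u \<in> fst c \<Longrightarrow> in_chart c f (snd c u) = f u"
  by (simp add: in_chart_def inj)

lemma in_chart_frame_deriv:
  "p \<in> snd c ` fst c \<Longrightarrow>
    in_chart c (frame_deriv c i f) p = frechet_derivative (in_chart c f) (at p) (axis i 1)"
  by (auto simp: frame_deriv_def differential_def)

lemma smooth_cong:
  assumes "chart_smooth c f" "\<And>u. u \<in> fst c \<Longrightarrow> f u = g u"
  shows "chart_smooth c g"
  unfolding chart_smooth_def
  by (rule smooth_on_cong[OF open_image _ assms(1)[unfolded chart_smooth_def]])
    (auto simp: assms(2))

lemma smooth_differentiable: "chart_smooth c f \<Longrightarrow> u \<in> fst c \<Longrightarrow> chart_differentiable c f u"
  by (simp add: chart_smooth_def chart_differentiable_def smooth_on_differentiable)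

lemma smooth_const: "chart_smooth c (\<lambda>_. a)"
  by (simp add: chart_smooth_def in_chart_def o_def smooth_on_const[OF open_image])

lemma smooth_bounded_linear: "bounded_linear L \<Longrightarrow> chart_smooth c f \<Longrightarrow> chart_smooth c (\<lambda>u. L (f u))"
  using smooth_on_bounded_linear[OF _ open_image] by (simp add: chart_smooth_def in_chart_def o_def)

lemma smooth_add: "chart_smooth c f \<Longrightarrow> chart_smooth c g \<Longrightarrow> chart_smooth c (\<lambda>u. f u + g u)"
  using smooth_on_add[OF open_image] by (simp add: chart_smooth_def in_chart_def o_def)

lemma smooth_bounded_bilinear:
  "bounded_bilinear B \<Longrightarrow> chart_smooth c f \<Longrightarrow> chart_smooth c g \<Longrightarrow> chart_smooth c (\<lambda>u. B (f u) (g u))"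
  using smooth_on_bounded_bilinear[OF _ open_image] by (simp add: chart_smooth_def in_chart_def o_def)

lemmas smooth_scaleR = smooth_bounded_bilinear[OF bounded_bilinear_scaleR]
lemmas smooth_inner = smooth_bounded_bilinear[OF bounded_bilinear_inner]
lemmas smooth_mult = smooth_bounded_bilinear[OF bounded_bilinear_mult]

lemma smooth_sum:
  "finite S \<Longrightarrow> (\<And>i. i \<in> S \<Longrightarrow> chart_smooth c (f i)) \<Longrightarrow> chart_smooth c (\<lambda>u. \<Sum>i\<in>S. f i u)"
  by (induction S rule: finite_induct) (simp_all add: smooth_const smooth_add)

lemma smooth_prod:
  fixes f :: "'i \<Rightarrow> 'a \<Rightarrow> real"
  shows "finite S \<Longrightarrow> (\<And>i. i \<in> S \<Longrightarrow> chart_smooth c (f i)) \<Longrightarrow> chart_smooth c (\<lambda>u. \<Prod>i\<in>S. f i u)"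
  by (induction S rule: finite_induct) (simp_all add: smooth_const smooth_mult)

lemma smooth_det:
  fixes f :: "'a \<Rightarrow> real ^ 'm::finite ^ 'm"
  shows "(\<And>i j. chart_smooth c (\<lambda>u. f u $ i $ j)) \<Longrightarrow> chart_smooth c (\<lambda>u. det (f u))"
  unfolding det_def by (intro smooth_sum smooth_mult smooth_const smooth_prod) auto

lemma smooth_nth: "chart_smooth c f \<Longrightarrow> chart_smooth c (\<lambda>u. f u $ i)"
  for f :: "'a \<Rightarrow> 'b::real_normed_vector ^ 'm::finite"
  by (rule smooth_bounded_linear[OF bounded_linear_vec_nth])

lemma smooth_vec:
  fixes f :: "'m::finite \<Rightarrow> 'a \<Rightarrow> real"
  assumes "\<And>i. chart_smooth c (f i)"
  shows "chart_smooth c (\<lambda>u. \<chi> i. f i u)"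
proof -
  have "(\<chi> i. f i u) = (\<Sum>i\<in>UNIV. f i u *\<^sub>R axis i (1::real))" for u
    using basis_expansion[of "\<chi> i. f i u"] by (simp add: scalar_mult_eq_scaleR)
  then show ?thesis by (simp add: smooth_sum smooth_scaleR assms smooth_const)
qed

lemma smooth_powr:
  fixes f :: "'a \<Rightarrow> real"
  assumes "chart_smooth c f" "\<And>u. u \<in> fst c \<Longrightarrow> 0 < f u"
  shows "chart_smooth c (\<lambda>u. f u powr a)"
proof -
  have "0 < in_chart c f p" if "p \<in> snd c ` fst c" for p using assms(2) that by auto
  from smooth_on_powr[OF open_image assms(1)[unfolded chart_smooth_def] this]
  show ?thesis by (simp add: chart_smooth_def in_chart_def o_def)
qed

lemma smooth_inverse:
  fixes f :: "'a \<Rightarrow> real"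
  assumes "chart_smooth c f" "\<And>u. u \<in> fst c \<Longrightarrow> f u \<noteq> 0"
  shows "chart_smooth c (\<lambda>u. inverse (f u))"
proof -
  have pos: "0 < f u * f u" if "u \<in> fst c" for u
    using assms(2)[OF that] by (metis not_real_square_gt_zero)
  \<comment> \<open>Squaring makes the base of the power positive even where \<open>f\<close> is
    negative.\<close>
  have "chart_smooth c (\<lambda>u. f u * (f u * f u) powr - 1)"
    using assms(1) pos by (intro smooth_mult smooth_powr) auto
  then show ?thesis
  proof (rule smooth_cong)
    fix u assume u: "u \<in> fst c"
    then show "f u * (f u * f u) powr - 1 = inverse (f u)"
      using pos[OF u] assms(2)[OF u] by (simp add: powr_minus_divide field_simps)
  qed
qed

lemma smooth_matrix_inv:
  fixes G :: "'a \<Rightarrow> real ^ 'm::finite ^ 'm"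
  assumes "\<And>i j. chart_smooth c (\<lambda>u. G u $ i $ j)" "\<And>u. u \<in> fst c \<Longrightarrow> det (G u) \<noteq> 0"
  shows "chart_smooth c (\<lambda>u. matrix_inv (G u) $ i $ j)"
proof -
  have "chart_smooth c (\<lambda>u. det (\<chi> k l. if l = i then (if k = j then 1 else 0) else G u $ k $ l) *
      inverse (det (G u)))"
  proof (intro smooth_mult smooth_inverse smooth_det assms)
    show "chart_smooth c (\<lambda>u. (\<chi> k l. if l = i then if k = j then 1 else 0 else G u $ k $ l) $ k $ l)"
      for k l by (cases "l = i"; cases "k = j") (simp_all add: assms(1) smooth_const)
  qed auto
  then show ?thesis by (rule smooth_cong) (simp add: assms(2) matrix_inv_nth)
qed

lemma smooth_frame_deriv:
  assumes "chart_smooth c f"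
  shows "chart_smooth c (frame_deriv c i f)"
  unfolding chart_smooth_def
  by (rule smooth_on_cong[OF open_image in_chart_frame_deriv[symmetric]
        smooth_on_frechet_derivative[OF assms[unfolded chart_smooth_def]]])

lemma differential_cong:
  assumes "W \<subseteq> fst c" "open (snd c ` W)" "u \<in> W" "\<And>v. v \<in> W \<Longrightarrow> f v = g v"
  shows "differential c f u = differential c g u"
  unfolding differential_def
  by (rule frechet_derivative_cong_open[OF assms(2)]) (use assms in auto)

lemma frame_deriv_cong:
  assumes "W \<subseteq> fst c" "open (snd c ` W)" "u \<in> W" "\<And>v. v \<in> W \<Longrightarrow> f v = g v"
  shows "frame_deriv c i f u = frame_deriv c i g u"
  unfolding frame_deriv_def by (simp add: differential_cong[OF assms])

lemma frame_deriv_const: "frame_deriv c i (\<lambda>_. a) u = 0"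
proof -
  have "differential c (\<lambda>_. a) u = (\<lambda>_. 0)"
    by (rule differential_eqI) (simp add: in_chart_def o_def)
  then show ?thesis by (simp add: frame_deriv_def)
qed

lemma differentiable_bounded_linear:
  assumes "bounded_linear L" "chart_differentiable c f u"
  shows "chart_differentiable c (\<lambda>u. L (f u)) u"
  using bounded_linear.has_derivative[OF assms(1) differential_works[OF assms(2)]]
  by (intro chart_differentiableI) (simp add: in_chart_def o_def)

lemma frame_deriv_bounded_linear:
  assumes "bounded_linear L" "chart_differentiable c f u"
  shows "frame_deriv c i (\<lambda>u. L (f u)) u = L (frame_deriv c i f u)"
proof -
  have "differential c (\<lambda>u. L (f u)) u = (\<lambda>v. L (differential c f u v))"
    using bounded_linear.has_derivative[OF assms(1) differential_works[OF assms(2)]]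
    by (intro differential_eqI) (simp add: in_chart_def o_def)
  then show ?thesis by (simp add: frame_deriv_def)
qed

lemma differentiable_add:
  assumes "chart_differentiable c f u" "chart_differentiable c g u"
  shows "chart_differentiable c (\<lambda>u. f u + g u) u"
    "frame_deriv c i (\<lambda>u. f u + g u) u = frame_deriv c i f u + frame_deriv c i g u"
proof -
  have *: "(in_chart c (\<lambda>u. f u + g u) has_derivative
      (\<lambda>v. differential c f u v + differential c g u v)) (at (snd c u))"
    using has_derivative_add[OF differential_works[OF assms(1)] differential_works[OF assms(2)]]
    by (simp add: in_chart_def o_def)
  show "chart_differentiable c (\<lambda>u. f u + g u) u"
    "frame_deriv c i (\<lambda>u. f u + g u) u = frame_deriv c i f u + frame_deriv c i g u"
    using chart_differentiableI[OF *] differential_eqI[OF *] by (simp_all add: frame_deriv_def)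
qed

lemma frame_deriv_sum:
  assumes "finite S" "\<And>k. k \<in> S \<Longrightarrow> chart_differentiable c (f k) u"
  shows "frame_deriv c i (\<lambda>u. \<Sum>k\<in>S. f k u) u = (\<Sum>k\<in>S. frame_deriv c i (f k) u)"
proof -
  have "in_chart c (\<lambda>u. \<Sum>k\<in>S. f k u) = (\<lambda>p. \<Sum>k\<in>S. in_chart c (f k) p)"
    by (simp add: in_chart_def o_def)
  then have *: "(in_chart c (\<lambda>u. \<Sum>k\<in>S. f k u) has_derivative
      (\<lambda>v. \<Sum>k\<in>S. differential c (f k) u v)) (at (snd c u))"
    using has_derivative_sum[of S "\<lambda>k. in_chart c (f k)"] differential_works[OF assms(2)] by simp
  show ?thesis using differential_eqI[OF *] by (simp add: frame_deriv_def)
qed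

lemma differentiable_bounded_bilinear:
  assumes "bounded_bilinear B" "u \<in> fst c" "chart_differentiable c f u" "chart_differentiable c g u"
  shows "chart_differentiable c (\<lambda>u. B (f u) (g u)) u"
    "frame_deriv c i (\<lambda>u. B (f u) (g u)) u = B (f u) (frame_deriv c i g u) + B (frame_deriv c i f u) (g u)"
proof -
  have *: "(in_chart c (\<lambda>u. B (f u) (g u)) has_derivative
      (\<lambda>v. B (f u) (differential c g u v) + B (differential c f u v) (g u))) (at (snd c u))"
    using bounded_bilinear.FDERIV[OF assms(1) differential_works[OF assms(3)] differential_works[OF assms(4)]]
    by (simp add: assms(2)) (simp add: in_chart_def o_def)
  show "chart_differentiable c (\<lambda>u. B (f u) (g u)) u"
    "frame_deriv c i (\<lambda>u. B (f u) (g u)) u = B (f u) (frame_deriv c i g u) + B (frame_deriv c i f u) (g u)"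
    using chart_differentiableI[OF *] differential_eqI[OF *] by (simp_all add: frame_deriv_def)
qed

lemmas frame_deriv_scaleR = differentiable_bounded_bilinear(2)[OF bounded_bilinear_scaleR]
lemmas frame_deriv_inner = differentiable_bounded_bilinear(2)[OF bounded_bilinear_inner]
lemmas frame_deriv_mult = differentiable_bounded_bilinear(2)[OF bounded_bilinear_mult]

text \<open>The factor \<open>C\<close> is known only in the direction \<open>e_i\<close>, whereas
  \<open>has_derivative_det\<close> asks for one in every direction. The inverse of
  \<open>f u\<close> supplies it, and in direction \<open>e_i\<close> it reproduces
  \<open>C\<close>.\<close>

lemma frame_deriv_det:
  fixes f :: "'a \<Rightarrow> real ^ 'm::finite ^ 'm"
  assumes "u \<in> fst c" "\<And>k l. chart_differentiable c (\<lambda>u. f u $ k $ l) u"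
    "\<And>k l. frame_deriv c i (\<lambda>u. f u $ k $ l) u = (C ** f u) $ k $ l" "det (f u) \<noteq> 0"
  shows "frame_deriv c i (\<lambda>u. det (f u)) u = trace C * det (f u)"
proof -
  let ?D = "\<lambda>v. \<chi> k l. differential c (\<lambda>u. f u $ k $ l) u v"
  obtain G where G: "G ** f u = mat 1"
    using assms(4) invertible_det_nz invertible_left_inverse by blast
  have D: "?D v = (?D v ** G) ** f u" for v by (simp add: G flip: matrix_mul_assoc)
  have "((\<lambda>p. in_chart c f p $ k $ l) has_derivative (\<lambda>v. ?D v $ k $ l)) (at (snd c u))" for k l
    using differential_works[OF assms(2)[of k l]] by (simp add: in_chart_def o_def)
  moreover have "?D v ** G ** in_chart c f (snd c u) = ?D v" for v
    using D[of v] assms(1) by simp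
  ultimately have "((\<lambda>p. det (in_chart c f p)) has_derivative
      (\<lambda>v. trace (?D v ** G) * det (in_chart c f (snd c u)))) (at (snd c u))"
    by (intro has_derivative_det[where C = "\<lambda>v. ?D v ** G"]) simp
  then have *: "(in_chart c (\<lambda>u. det (f u)) has_derivative
      (\<lambda>v. trace (?D v ** G) * det (f u))) (at (snd c u))"
    using assms(1) by (simp add: in_chart_apply) (simp add: in_chart_def o_def)
  have "?D (axis i 1) = C ** f u"
    using assms(3) by (simp add: vec_eq_iff frame_deriv_def)
  then have "?D (axis i 1) ** G = C"
    using G matrix_left_right_inverse[of G "f u"] by (simp flip: matrix_mul_assoc)
  then show ?thesis using differential_eqI[OF *] by (simp add: frame_deriv_def)
qed

lemma frame_deriv_commute:
  fixes f :: "'a \<Rightarrow> 'b::real_inner"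
  assumes "chart_smooth c f" "u \<in> fst c"
  shows "frame_deriv c j (frame_deriv c i f) u = frame_deriv c i (frame_deriv c j f) u"
proof -
  have *: "frame_deriv c j (frame_deriv c i f) u = frechet_derivative
      (\<lambda>q. frechet_derivative (in_chart c f) (at q) (axis i 1)) (at (snd c u)) (axis j 1)" for i j
    unfolding frame_deriv_def[of c j] differential_def[of c "frame_deriv c i f"]
    by (rule fun_cong[OF frechet_derivative_cong_open[OF open_image]])
      (use assms(2) in_chart_frame_deriv in auto)
  show ?thesis unfolding *
    using assms by (intro mixed_derivatives_commute[OF open_image]) (auto simp: chart_smooth_def smooth_on_def)
qed

text \<open>Vanishing frame derivatives kill the whole differential, and a ball inside the
  coordinate image is convex.\<close>

lemma locally_constant:
  fixes f :: "'a \<Rightarrow> 'b::real_normed_vector"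
  assumes "u \<in> fst c" "\<And>v. v \<in> fst c \<Longrightarrow> chart_differentiable c f v"
    "\<And>v i. v \<in> fst c \<Longrightarrow> frame_deriv c i f v = 0"
  obtains e where "e > 0" "\<And>v. v \<in> fst c \<Longrightarrow> snd c v \<in> ball (snd c u) e \<Longrightarrow> f v = f u"
proof -
  obtain e where e: "e > 0" "ball (snd c u) e \<subseteq> snd c ` fst c"
    using open_image assms(1) unfolding open_contains_ball by blast
  have "(in_chart c f has_derivative (\<lambda>_. 0)) (at p within ball (snd c u) e)"
    if p: "p \<in> ball (snd c u) e" for p
  proof -
    obtain v where v: "v \<in> fst c" "p = snd c v" using e(2) p by blast
    have "differential c f v = (\<lambda>_. 0)"
      using differential_frame[OF assms(2)[OF v(1)]] assms(3)[OF v(1)] by auto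
    then show ?thesis
      using differential_works[OF assms(2)[OF v(1)]] v(2) has_derivative_at_withinI by metis
  qed
  then obtain a where a: "\<And>p. p \<in> ball (snd c u) e \<Longrightarrow> in_chart c f p = a"
    using has_derivative_zero_constant[OF convex_ball] by metis
  have "f v = f u" if "v \<in> fst c" "snd c v \<in> ball (snd c u) e" for v
    using a[OF that(2)] a[of "snd c u"] e(1) that(1) assms(1) by simp
  then show ?thesis using that e by blast
qed

end

lemma chart_change:
  assumes c: "chart_domain c" and c': "chart_domain c'"
    and W: "W \<subseteq> fst c \<inter> fst c'" "open (snd c ` W)" "u \<in> W"
    and trans: "chart_differentiable c (snd c') u" and f: "chart_differentiable c' f u"
  shows "chart_differentiable c f u"
    "frame_deriv c i f u = (\<Sum>k\<in>UNIV. frame_deriv c i (snd c') u $ k *\<^sub>R frame_deriv c' k f u)"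
proof -
  have eq: "in_chart c' f (in_chart c (snd c') p) = in_chart c f p" if p: "p \<in> snd c ` W" for p
  proof -
    obtain w where w: "w \<in> fst c" "w \<in> fst c'" "p = snd c w" using p W(1) by blast
    then show ?thesis
      by (simp add: chart_domain.in_chart_apply[OF c] chart_domain.in_chart_apply[OF c'])
  qed
  have u: "in_chart c (snd c') (snd c u) = snd c' u"
    using W chart_domain.in_chart_apply[OF c] by auto
  have "((\<lambda>p. in_chart c' f (in_chart c (snd c') p)) has_derivative
      (\<lambda>v. differential c' f u (differential c (snd c') u v))) (at (snd c u))"
    by (rule has_derivative_compose[OF differential_works[OF trans]])
      (simp add: u differential_works[OF f])
  from has_derivative_transform_within_open[OF this W(2) _ eq] W(3)
  have *: "(in_chart c f has_derivative
      (\<lambda>v. differential c' f u (differential c (snd c') u v))) (at (snd c u))" by blast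
  show "chart_differentiable c f u" by (rule chart_differentiableI[OF *])
  show "frame_deriv c i f u = (\<Sum>k\<in>UNIV. frame_deriv c i (snd c') u $ k *\<^sub>R frame_deriv c' k f u)"
    unfolding frame_deriv_def[of c i f] frame_deriv_def[of c i "snd c'"] differential_eqI[OF *]
    by (rule differential_frame[OF f])
qed

section \<open>Characterization of the affine normal\<close>

lemma conormal_frame_deriv [simp]: "conormal (\<lambda>i. frame_deriv c i x u) \<bullet> frame_deriv c k x u = 0"
  using conormal_orthogonal_frame[of "\<lambda>i. frame_deriv c i x u"] .

text \<open>Pairing with the conormal removes the tangential coefficients and leaves
  \<open>h\<close>, because \<open>Vol X e = 1\<close> says that the conormal pairs to 1 with
  \<open>e\<close>. This makes the definite description well defined and computable.\<close>

lemma second_form_eq: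
  assumes "conormal (\<lambda>i. frame_deriv c i x u) \<noteq> 0"
  shows "second_form c x u = (\<chi> i j. conormal (\<lambda>i. frame_deriv c i x u) \<bullet> frame_deriv c j (frame_deriv c i x) u)"
    (is "_ = ?h")
  unfolding second_form_def
proof (rule the_equality)
  let ?N = "conormal (\<lambda>i. frame_deriv c i x u)"
  \<comment> \<open>The conormal rescaled to unit volume; any transversal vector with
    \<open>?N \<bullet> e = 1\<close> would give the same \<open>h\<close>.\<close>
  define e where "e = ?N /\<^sub>R (?N \<bullet> ?N)"
  have e: "?N \<bullet> e = 1" using assms by (simp add: e_def)
  have "\<exists>a. frame_deriv c j (frame_deriv c i x) u =
      (\<Sum>k\<in>UNIV. a k *\<^sub>R frame_deriv c k x u) + ?h $ i $ j *\<^sub>R e" for i j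
    using frame_decomposition[of "\<lambda>i. frame_deriv c i x u" e "frame_deriv c j (frame_deriv c i x) u"] e
    by auto
  then have "frame_deriv c j (frame_deriv c i x) u =
      (\<Sum>k\<in>UNIV. (SOME a. frame_deriv c j (frame_deriv c i x) u =
      (\<Sum>k\<in>UNIV. a k *\<^sub>R frame_deriv c k x u) + ?h $ i $ j *\<^sub>R e) k *\<^sub>R frame_deriv c k x u)
      + ?h $ i $ j *\<^sub>R e" for i j
    by (rule someI_ex)
  then have "\<exists>\<Gamma>. \<forall>i j. frame_deriv c j (frame_deriv c i x) u =
      (\<Sum>k\<in>UNIV. \<Gamma> i j k *\<^sub>R frame_deriv c k x u) + ?h $ i $ j *\<^sub>R e"
    by (intro exI[of _ "\<lambda>i j. SOME a. frame_deriv c j (frame_deriv c i x) u =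
      (\<Sum>k\<in>UNIV. a k *\<^sub>R frame_deriv c k x u) + ?h $ i $ j *\<^sub>R e"] allI)
  then show "\<exists>e \<Gamma>. Vol (\<lambda>i. frame_deriv c i x u) e = 1 \<and>
     (\<forall>i j. frame_deriv c j (frame_deriv c i x) u =
        (\<Sum>k\<in>UNIV. \<Gamma> i j k *\<^sub>R frame_deriv c k x u) + ?h $ i $ j *\<^sub>R e)"
    using e unfolding Vol_eq_conormal by blast
next
  let ?N = "conormal (\<lambda>i. frame_deriv c i x u)"
  fix h assume "\<exists>e \<Gamma>. Vol (\<lambda>i. frame_deriv c i x u) e = 1 \<and>
     (\<forall>i j. frame_deriv c j (frame_deriv c i x) u =
        (\<Sum>k\<in>UNIV. \<Gamma> i j k *\<^sub>R frame_deriv c k x u) + h $ i $ j *\<^sub>R e)"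
  then obtain e \<Gamma> where e: "?N \<bullet> e = 1" "\<And>i j. frame_deriv c j (frame_deriv c i x) u =
        (\<Sum>k\<in>UNIV. \<Gamma> i j k *\<^sub>R frame_deriv c k x u) + h $ i $ j *\<^sub>R e"
    unfolding Vol_eq_conormal by blast
  have "?N \<bullet> frame_deriv c j (frame_deriv c i x) u = h $ i $ j" for i j
    unfolding e(2) by (simp add: inner_add_right inner_sum_right e(1))
  then show "h = ?h" by (simp add: vec_eq_iff)
qed

text \<open>Injectivity of the differential is stated through the conormal;
  \<open>hypersurface_iff\<close> proves the equivalence.\<close>

locale chart_immersion = chart_domain c for c :: "('a, 'n::finite) chart" +
  fixes x :: "'a \<Rightarrow> real ^ ('n option)"
  assumes smooth_x: "chart_smooth c x"
    and conormal_nz: "u \<in> fst c \<Longrightarrow> conormal (\<lambda>i. frame_deriv c i x u) \<noteq> 0"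
begin

abbreviation D where "D i f \<equiv> frame_deriv c i f"
abbreviation "N u \<equiv> conormal (\<lambda>i. frame_deriv c i x u)"
abbreviation "h u \<equiv> second_form c x u"

lemma second_form_nth: "u \<in> fst c \<Longrightarrow> h u $ i $ j = N u \<bullet> D j (D i x) u"
  by (simp add: second_form_eq conormal_nz)

lemma second_form_symmetric: "u \<in> fst c \<Longrightarrow> transpose (h u) = h u"
  by (simp add: vec_eq_iff transpose_def second_form_nth frame_deriv_commute[OF smooth_x])

lemma second_form_commute: "u \<in> fst c \<Longrightarrow> h u $ i $ j = h u $ j $ i"
  by (simp add: second_form_nth frame_deriv_commute[OF smooth_x])

lemma smooth_frame: "chart_smooth c (D i x)"
  by (rule smooth_frame_deriv[OF smooth_x])

lemma smooth_frame_rows: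
  "chart_smooth c Y \<Longrightarrow> chart_smooth c (\<lambda>u. frame_rows (\<lambda>i. D i x u) (Y u) $ r $ s)"
  by (cases r) (auto simp: frame_rows_def intro!: smooth_nth smooth_frame)

lemma smooth_conormal: "chart_smooth c N"
  unfolding conormal_def Vol_eq_det_frame_rows
  by (intro smooth_vec smooth_det smooth_frame_rows smooth_const)

lemma smooth_second_form: "chart_smooth c (\<lambda>u. h u $ i $ j)"
  by (rule smooth_cong[of "\<lambda>u. N u \<bullet> D j (D i x) u"])
    (auto simp: second_form_nth intro!: smooth_inner smooth_conormal smooth_frame_deriv smooth_x)

text \<open>Only the values of the conormal field are rescaled here, so no derivative of \<open>\<delta>\<close> is needed.\<close>

lemma second_form_via_conormal:
  assumes "W \<subseteq> fst c" "open (snd c ` W)" "u \<in> W"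
    and "chart_differentiable c \<zeta> u" "\<And>v i. v \<in> W \<Longrightarrow> \<zeta> v \<bullet> D i x v = 0" "N u = \<delta> *\<^sub>R \<zeta> u"
  shows "h u $ i $ j = - \<delta> * (D j \<zeta> u \<bullet> D i x u)"
proof -
  have u: "u \<in> fst c" using assms by blast
  have "D j (\<lambda>v. \<zeta> v \<bullet> D i x v) u = D j (\<lambda>_. 0) u"
    by (rule frame_deriv_cong[OF assms(1-3)]) (simp add: assms(5))
  then have "\<zeta> u \<bullet> D j (D i x) u + D j \<zeta> u \<bullet> D i x u = 0"
    using frame_deriv_inner[OF u assms(4) smooth_differentiable[OF smooth_frame u], of j i]
    by (simp add: frame_deriv_const)
  then have "\<zeta> u \<bullet> D j (D i x) u = - (D j \<zeta> u \<bullet> D i x u)" by (simp add: eq_neg_iff_add_eq_0)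
  then show ?thesis using assms(6) by (simp add: second_form_nth[OF u])
qed

lemma second_form_conormal: "u \<in> fst c \<Longrightarrow> D j N u \<bullet> D i x u = - h u $ i $ j"
  using second_form_via_conormal[of "fst c" u N 1 i j] open_image
    smooth_differentiable[OF smooth_conormal] by simp

end

text \<open>With \<open>\<nu> = Vol(x\<^sub>1,\<dots>,x\<^sub>n,Y)\<close> the Blaschke metric is \<open>h/\<nu>\<close>, and \<open>det h = \<nu>\<^sup>n\<^sup>+\<^sup>2\<close> says that its
  volume form is \<open>\<bar>\<nu>\<bar>\<close>; together with the tangency of \<open>dY\<close> this characterizes the affine normal.\<close>

definition affine_normal_at ::
  "('a, 'n::finite) chart \<Rightarrow> ('a \<Rightarrow> real ^ ('n option)) \<Rightarrow> ('a \<Rightarrow> real ^ ('n option)) \<Rightarrow> 'a \<Rightarrow> bool" where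
  "affine_normal_at c x Y u \<longleftrightarrow>
     positive_definite ((conormal (\<lambda>i. frame_deriv c i x u) \<bullet> Y u) *\<^sub>R second_form c x u) \<and>
     det (second_form c x u) = (conormal (\<lambda>i. frame_deriv c i x u) \<bullet> Y u) ^ (CARD('n) + 2) \<and>
     (\<forall>i. conormal (\<lambda>i. frame_deriv c i x u) \<bullet> frame_deriv c i Y u = 0)"

lemma affine_normal_at_nonzero:
  assumes "affine_normal_at c x Y u"
  shows "conormal (\<lambda>i. frame_deriv c i x u) \<bullet> Y u \<noteq> 0" "det (second_form c x u) \<noteq> 0"
  using assms positive_definite_diagonal_entry[of "(conormal (\<lambda>i. frame_deriv c i x u) \<bullet> Y u) *\<^sub>R second_form c x u"]
  by (auto simp: affine_normal_at_def)

context chart_immersion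
begin

text \<open>The two fields have to pass the test on a neighbourhood, not only at \<open>u\<close>,
  because the equality of their transversal components is differentiated.\<close>

lemma affine_normal_at_unique:
  assumes W: "W \<subseteq> fst c" "open (snd c ` W)" "u \<in> W"
    and YZ: "chart_differentiable c Y u" "chart_differentiable c Z u"
    and an: "\<And>v. v \<in> W \<Longrightarrow> affine_normal_at c x Y v" "\<And>v. v \<in> W \<Longrightarrow> affine_normal_at c x Z v"
  shows "Y u = Z u"
proof -
  have u: "u \<in> fst c" using W by blast
  \<comment> \<open>The power n+2 fixes the transversal component only up to sign; definiteness of
    both multiples of \<open>h\<close> fixes the sign.\<close>
  have same: "N v \<bullet> Y v = N v \<bullet> Z v" if "v \<in> W" for v
  proof -
    let ?a = "N v \<bullet> Y v" and ?b = "N v \<bullet> Z v"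
    have ab: "det (h v) = ?a ^ (CARD('n) + 2)" "det (h v) = ?b ^ (CARD('n) + 2)"
      and pd: "positive_definite (?a *\<^sub>R h v)" "positive_definite (?b *\<^sub>R h v)"
      using an[OF that] unfolding affine_normal_at_def by blast+
    have eq: "?a ^ (CARD('n) + 2) = ?b ^ (CARD('n) + 2)" by (rule trans[OF ab(1)[symmetric] ab(2)])
    have "0 < ?a * ?b" by (rule positive_definite_scaleR_unique_sign[OF pd])
    moreover have "\<bar>?a\<bar> ^ (CARD('n) + 2) = \<bar>?b\<bar> ^ (CARD('n) + 2)"
      using arg_cong[OF eq, of abs] by (simp only: power_abs)
    then have "\<bar>?a\<bar> = \<bar>?b\<bar>" by (rule power_eq_imp_eq_base) auto
    ultimately show ?thesis by (auto simp: zero_less_mult_iff)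
  qed
  define T where "T v = Y v + - Z v" for v
  have Z': "chart_differentiable c (\<lambda>v. - Z v) u" "D j (\<lambda>v. - Z v) u = - D j Z u" for j
    using frame_deriv_bounded_linear[OF bounded_linear_minus[OF bounded_linear_ident] YZ(2)]
      differentiable_bounded_linear[OF bounded_linear_minus[OF bounded_linear_ident] YZ(2)] by auto
  have T: "chart_differentiable c T u" "D j T u = D j Y u - D j Z u" for j
    unfolding T_def[abs_def] using differentiable_add[OF YZ(1) Z'(1)] Z'(2) by auto
  \<comment> \<open>In the derivative of <N, T> = 0 the term <N, dT> vanishes by tangency, leaving
    <dN, T> = 0. As dN represents -h on the frame, nondegeneracy of h forces T = 0.\<close>
  have "D j (\<lambda>v. N v \<bullet> T v) u = D j (\<lambda>_. 0) u" for j
    by (rule frame_deriv_cong[OF W]) (simp add: T_def inner_diff_right same)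
  then have "N u \<bullet> D j T u + D j N u \<bullet> T u = 0" for j
    using frame_deriv_inner[OF u smooth_differentiable[OF smooth_conormal u] T(1), of j]
    by (simp add: frame_deriv_const)
  moreover have "N u \<bullet> D j T u = 0" for j
    using an[OF W(3)] by (simp add: T(2) inner_diff_right affine_normal_at_def)
  ultimately have 0: "D j N u \<bullet> T u = 0" for j by simp
  obtain a where a: "T u = (\<Sum>i\<in>UNIV. a i *\<^sub>R D i x u)"
    using tangent_decomposition[OF conormal_nz[OF u], of "T u"] same[OF W(3)]
    by (auto simp: T_def inner_diff_right)
  have "(\<Sum>i\<in>UNIV. h u $ j $ i * a i) = 0" for j
    using 0[of j] unfolding a
    by (simp add: inner_sum_right second_form_conormal[OF u] sum_negf second_form_commute[OF u, of j] mult.commute)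
  then have "h u *v (\<chi> i. a i) = 0" by (simp add: vec_eq_iff matrix_vector_mult_def)
  moreover have "invertible (h u)"
    using affine_normal_at_nonzero(2)[OF an(1)[OF W(3)]] invertible_det_nz by blast
  ultimately have "(\<chi> i. a i) = 0"
    by (metis invertible_left_inverse matrix_left_invertible_ker)
  then have "a i = 0" for i by (simp add: vec_eq_iff)
  then have "T u = 0" using a by simp
  then show ?thesis by (simp add: T_def)
qed

end

text \<open>With d = det J the conormal is multiplied by d and h' becomes d J h' J^T. Hence \<nu> h
  gains the square of d together with a congruence, and both sides of the determinant condition gain
  d^(n+2).\<close>

lemma affine_normal_at_chart_change:
  fixes c c' :: "('a, 'n::finite) chart"
  assumes c: "chart_immersion c x" and c': "chart_immersion c' x"
    and W: "W \<subseteq> fst c \<inter> fst c'" "open (snd c ` W)" "u \<in> W"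
    and trans: "\<And>v. v \<in> W \<Longrightarrow> chart_differentiable c (snd c') v"
    and Y: "chart_differentiable c' Y u" "affine_normal_at c' x Y u"
  shows "affine_normal_at c x Y u"
proof -
  interpret c: chart_immersion c x by (rule c)
  interpret c': chart_immersion c' x by (rule c')
  define J where "J v = (\<chi> i k. frame_deriv c i (snd c') v $ k)" for v
  have change: "frame_deriv c i f v = (\<Sum>k\<in>UNIV. J v $ i $ k *\<^sub>R frame_deriv c' k f v)"
    "chart_differentiable c f v"
    if "v \<in> W" "chart_differentiable c' f v" for i v and f :: "'a \<Rightarrow> real ^ ('n option)"
    using chart_change[OF c.chart_domain_axioms c'.chart_domain_axioms W(1,2) that(1) trans[OF that(1)] that(2)]
    by (simp_all add: J_def)
  have u: "u \<in> fst c" "u \<in> fst c'" using W by auto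
  have Dx: "c.D i x v = (\<Sum>k\<in>UNIV. J v $ i $ k *\<^sub>R c'.D k x v)" if "v \<in> W" for i v
    using change(1)[OF that c'.smooth_differentiable[OF c'.smooth_x]] that W by blast
  have N: "c.N v = det (J v) *\<^sub>R c'.N v" if "v \<in> W" for v
    by (rule conormal_frame_change) (rule Dx[OF that])
  have dN': "chart_differentiable c' c'.N u"
    by (rule c'.smooth_differentiable[OF c'.smooth_conormal u(2)])
  let ?J = "J u" and ?d = "det (J u)"
  have d: "?d \<noteq> 0" using N[OF W(3)] c.conormal_nz[OF u(1)] by auto
  have "c.h u $ i $ j = (?d *\<^sub>R (?J ** c'.h u ** transpose ?J)) $ i $ j" for i j
  proof -
    \<comment> \<open>Using the derivative of the conormal of \<open>c'\<close>, rather than second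
      derivatives of \<open>x\<close>, keeps second derivatives of the coordinate change
      out.\<close>
    have "c.h u $ i $ j = - ?d * (c.D j c'.N u \<bullet> c.D i x u)"
    proof (rule c.second_form_via_conormal)
      show "c'.N v \<bullet> c.D i x v = 0" if "v \<in> W" for v i
        by (simp add: Dx[OF that] inner_sum_right)
    qed (use W change(2)[OF W(3) dN'] N in auto)
    also have "\<dots> = ?d * (\<Sum>k\<in>UNIV. \<Sum>l\<in>UNIV. ?J $ i $ k * ?J $ j $ l * c'.h u $ k $ l)"
      by (simp add: change(1)[OF W(3) dN'] Dx[OF W(3)] inner_sum_left inner_sum_right
          c'.second_form_conormal[OF u(2)] sum_negf sum_distrib_left mult_ac)
    also have "\<dots> = (?d *\<^sub>R (?J ** c'.h u ** transpose ?J)) $ i $ j"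
      by (subst sum.swap) (simp add: matrix_matrix_mult_def transpose_def sum_distrib_left sum_distrib_right mult_ac)
    finally show ?thesis .
  qed
  then have h: "c.h u = ?d *\<^sub>R (?J ** c'.h u ** transpose ?J)" by (simp add: vec_eq_iff)
  have nu: "c.N u \<bullet> Y u = ?d * (c'.N u \<bullet> Y u)" by (simp add: N[OF W(3)])
  have "invertible ?J" using d invertible_det_nz by blast
  moreover have s: "?J ** (a *\<^sub>R c'.h u) ** transpose ?J = a *\<^sub>R (?J ** c'.h u ** transpose ?J)" for a
    by (simp add: vec_eq_iff matrix_matrix_mult_def sum_distrib_left sum_distrib_right ac_simps)
  ultimately have "positive_definite ((c'.N u \<bullet> Y u) *\<^sub>R (?J ** c'.h u ** transpose ?J))"
    using positive_definite_congruence[of ?J "(c'.N u \<bullet> Y u) *\<^sub>R c'.h u"] Y(2)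
    by (simp add: affine_normal_at_def)
  moreover have "(c.N u \<bullet> Y u) *\<^sub>R c.h u = (?d * ?d) *\<^sub>R ((c'.N u \<bullet> Y u) *\<^sub>R (?J ** c'.h u ** transpose ?J))"
    by (simp add: nu h mult_ac)
  moreover have "0 < ?d * ?d" using d not_real_square_gt_zero by blast
  ultimately have 1: "positive_definite ((c.N u \<bullet> Y u) *\<^sub>R c.h u)"
    by (simp only: positive_definite_scaleR)
  have "det (c.h u) = ?d ^ CARD('n) * (?d * det (c'.h u) * ?d)"
    unfolding h by (simp add: det_scaleR det_mul)
  also have "\<dots> = ?d ^ (CARD('n) + 2) * (c'.N u \<bullet> Y u) ^ (CARD('n) + 2)"
    using Y(2) by (simp add: affine_normal_at_def power_add power2_eq_square)
  finally have 2: "det (c.h u) = (c.N u \<bullet> Y u) ^ (CARD('n) + 2)"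
    by (simp add: nu power_mult_distrib)
  have 3: "c.N u \<bullet> c.D i Y u = 0" for i
    using Y(2) by (simp add: N[OF W(3)] change(1)[OF W(3) Y(1)] inner_sum_right affine_normal_at_def)
  show ?thesis using 1 2 3 by (simp add: affine_normal_at_def)
qed

section \<open>The Laplacian of the position vector\<close>

locale convex_chart = chart_immersion +
  assumes convex: "u \<in> fst c \<Longrightarrow>
    positive_definite (second_form c x u) \<or> positive_definite (- second_form c x u)"
begin

text \<open>The sign of \<open>\<nu>\<close> encodes the orientation, which any diagonal entry of \<open>h\<close> detects.\<close>

definition nu :: "'a \<Rightarrow> real" where
  "nu u = (let a = undefined in sgn (h u $ a $ a) * \<bar>det (h u)\<bar> powr (1 / (real CARD('b) + 2)))"

abbreviation "g \<equiv> blaschke_metric c x"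

text \<open>The sign \<epsilon> that makes \<epsilon> h positive definite is the sign of each
  diagonal entry. Positivity of det(\<epsilon> h) = \<epsilon>^n det h then determines the sign of
  det h.\<close>

lemma orientation:
  assumes u: "u \<in> fst c"
  obtains \<epsilon> where "\<epsilon> * \<epsilon> = 1" "positive_definite (\<epsilon> *\<^sub>R h u)" "oriented_second_form c x u = \<epsilon> *\<^sub>R h u"
    "sgn (h u $ a $ a) = \<epsilon>" "det (h u) = \<epsilon> ^ CARD('b) * \<bar>det (h u)\<bar>" "det (h u) \<noteq> 0"
    "h u $ a $ a \<noteq> 0"
proof -
  define \<epsilon> where "\<epsilon> = (if positive_definite (h u) then 1 else - 1 :: real)"
  have 1: "\<epsilon> * \<epsilon> = 1" and 2: "positive_definite (\<epsilon> *\<^sub>R h u)" using convex[OF u] by (auto simp: \<epsilon>_def)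
  have 3: "oriented_second_form c x u = \<epsilon> *\<^sub>R h u"
    by (simp add: oriented_second_form_def \<epsilon>_def)
  have "0 < (\<epsilon> *\<^sub>R h u) $ a $ a" by (rule positive_definite_diagonal_entry[OF 2])
  then have 4: "sgn (h u $ a $ a) = \<epsilon>" "h u $ a $ a \<noteq> 0" by (auto simp: \<epsilon>_def split: if_splits)
  have "transpose (\<epsilon> *\<^sub>R h u) = \<epsilon> *\<^sub>R h u"
    using second_form_commute[OF u] by (simp add: vec_eq_iff transpose_def)
  from positive_definite_det[OF 2 this] have p: "0 < \<epsilon> ^ CARD('b) * det (h u)" by (simp add: det_scaleR)
  have "\<epsilon> ^ CARD('b) * \<epsilon> ^ CARD('b) = 1" by (simp add: 1 flip: power_mult_distrib)
  moreover have "\<bar>\<epsilon> ^ CARD('b)\<bar> = 1" by (simp add: \<epsilon>_def power_abs)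
  then have "\<bar>det (h u)\<bar> = \<epsilon> ^ CARD('b) * det (h u)"
    using p by (metis abs_mult abs_of_pos mult_1)
  ultimately have 5: "det (h u) = \<epsilon> ^ CARD('b) * \<bar>det (h u)\<bar>" by (metis mult.assoc mult_1)
  have 6: "det (h u) \<noteq> 0" using p by auto
  show ?thesis using that[of \<epsilon>] 1 2 3 4 5 6 by blast
qed

text \<open>Here \<open>nu\<close> is \<epsilon> times the positive root of |det h|. Since
  \<epsilon> is its own inverse, dividing by \<open>nu\<close> orients h and yields the Blaschke
  metric, and \<epsilon>^(n+2) = \<epsilon>^n restores the sign of det h.\<close>

lemma nu_properties:
  assumes u: "u \<in> fst c"
  shows "nu u \<noteq> 0" "g u = inverse (nu u) *\<^sub>R h u" "positive_definite (nu u *\<^sub>R h u)"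
    "det (h u) = nu u ^ (CARD('b) + 2)" "det (h u) \<noteq> 0"
proof -
  obtain \<epsilon> where e: "\<epsilon> * \<epsilon> = 1" "positive_definite (\<epsilon> *\<^sub>R h u)" "oriented_second_form c x u = \<epsilon> *\<^sub>R h u"
    "sgn (h u $ undefined $ undefined) = \<epsilon>" "det (h u) = \<epsilon> ^ CARD('b) * \<bar>det (h u)\<bar>" "det (h u) \<noteq> 0"
    using orientation[OF u] by metis
  define r where "r = \<bar>det (h u)\<bar> powr (1 / (real CARD('b) + 2))"
  have r: "r > 0" using e(6) by (simp add: r_def)
  have rn: "r ^ (CARD('b) + 2) = \<bar>det (h u)\<bar>"
  proof -
    have "r ^ (CARD('b) + 2) = r powr real (CARD('b) + 2)" by (rule powr_realpow[OF r, symmetric])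
    also have "\<dots> = \<bar>det (h u)\<bar> powr (1 / (real CARD('b) + 2) * real (CARD('b) + 2))"
      by (simp only: r_def powr_powr)
    also have "1 / (real CARD('b) + 2) * real (CARD('b) + 2) = 1" by simp
    finally show ?thesis using e(6) by simp
  qed
  have nu: "nu u = \<epsilon> * r" by (simp add: nu_def e(4) r_def)
  have e0: "\<epsilon> \<noteq> 0" and ei: "inverse \<epsilon> = \<epsilon>" using e(1) by (auto simp: inverse_unique)
  have ea: "\<bar>\<epsilon> ^ CARD('b)\<bar> = 1"
    using e(1) by (metis abs_1 abs_mult_self_eq abs_square_eq_1 power2_eq_square power_abs power_one)
  show "nu u \<noteq> 0" using nu e0 r by simp
  have "\<bar>det (oriented_second_form c x u)\<bar> = \<bar>det (h u)\<bar>"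
    by (simp add: e(3) det_scaleR abs_mult ea)
  then have "g u = inverse r *\<^sub>R \<epsilon> *\<^sub>R h u"
    unfolding blaschke_metric_def e(3) r_def by (simp add: e(3)[symmetric] powr_minus[symmetric])
  then show "g u = inverse (nu u) *\<^sub>R h u" by (simp add: nu ei mult.commute)
  show "positive_definite (nu u *\<^sub>R h u)"
    using e(2) r positive_definite_scaleR[of r "\<epsilon> *\<^sub>R h u"] by (simp add: nu mult.commute)
  show "det (h u) = nu u ^ (CARD('b) + 2)"
  proof -
    have "nu u ^ (CARD('b) + 2) = \<epsilon> ^ (CARD('b) + 2) * r ^ (CARD('b) + 2)"
      by (simp only: nu power_mult_distrib)
    also have "\<epsilon> ^ (CARD('b) + 2) = \<epsilon> ^ CARD('b)"
      by (simp only: power_add power2_eq_square e(1) mult_1_right)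
    finally show ?thesis using e(5) by (simp only: rn)
  qed
  show "det (h u) \<noteq> 0" by (rule e(6))
qed

text \<open>Sign and absolute value are made smooth away from zero by sgn t = t (t^2)^(-1/2) and
  |t|^b = (t^2)^(b/2).\<close>

lemma smooth_nu: "chart_smooth c nu"
proof -
  let ?a = "undefined :: 'b"
  have nz: "h u $ ?a $ ?a \<noteq> 0" "det (h u) \<noteq> 0" if "u \<in> fst c" for u
    using orientation[OF that, of ?a] by metis+
  have "chart_smooth c (\<lambda>u. (h u $ ?a $ ?a * (h u $ ?a $ ?a * h u $ ?a $ ?a) powr (- 1 / 2)) *
      (det (h u) * det (h u)) powr (1 / (2 * (real CARD('b) + 2))))"
    by (intro smooth_mult smooth_powr smooth_det smooth_second_form)
      (use nz in \<open>auto simp: zero_less_mult_iff linorder_neq_iff\<close>)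
  then show ?thesis
  proof (rule smooth_cong)
    fix u assume u: "u \<in> fst c"
    have sq: "(t * t) powr (b / 2) = \<bar>t\<bar> powr b" if "t \<noteq> 0" for t b :: real
    proof -
      have "t * t = \<bar>t\<bar> powr 2" using that by (simp add: powr_numeral power2_eq_square)
      then show ?thesis by (simp only: powr_powr) simp
    qed
    have "h u $ ?a $ ?a * (h u $ ?a $ ?a * h u $ ?a $ ?a) powr (- 1 / 2) = sgn (h u $ ?a $ ?a)"
      using nz(1)[OF u] by (simp add: sq powr_minus sgn_if field_simps)
    moreover have "(det (h u) * det (h u)) powr (1 / (2 * (real CARD('b) + 2))) =
        \<bar>det (h u)\<bar> powr (1 / (real CARD('b) + 2))"
      using sq[OF nz(2)[OF u], of "1 / (real CARD('b) + 2)"] by (simp add: field_simps)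
    ultimately show "(h u $ ?a $ ?a * (h u $ ?a $ ?a * h u $ ?a $ ?a) powr (- 1 / 2)) *
      (det (h u) * det (h u)) powr (1 / (2 * (real CARD('b) + 2))) = nu u"
      by (simp add: nu_def)
  qed
qed

definition s :: "'a \<Rightarrow> real" where "s u = sqrt \<bar>det (g u)\<bar>"
definition ginv :: "'a \<Rightarrow> 'b \<Rightarrow> 'b \<Rightarrow> real" where "ginv u i j = matrix_inv (g u) $ i $ j"
text \<open>The Laplacian in the fixed chart \<open>c\<close>, in contrast to
  \<open>affine_normal\<close>, whose chart depends on the point. The two are identified in
  \<open>affine_normal_chart\<close>.\<close>

definition Y :: "'a \<Rightarrow> real ^ ('b option)" where "Y u = (1 / real CARD('b)) *\<^sub>R laplacian c g x u"

lemma metric_nth: "u \<in> fst c \<Longrightarrow> g u $ i $ j = inverse (nu u) * h u $ i $ j"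
  by (simp add: nu_properties)

text \<open>The exponents combine to \<nu>^(-n) \<nu>^(n+2), so the volume density of the Blaschke
  metric is |\<nu>|.\<close>

lemma det_metric: "u \<in> fst c \<Longrightarrow> det (g u) = nu u * nu u"
  by (simp add: nu_properties det_scaleR power2_eq_square power_inverse field_simps)

lemma s_properties: assumes "u \<in> fst c" shows "s u = \<bar>nu u\<bar>" "s u \<noteq> 0" "s u * s u = det (g u)"
  using assms nu_properties(1)[OF assms]
  by (auto simp: s_def det_metric abs_mult real_sqrt_mult)

lemma smooth_metric: "chart_smooth c (\<lambda>u. g u $ i $ j)"
proof -
  have "chart_smooth c (\<lambda>u. inverse (nu u) * h u $ i $ j)"
    by (intro smooth_mult smooth_inverse smooth_nu smooth_second_form nu_properties)
  then show ?thesis by (rule smooth_cong) (simp add: metric_nth)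
qed

lemma det_metric_nz: "u \<in> fst c \<Longrightarrow> det (g u) \<noteq> 0"
  using nu_properties(1)[of u] det_metric[of u] by auto

lemma smooth_ginv: "chart_smooth c (\<lambda>u. ginv u i j)"
  unfolding ginv_def by (rule smooth_matrix_inv[OF smooth_metric det_metric_nz])

lemma smooth_s: "chart_smooth c s"
proof -
  have "chart_smooth c (\<lambda>u. (nu u * nu u) powr (1 / 2))"
    using nu_properties(1) by (intro smooth_powr smooth_mult smooth_nu)
      (auto simp: zero_less_mult_iff linorder_neq_iff)
  then show ?thesis
    by (rule smooth_cong) (auto simp: s_def det_metric powr_half_sqrt)
qed

lemma ginv_mult:
  assumes "u \<in> fst c"
  shows "(\<Sum>j\<in>UNIV. ginv u i j * g u $ j $ k) = (if i = k then 1 else 0)"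
    "(\<Sum>j\<in>UNIV. g u $ i $ j * ginv u j k) = (if i = k then 1 else 0)"
proof -
  have inv: "invertible (g u)" using det_metric_nz[OF assms] invertible_det_nz by blast
  have "(matrix_inv (g u) ** g u) $ i $ k = (if i = k then 1 else 0)"
    "(g u ** matrix_inv (g u)) $ i $ k = (if i = k then 1 else 0)"
    unfolding matrix_inv_mult(2)[OF inv] matrix_inv_mult(1)[OF inv] by (simp_all add: mat_def)
  then show "(\<Sum>j\<in>UNIV. ginv u i j * g u $ j $ k) = (if i = k then 1 else 0)"
    "(\<Sum>j\<in>UNIV. g u $ i $ j * ginv u j k) = (if i = k then 1 else 0)"
    by (simp_all add: matrix_matrix_mult_def ginv_def)
qed

lemma differentiable_weight:
  "u \<in> fst c \<Longrightarrow> chart_differentiable c (\<lambda>v. s v * ginv v i j) u"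
  by (rule smooth_differentiable) (intro smooth_mult smooth_s smooth_ginv)

lemma smooth_Y: "chart_smooth c Y"
proof -
  have "chart_smooth c (\<lambda>u. (1 / real CARD('b)) *\<^sub>R inverse (s u) *\<^sub>R
      (\<Sum>i\<in>UNIV. D i (\<lambda>v. s v *\<^sub>R (\<Sum>j\<in>UNIV. ginv v i j *\<^sub>R D j x v)) u))"
    by (intro smooth_scaleR smooth_const smooth_inverse smooth_sum smooth_frame_deriv smooth_s
        smooth_ginv smooth_frame s_properties) auto
  then show ?thesis
    by (rule smooth_cong) (simp add: Y_def laplacian_def s_def ginv_def divide_inverse)
qed

text \<open>The product s g^ij is kept as one weight, whose divergence \<open>D_weight\<close>
  controls. The factor n s clears the denominators of the Laplacian.\<close>

lemma Y_expansion:
  assumes u: "u \<in> fst c"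
  shows "(real CARD('b) * s u) *\<^sub>R Y u = (\<Sum>i\<in>UNIV. \<Sum>j\<in>UNIV.
    D i (\<lambda>v. s v * ginv v i j) u *\<^sub>R D j x u + (s u * ginv u i j) *\<^sub>R D i (D j x) u)"
proof -
  have "(real CARD('b) * s u) *\<^sub>R Y u =
      (\<Sum>i\<in>UNIV. D i (\<lambda>v. s v *\<^sub>R (\<Sum>j\<in>UNIV. ginv v i j *\<^sub>R D j x v)) u)"
    using s_properties(2)[OF u] by (simp add: Y_def laplacian_def ginv_def s_def)
  also have "\<dots> = (\<Sum>i\<in>UNIV. D i (\<lambda>v. \<Sum>j\<in>UNIV. (s v * ginv v i j) *\<^sub>R D j x v) u)"
    by (simp add: scaleR_sum_right)
  also have "\<dots> = (\<Sum>i\<in>UNIV. \<Sum>j\<in>UNIV. D i (\<lambda>v. (s v * ginv v i j) *\<^sub>R D j x v) u)"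
    by (intro sum.cong refl frame_deriv_sum)
      (auto intro!: smooth_differentiable[OF _ u] smooth_scaleR smooth_mult smooth_s smooth_ginv smooth_frame)
  also have "\<dots> = (\<Sum>i\<in>UNIV. \<Sum>j\<in>UNIV.
    D i (\<lambda>v. s v * ginv v i j) u *\<^sub>R D j x u + (s u * ginv u i j) *\<^sub>R D i (D j x) u)"
    by (simp add: frame_deriv_scaleR[OF u differentiable_weight[OF u] smooth_differentiable[OF smooth_frame u]]
        add.commute)
  finally show ?thesis .
qed

text \<open>The conormal kills the first-order part and leaves the trace of \<nu> g with respect to
  g, which is n \<nu>.\<close>

lemma inner_Y: assumes u: "u \<in> fst c" shows "N u \<bullet> Y u = nu u"
proof -
  have h: "N u \<bullet> D i (D j x) u = nu u * g u $ j $ i" for i j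
    using nu_properties(1)[OF u] by (simp add: metric_nth[OF u] second_form_nth[OF u])
  have "real CARD('b) * s u * (N u \<bullet> Y u) = N u \<bullet> ((real CARD('b) * s u) *\<^sub>R Y u)" by simp
  also have "\<dots> = (\<Sum>i\<in>UNIV. \<Sum>j\<in>UNIV. s u * nu u * (ginv u i j * g u $ j $ i))"
    unfolding Y_expansion[OF u]
    by (simp add: inner_sum_right inner_add_right h mult_ac)
  also have "\<dots> = real CARD('b) * s u * nu u"
    by (simp add: ginv_mult[OF u] flip: sum_distrib_left)
  finally show ?thesis using s_properties(2)[OF u] by simp
qed

text \<open>The affine conormal in its classical normalization <\<zeta>, Y> = 1; paired with second
  derivatives of x it gives the Blaschke metric in place of h.\<close>

definition \<zeta> :: "'a \<Rightarrow> real ^ ('b option)" where "\<zeta> u = inverse (nu u) *\<^sub>R N u"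

lemma smooth_zeta: "chart_smooth c \<zeta>"
  unfolding \<zeta>_def[abs_def] by (intro smooth_scaleR smooth_inverse smooth_nu smooth_conormal nu_properties)

lemma zeta_Y: "u \<in> fst c \<Longrightarrow> \<zeta> u \<bullet> Y u = 1"
  by (simp add: \<zeta>_def inner_Y nu_properties)

lemma zeta_frame: "\<zeta> u \<bullet> D i x u = 0" by (simp add: \<zeta>_def)

lemma zeta_second: "u \<in> fst c \<Longrightarrow> \<zeta> u \<bullet> D j (D i x) u = g u $ i $ j"
  by (simp add: \<zeta>_def metric_nth second_form_nth)

lemma D_eq: "u \<in> fst c \<Longrightarrow> (\<And>v. v \<in> fst c \<Longrightarrow> f v = f' v) \<Longrightarrow> D k f u = D k f' u"
  by (rule frame_deriv_cong[OF subset_refl open_image])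

lemma D_zeta_frame: assumes u: "u \<in> fst c" shows "D k \<zeta> u \<bullet> D j x u = - g u $ j $ k"
  using frame_deriv_inner[OF u smooth_differentiable[OF smooth_zeta u] smooth_differentiable[OF smooth_frame[of j] u], of k]
    zeta_second[OF u, of k j] by (simp add: zeta_frame frame_deriv_const)

lemma D_zeta_Y: assumes u: "u \<in> fst c" shows "\<zeta> u \<bullet> D k Y u = - (D k \<zeta> u \<bullet> Y u)"
  using frame_deriv_inner[OF u smooth_differentiable[OF smooth_zeta u] smooth_differentiable[OF smooth_Y u], of k]
    D_eq[OF u, of "\<lambda>v. \<zeta> v \<bullet> Y v" "\<lambda>_. 1" k, OF zeta_Y] by (simp add: frame_deriv_const eq_neg_iff_add_eq_0)

text \<open>Differentiating g_jk = <\<zeta>, x_jk> produces third derivatives of x, which cancel by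
  symmetry when i and k are exchanged.\<close>

lemma metric_codazzi:
  assumes u: "u \<in> fst c"
  shows "D i (\<lambda>v. g v $ j $ k) u + D k \<zeta> u \<bullet> D i (D j x) u =
    D k (\<lambda>v. g v $ j $ i) u + D i \<zeta> u \<bullet> D k (D j x) u"
proof -
  have "D l (\<lambda>v. g v $ j $ m) u = \<zeta> u \<bullet> D l (D m (D j x)) u + D l \<zeta> u \<bullet> D m (D j x) u" for l m
    using frame_deriv_inner[OF u smooth_differentiable[OF smooth_zeta u]
        smooth_differentiable[OF smooth_frame_deriv[OF smooth_frame[of j], of m] u], of l]
      D_eq[OF u, of "\<lambda>v. \<zeta> v \<bullet> D m (D j x) v" "\<lambda>v. g v $ j $ m" l, OF zeta_second] by simp
  then show ?thesis using frame_deriv_commute[OF smooth_frame u, of i k j] by simp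
qed

text \<open>Obtained by differentiating s g^ij g_jk = s \<delta>^i_k in direction i and summing over
  i, so that no formula for the derivative of the inverse metric is required.\<close>

lemma D_weight:
  assumes u: "u \<in> fst c"
  shows "(\<Sum>i\<in>UNIV. \<Sum>j\<in>UNIV. D i (\<lambda>v. s v * ginv v i j) u * g u $ j $ k) =
    D k s u - s u * (\<Sum>i\<in>UNIV. \<Sum>j\<in>UNIV. ginv u i j * D i (\<lambda>v. g v $ j $ k) u)"
proof -
  have "(\<Sum>j\<in>UNIV. D i (\<lambda>v. s v * ginv v i j) u * g u $ j $ k) =
      (if i = k then D k s u else 0) - s u * (\<Sum>j\<in>UNIV. ginv u i j * D i (\<lambda>v. g v $ j $ k) u)" for i
  proof -
    have "(\<Sum>j\<in>UNIV. s v * ginv v i j * g v $ j $ k) = (if i = k then s v else 0)" if "v \<in> fst c" for v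
      using ginv_mult(1)[OF that, of i k] by (simp add: mult.assoc flip: sum_distrib_left)
    then have "D i (\<lambda>v. \<Sum>j\<in>UNIV. s v * ginv v i j * g v $ j $ k) u = D i (\<lambda>v. if i = k then s v else 0) u"
      by (intro D_eq[OF u])
    also have "\<dots> = (if i = k then D k s u else 0)" by (simp add: frame_deriv_const)
    also have "D i (\<lambda>v. \<Sum>j\<in>UNIV. s v * ginv v i j * g v $ j $ k) u =
        (\<Sum>j\<in>UNIV. D i (\<lambda>v. s v * ginv v i j * g v $ j $ k) u)"
      by (rule frame_deriv_sum)
        (auto intro!: smooth_differentiable[OF _ u] smooth_mult smooth_s smooth_ginv smooth_metric)
    also have "\<dots> = (\<Sum>j\<in>UNIV. s u * ginv u i j * D i (\<lambda>v. g v $ j $ k) u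
        + D i (\<lambda>v. s v * ginv v i j) u * g u $ j $ k)"
      by (simp add: frame_deriv_mult[OF u differentiable_weight[OF u] smooth_differentiable[OF smooth_metric u]])
    finally show ?thesis by (simp add: sum.distrib sum_distrib_left mult.assoc)
  qed
  then show ?thesis by (simp add: sum_subtractf sum_distrib_left)
qed

text \<open>Jacobi's formula applied to det g = s^2, divided by s.\<close>

lemma D_det_metric:
  assumes u: "u \<in> fst c"
  shows "s u * (\<Sum>i\<in>UNIV. \<Sum>j\<in>UNIV. ginv u i j * D k (\<lambda>v. g v $ j $ i) u) = 2 * D k s u"
proof -
  let ?Dg = "\<chi> j i. D k (\<lambda>v. g v $ j $ i) u"
  let ?C = "?Dg ** matrix_inv (g u)"
  have inv: "invertible (g u)" using det_metric_nz[OF u] invertible_det_nz by blast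
  have "D k (\<lambda>v. det (g v)) u = trace ?C * det (g u)"
    by (rule frame_deriv_det[OF u smooth_differentiable[OF smooth_metric u] _ det_metric_nz[OF u]])
      (simp add: matrix_inv_mult(2)[OF inv] flip: matrix_mul_assoc)
  moreover have "D k (\<lambda>v. det (g v)) u = D k (\<lambda>v. s v * s v) u"
    by (rule D_eq[OF u]) (simp add: s_properties(3))
  moreover have "D k (\<lambda>v. s v * s v) u = s u * D k s u + D k s u * s u"
    by (rule frame_deriv_mult[OF u smooth_differentiable[OF smooth_s u] smooth_differentiable[OF smooth_s u]])
  ultimately have "s u * (2 * D k s u) = s u * (s u * trace ?C)"
    using s_properties(3)[OF u] by (simp add: algebra_simps)
  then have "2 * D k s u = s u * trace ?C" using s_properties(2)[OF u] by simp
  moreover have "trace ?C = (\<Sum>i\<in>UNIV. \<Sum>j\<in>UNIV. ginv u i j * D k (\<lambda>v. g v $ j $ i) u)"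
    by (subst sum.swap) (simp add: trace_def matrix_matrix_mult_def ginv_def mult.commute)
  ultimately show ?thesis by simp
qed

text \<open>The Laplacian only determines the trace \<open>g\<^sup>i\<^sup>j\<Gamma>\<^sub>i\<^sub>j\<^sup>k\<close> of \<open>\<Gamma>\<close>; the two volume derivatives and the
  Codazzi equation turn this into \<open>n t\<^sub>k = 0\<close> for the normal component \<open>t\<^sub>k\<close> of \<open>- Y\<^sub>k\<close>.\<close>

lemma Y_tangential:
  assumes u: "u \<in> fst c"
  shows "N u \<bullet> D k Y u = 0"
proof -
  define t where "t i = D i \<zeta> u \<bullet> Y u" for i
  have nuY: "N u \<bullet> Y u \<noteq> 0" by (simp add: inner_Y[OF u] nu_properties[OF u])
  have split: "\<exists>a. w = (\<Sum>l\<in>UNIV. a l *\<^sub>R D l x u) + (\<zeta> u \<bullet> w) *\<^sub>R Y u" for w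
  proof -
    obtain a where "w = (\<Sum>l\<in>UNIV. a l *\<^sub>R D l x u) + (N u \<bullet> w / (N u \<bullet> Y u)) *\<^sub>R Y u"
      by (rule frame_decomposition[OF nuY])
    then show ?thesis by (auto simp: \<zeta>_def inner_Y[OF u] divide_inverse mult.commute)
  qed
  define \<Gamma> where "\<Gamma> j = (SOME a. D k (D j x) u = (\<Sum>l\<in>UNIV. a l *\<^sub>R D l x u) + (\<zeta> u \<bullet> D k (D j x) u) *\<^sub>R Y u)" for j
  have \<Gamma>: "D k (D j x) u = (\<Sum>l\<in>UNIV. \<Gamma> j l *\<^sub>R D l x u) + g u $ j $ k *\<^sub>R Y u" for j
    using someI_ex[OF split[of "D k (D j x) u"]] unfolding \<Gamma>_def zeta_second[OF u] .
  obtain b where b: "D k Y u = (\<Sum>l\<in>UNIV. b l *\<^sub>R D l x u) + (- t k) *\<^sub>R Y u"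
    using split[of "D k Y u"] unfolding D_zeta_Y[OF u] t_def by blast
  define \<gamma> where "\<gamma> = (\<Sum>j\<in>UNIV. \<Gamma> j j)"
  \<comment> \<open>First volume derivative: up to sign s is \<nu>, the determinant of the extended
    frame x_1, ..., x_n, Y, so its logarithmic derivative is the trace of the structure
    equations.\<close>
  have Ds: "D k s u = s u * (\<gamma> - t k)"
  proof -
    let ?F = "\<lambda>u. frame_rows (\<lambda>i. D i x u) (Y u)"
    \<comment> \<open>The coefficients of the derivative of the extended frame; the row
      \<open>None\<close> belongs to Y, so the trace is \<open>\<gamma> - t k\<close>.\<close>
    let ?C = "\<chi> r q. case r of
        None \<Rightarrow> (case q of None \<Rightarrow> - t k | Some l \<Rightarrow> b l)
      | Some j \<Rightarrow> (case q of None \<Rightarrow> g u $ j $ k | Some l \<Rightarrow> \<Gamma> j l)"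
    have nu: "nu v = det (?F v)" if "v \<in> fst c" for v
      using inner_Y[OF that] by (simp flip: Vol_eq_conormal Vol_eq_det_frame_rows)
    have "D k (\<lambda>v. det (?F v)) u = trace ?C * det (?F u)"
    proof (rule frame_deriv_det[OF u smooth_differentiable[OF smooth_frame_rows[OF smooth_Y] u]])
      fix r q
      show "D k (\<lambda>v. ?F v $ r $ q) u = (?C ** ?F u) $ r $ q"
      proof (cases r)
        case None
        have "D k (\<lambda>v. Y v $ q) u = D k Y u $ q"
          by (rule frame_deriv_bounded_linear[OF bounded_linear_vec_nth smooth_differentiable[OF smooth_Y u]])
        then show ?thesis using None b
          by (simp add: frame_rows_def matrix_matrix_mult_def sum_option_UNIV)
      next
        case (Some j)
        have "D k (\<lambda>v. D j x v $ q) u = D k (D j x) u $ q"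
          by (rule frame_deriv_bounded_linear[OF bounded_linear_vec_nth smooth_differentiable[OF smooth_frame u]])
        then show ?thesis using Some \<Gamma>
          by (simp add: frame_rows_def matrix_matrix_mult_def sum_option_UNIV)
      qed
    qed (simp add: nu[OF u, symmetric] nu_properties[OF u])
    then have "D k nu u = (\<gamma> - t k) * nu u"
      using D_eq[OF u, of nu "\<lambda>v. det (?F v)" k, OF nu] nu[OF u] by (simp add: trace_def sum_option_UNIV \<gamma>_def)
    moreover have "D k (\<lambda>v. s v * s v) u = D k (\<lambda>v. nu v * nu v) u"
      by (rule D_eq[OF u]) (simp add: s_properties(3) det_metric)
    then have "s u * D k s u = nu u * D k nu u"
      using frame_deriv_mult[OF u smooth_differentiable[OF smooth_s u] smooth_differentiable[OF smooth_s u], of k]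
        frame_deriv_mult[OF u smooth_differentiable[OF smooth_nu u] smooth_differentiable[OF smooth_nu u], of k]
      by simp
    ultimately have "s u * D k s u = (nu u * nu u) * (\<gamma> - t k)" by (simp add: mult_ac)
    then have "s u * (2 * D k s u) = (nu u * nu u) * (2 * (\<gamma> - t k))" by (metis mult.left_commute)
    also have "\<dots> = s u * (2 * (s u * (\<gamma> - t k)))"
      using s_properties(3)[OF u] det_metric[OF u] by (simp add: algebra_simps)
    finally show ?thesis using s_properties(2)[OF u] by simp
  qed
  have "real CARD('b) * s u * t k = D k \<zeta> u \<bullet> ((real CARD('b) * s u) *\<^sub>R Y u)" by (simp add: t_def)
  also have "\<dots> = - (\<Sum>i\<in>UNIV. \<Sum>j\<in>UNIV. D i (\<lambda>v. s v * ginv v i j) u * g u $ j $ k)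
      + s u * (\<Sum>i\<in>UNIV. \<Sum>j\<in>UNIV. ginv u i j * (D k \<zeta> u \<bullet> D i (D j x) u))"
    unfolding Y_expansion[OF u]
    by (simp add: inner_sum_right inner_add_right D_zeta_frame[OF u] sum.distrib sum_negf
        sum_distrib_left mult.assoc)
  also have "\<dots> = - D k s u + s u * (\<Sum>i\<in>UNIV. \<Sum>j\<in>UNIV. ginv u i j *
      (D i (\<lambda>v. g v $ j $ k) u + D k \<zeta> u \<bullet> D i (D j x) u))"
    unfolding D_weight[OF u] by (simp add: distrib_left sum.distrib)
  \<comment> \<open>Codazzi exchanges i and k: the metric derivative becomes the trace in
    \<open>D_det_metric\<close>, and D_k x_j can be expanded with \<Gamma>.\<close>
  also have "(\<Sum>i\<in>UNIV. \<Sum>j\<in>UNIV. ginv u i j * (D i (\<lambda>v. g v $ j $ k) u + D k \<zeta> u \<bullet> D i (D j x) u)) =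
      (\<Sum>i\<in>UNIV. \<Sum>j\<in>UNIV. ginv u i j * (D k (\<lambda>v. g v $ j $ i) u + D i \<zeta> u \<bullet> D k (D j x) u))"
    by (intro sum.cong refl arg_cong2[where f = "(*)"] metric_codazzi[OF u])
  also have "- D k s u + s u * \<dots> = - D k s u + s u * (\<Sum>i\<in>UNIV. \<Sum>j\<in>UNIV. ginv u i j * D k (\<lambda>v. g v $ j $ i) u)
      + s u * (\<Sum>i\<in>UNIV. \<Sum>j\<in>UNIV. ginv u i j * (D i \<zeta> u \<bullet> D k (D j x) u))"
    by (simp add: distrib_left sum.distrib)
  also have "(\<Sum>i\<in>UNIV. \<Sum>j\<in>UNIV. ginv u i j * (D i \<zeta> u \<bullet> D k (D j x) u)) = t k - \<gamma>"
  proof -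
    have 1: "D i \<zeta> u \<bullet> D k (D j x) u = g u $ j $ k * t i - (\<Sum>l\<in>UNIV. \<Gamma> j l * g u $ l $ i)" for i j
      unfolding \<Gamma> by (simp add: inner_add_right inner_sum_right D_zeta_frame[OF u] sum_negf t_def)
    have 2: "(\<Sum>i\<in>UNIV. \<Sum>j\<in>UNIV. ginv u i j * (g u $ j $ k * t i)) = t k"
    proof -
      have "(\<Sum>j\<in>UNIV. ginv u i j * (g u $ j $ k * t i)) = (if i = k then t i else 0)" for i
        using ginv_mult(1)[OF u, of i k] by (simp add: mult.assoc[symmetric] flip: sum_distrib_right)
      then show ?thesis by simp
    qed
    have "(\<Sum>i\<in>UNIV. \<Sum>j\<in>UNIV. ginv u i j * (\<Sum>l\<in>UNIV. \<Gamma> j l * g u $ l $ i))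
        = (\<Sum>j\<in>UNIV. \<Sum>i\<in>UNIV. \<Sum>l\<in>UNIV. \<Gamma> j l * (g u $ l $ i * ginv u i j))"
      by (subst sum.swap) (simp add: sum_distrib_left mult_ac)
    also have "\<dots> = (\<Sum>j\<in>UNIV. \<Sum>l\<in>UNIV. \<Gamma> j l * (\<Sum>i\<in>UNIV. g u $ l $ i * ginv u i j))"
      unfolding sum_distrib_left by (intro sum.cong refl sum.swap)
    also have "\<dots> = \<gamma>"
      by (simp add: ginv_mult(2)[OF u] \<gamma>_def if_distrib cong: if_cong)
    finally show ?thesis using 2 by (simp add: 1 right_diff_distrib sum_subtractf)
  qed
  finally have "real CARD('b) * s u * t k = D k s u + s u * (t k - \<gamma>)"
    using D_det_metric[OF u, of k] by simp
  \<comment> \<open>Substituting D_k s = s (\<gamma> - t_k) cancels the whole right-hand side and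
    leaves n s t_k = 0.\<close>
  then have "t k = 0" using Ds s_properties(2)[OF u] by (simp add: algebra_simps)
  then show ?thesis using D_zeta_Y[OF u, of k] nu_properties(1)[OF u] by (simp add: t_def \<zeta>_def)
qed

lemma Y_affine_normal: "u \<in> fst c \<Longrightarrow> affine_normal_at c x Y u"
  by (simp add: affine_normal_at_def inner_Y nu_properties Y_tangential)

end

section \<open>Affine invariants on the manifold\<close>

text \<open>Subtracting the images of the parameters 1 and 0 removes the base points and the
  translation.\<close>

lemma affine_parallel_lines:
  assumes "affine_parallel {p + t *\<^sub>R v | t. True} {q + t *\<^sub>R w | t. True}"
  shows "\<exists>r. v = r *\<^sub>R (w :: 'v::real_vector)"
proof -
  obtain a where a: "{q + t *\<^sub>R w | t. True} = (\<lambda>y. a + y) ` {p + t *\<^sub>R v | t. True}"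
    using assms unfolding affine_parallel_def by blast
  have "a + (p + t *\<^sub>R v) \<in> {q + t *\<^sub>R w | t. True}" for t unfolding a by blast
  then obtain s where s: "\<And>t. a + (p + t *\<^sub>R v) = q + s t *\<^sub>R w" by simp metis
  have "v = (a + (p + 1 *\<^sub>R v)) - (a + (p + 0 *\<^sub>R v))" by simp
  also have "\<dots> = (s 1 - s 0) *\<^sub>R w" unfolding s by (simp add: scaleR_diff_left)
  finally show ?thesis by blast
qed

lemma connected_space_locally_constant:
  assumes "connected_space X" "u \<in> topspace X" "v \<in> topspace X"
    and loc: "\<And>u. u \<in> topspace X \<Longrightarrow> \<exists>W. openin X W \<and> u \<in> W \<and> (\<forall>v\<in>W. f v = f u)"
  shows "f u = f v"
proof -
  have op: "openin X {w \<in> topspace X. P (f w)}" for P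
    unfolding openin_subopen[of X "{w \<in> topspace X. P (f w)}"]
  proof
    fix w assume "w \<in> {w \<in> topspace X. P (f w)}"
    then have w: "w \<in> topspace X" "P (f w)" by simp_all
    from loc[OF w(1)] obtain W where W: "openin X W" "w \<in> W" "\<forall>v\<in>W. f v = f w" by (elim exE conjE)
    have "W \<subseteq> {w \<in> topspace X. P (f w)}"
    proof
      fix v assume v: "v \<in> W"
      then have "f v = f w" by (rule bspec[OF W(3)])
      then show "v \<in> {w \<in> topspace X. P (f w)}" using v w(2) openin_subset[OF W(1)] by auto
    qed
    then show "\<exists>T. openin X T \<and> w \<in> T \<and> T \<subseteq> {w \<in> topspace X. P (f w)}" using W(1,2) by blast
  qed
  let ?T = "{w \<in> topspace X. f w = f u}"
  have "topspace X - ?T = {w \<in> topspace X. f w \<noteq> f u}" by auto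
  then have "closedin X ?T" using op[of "\<lambda>y. y \<noteq> f u"] by (simp add: closedin_def)
  moreover have "openin X ?T" using op[of "\<lambda>y. y = f u"] .
  ultimately have "?T = {} \<or> ?T = topspace X"
    using assms(1) unfolding connected_space_clopen_in by blast
  moreover have "u \<in> ?T" using assms(2) by simp
  ultimately have "v \<in> ?T" using assms(3) by blast
  then show ?thesis by simp
qed

section \<open>Charts of the manifold and chart independence of the affine normal\<close>

context
  fixes M :: "'a topology" and A :: "('a, 'n::finite) chart set"
  assumes manifold: "smooth_manifold M A"
begin

lemma chart_openin: "c \<in> A \<Longrightarrow> openin M (fst c)"
  using manifold by (cases c) (auto simp: smooth_manifold_def)

lemma chart_homeomorphic:
  "c \<in> A \<Longrightarrow> open (snd c ` fst c)"
  "c \<in> A \<Longrightarrow> homeomorphic_map (subtopology M (fst c)) (top_of_set (snd c ` fst c)) (snd c)"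
  using manifold by (cases c, fastforce simp: smooth_manifold_def)+

lemma topspace_chart: "c \<in> A \<Longrightarrow> topspace (subtopology M (fst c)) = fst c"
  using openin_subset[OF chart_openin[of c]] by (simp add: Int_absorb1)

lemma chart_domain: assumes "c \<in> A" shows "chart_domain c"
proof
  show "inj_on (snd c) (fst c)"
    using homeomorphic_imp_injective_map[OF chart_homeomorphic(2)[OF assms]]
    unfolding topspace_chart[OF assms] .
  show "open (snd c ` fst c)" by (rule chart_homeomorphic(1)[OF assms])
qed

lemma open_chart_image:
  assumes "c \<in> A" "openin M W" "W \<subseteq> fst c"
  shows "open (snd c ` W)"
proof -
  have "openin (subtopology M (fst c)) W"
    using assms chart_openin[OF assms(1)] by (simp add: openin_open_subtopology)
  then have "openin (top_of_set (snd c ` fst c)) (snd c ` W)"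
    using homeomorphic_imp_open_map[OF chart_homeomorphic(2)[OF assms(1)]] by (simp add: open_map_def)
  then show ?thesis using chart_homeomorphic(1)[OF assms(1)] openin_open_eq by blast
qed

lemma openin_chart_preimage:
  assumes "c \<in> A" "open V"
  shows "openin M {u \<in> fst c. snd c u \<in> V}"
proof -
  have "openin (top_of_set (snd c ` fst c)) (snd c ` fst c \<inter> V)" using assms(2) by blast
  from openin_continuous_map_preimage[OF homeomorphic_imp_continuous_map[OF chart_homeomorphic(2)[OF assms(1)]] this]
  have "openin (subtopology M (fst c)) {u \<in> fst c. snd c u \<in> V}"
    unfolding topspace_chart[OF assms(1)] by (auto elim: back_subst[where P = "openin _"])
  then show ?thesis using chart_openin[OF assms(1)] openin_trans_full by blast
qed

lemma transition_differentiable: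
  assumes "c \<in> A" "c' \<in> A" "u \<in> fst c \<inter> fst c'"
  shows "chart_differentiable c (snd c') u"
proof -
  have "smooth_on (snd c ` (fst c \<inter> fst c')) (in_chart c (snd c'))"
    using manifold assms(1,2) by (cases c; cases c') (fastforce simp: smooth_manifold_def)
  then show ?thesis unfolding chart_differentiable_def
    by (rule smooth_on_differentiable) (use assms(3) in blast)
qed

lemma topspace_iff: "u \<in> topspace M \<longleftrightarrow> (\<exists>c\<in>A. u \<in> fst c)"
  using manifold by (auto simp: smooth_manifold_def)

lemma chart_at: "u \<in> topspace M \<Longrightarrow> chart_at A u \<in> A \<and> u \<in> fst (chart_at A u)"
  unfolding chart_at_def topspace_iff by (rule someI_ex) blast

lemma overlap:
  assumes "c \<in> A" "c' \<in> A"
  shows "open (snd c ` (fst c \<inter> fst c'))"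
  using assms by (intro open_chart_image openin_Int chart_openin) auto

lemma hypersurface_iff:
  "hypersurface A x \<longleftrightarrow> (\<forall>c\<in>A. chart_immersion c x)"
proof -
  have "inj (differential c x u) \<longleftrightarrow> conormal (\<lambda>i. frame_deriv c i x u) \<noteq> 0"
    if c: "c \<in> A" "u \<in> fst c" and sm: "chart_smooth c x" for c u
  proof -
    interpret chart_domain c by (rule chart_domain[OF c(1)])
    have diff: "chart_differentiable c x u" by (rule smooth_differentiable[OF sm c(2)])
    have lin: "linear (differential c x u)"
      using differential_works[OF diff] has_derivative_linear by blast
    have eq: "(\<Sum>i\<in>UNIV. a i *\<^sub>R frame_deriv c i x u) = differential c x u (\<chi> i. a i)" for a
      unfolding differential_frame[OF diff] by simp
    show ?thesis
    proof
      assume inj: "inj (differential c x u)"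
      show "conormal (\<lambda>i. frame_deriv c i x u) \<noteq> 0"
      proof (rule conormal_nonzero)
        fix a i assume "(\<Sum>i\<in>UNIV. a i *\<^sub>R frame_deriv c i x u) = 0"
        then have "(\<chi> i. a i) = (0 :: real ^ 'n)"
          using inj lin unfolding eq by (metis linear_injective_0)
        then show "a i = 0" by (simp add: vec_eq_iff)
      qed
    next
      assume nz: "conormal (\<lambda>i. frame_deriv c i x u) \<noteq> 0"
      show "inj (differential c x u)"
        unfolding linear_injective_0[OF lin]
      proof (intro allI impI)
        fix v assume "differential c x u v = 0"
        then have "v $ i = 0" for i
          unfolding differential_frame[OF diff] by (rule frame_independent[OF nz])
        then show "v = 0" by (simp add: vec_eq_iff)
      qed
    qed
  qed
  then show ?thesis
    unfolding hypersurface_def smooth_map_iff_chart_smooth chart_immersion_def chart_immersion_axioms_def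
    using chart_domain by blast
qed

lemma locally_strongly_convex_iff:
  "locally_strongly_convex A x \<longleftrightarrow> (\<forall>c\<in>A. convex_chart c x)"
  unfolding locally_strongly_convex_def hypersurface_iff convex_chart_def convex_chart_axioms_def
  by blast

text \<open>On the overlap with the chart chosen at \<open>u\<close>, the Laplacians of both charts
  pass the test for an affine normal in \<open>c\<close>, so they agree at \<open>u\<close>.
  Smoothness of \<open>affine_normal\<close> follows, although its definition switches charts from
  point to point.\<close>

lemma affine_normal_chart:
  assumes lsc: "locally_strongly_convex A x" and c: "c \<in> A" and u: "u \<in> fst c"
  shows "affine_normal A x u = convex_chart.Y c x u"
proof -
  define c' where "c' = chart_at A u"
  have "u \<in> topspace M" using c u topspace_iff by blast
  then have c': "c' \<in> A" "u \<in> fst c'" using chart_at by (simp_all add: c'_def)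
  interpret c: convex_chart c x using lsc c by (simp add: locally_strongly_convex_iff)
  interpret c': convex_chart c' x using lsc c'(1) by (simp add: locally_strongly_convex_iff)
  let ?W = "fst c \<inter> fst c'"
  have diff: "chart_differentiable c' c'.Y v" if "v \<in> ?W" for v
    using c'.smooth_differentiable[OF c'.smooth_Y] that by blast
  have tr: "chart_differentiable c (snd c') v" if "v \<in> ?W" for v
    using transition_differentiable[OF c c'(1)] that by blast
  have "c.Y u = c'.Y u"
  proof (rule c.affine_normal_at_unique)
    show "open (snd c ` ?W)" by (rule overlap[OF c c'(1)])
    show "chart_differentiable c c.Y u" by (rule c.smooth_differentiable[OF c.smooth_Y u])
    show "chart_differentiable c c'.Y u"
      using chart_change(1)[OF c.chart_domain_axioms c'.chart_domain_axioms order_refl overlap[OF c c'(1)]]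
        u c' tr diff by blast
    show "affine_normal_at c x c.Y v" if "v \<in> ?W" for v using c.Y_affine_normal that by blast
    show "affine_normal_at c x c'.Y v" if "v \<in> ?W" for v
      using affine_normal_at_chart_change[OF c.chart_immersion_axioms c'.chart_immersion_axioms
          order_refl overlap[OF c c'(1)] that tr diff[OF that]] c'.Y_affine_normal that by blast
  qed (use u c' in auto)
  also have "\<dots> = affine_normal A x u"
    by (simp add: affine_normal_def c'.Y_def Let_def flip: c'_def)
  finally show ?thesis by simp
qed

lemma smooth_affine_normal:
  assumes "locally_strongly_convex A x" "c \<in> A"
  shows "chart_smooth c (affine_normal A x)"
proof -
  interpret convex_chart c x using assms by (simp add: locally_strongly_convex_iff)
  show ?thesis by (rule smooth_cong[OF smooth_Y]) (simp add: affine_normal_chart[OF assms])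
qed

lemma affine_normal_at_affine_normal:
  assumes "locally_strongly_convex A x" "c \<in> A" "u \<in> fst c"
  shows "affine_normal_at c x (affine_normal A x) u"
proof -
  interpret convex_chart c x using assms by (simp add: locally_strongly_convex_iff)
  show ?thesis
    using Y_affine_normal[OF assms(3)] D_eq[OF assms(3), of Y "affine_normal A x"] affine_normal_chart[OF assms(1,2)]
    unfolding affine_normal_at_def by (simp add: assms(3))
qed

lemma affine_normal_unique:
  assumes "locally_strongly_convex A x" "c \<in> A" "u \<in> fst c"
    and "chart_smooth c Z" "\<And>v. v \<in> fst c \<Longrightarrow> affine_normal_at c x Z v"
  shows "affine_normal A x u = Z u"
proof -
  interpret convex_chart c x using assms by (simp add: locally_strongly_convex_iff)
  show ?thesis
    by (rule affine_normal_at_unique[OF subset_refl open_image assms(3)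
          smooth_differentiable[OF smooth_affine_normal[OF assms(1,2)] assms(3)]
          smooth_differentiable[OF assms(4,3)] affine_normal_at_affine_normal[OF assms(1,2)] assms(5)])
qed

end

locale convex_hypersurface =
  fixes M :: "'a topology" and A :: "('a, 'n::finite) chart set" and x :: "'a \<Rightarrow> real ^ ('n option)"
  assumes manifold: "smooth_manifold M A" and lsc: "locally_strongly_convex A x"
begin

abbreviation "Y \<equiv> affine_normal A x"
abbreviation "B c u \<equiv> shape_matrix A c x u"
abbreviation "P m c u \<equiv> mat 1 - m *\<^sub>R B c u"
abbreviation "X m \<equiv> parallel_map A x (\<lambda>_. m)"
abbreviation "N c y u \<equiv> conormal (\<lambda>i. frame_deriv c i y u)"

lemma convex_chart: "c \<in> A \<Longrightarrow> convex_chart c x"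
  using lsc locally_strongly_convex_iff[OF manifold] by blast

lemma immersion: "c \<in> A \<Longrightarrow> chart_immersion c x"
  using convex_chart convex_chart.axioms(1) by blast

lemma smooth_Y: "c \<in> A \<Longrightarrow> chart_smooth c Y"
  by (rule smooth_affine_normal[OF manifold lsc])

lemma normal_Y: "c \<in> A \<Longrightarrow> u \<in> fst c \<Longrightarrow> affine_normal_at c x Y u"
  by (rule affine_normal_at_affine_normal[OF manifold lsc])

lemma shape_matrixI:
  assumes "c \<in> A" "u \<in> fst c"
    and C: "\<And>i. frame_deriv c i (affine_normal A x) u = - (\<Sum>j\<in>UNIV. C $ i $ j *\<^sub>R frame_deriv c j x u)"
  shows "shape_matrix A c x u = C"
  unfolding shape_matrix_def
proof (rule the_equality)
  fix C' assume C': "\<forall>i. frame_deriv c i Y u = - (\<Sum>j\<in>UNIV. C' $ i $ j *\<^sub>R frame_deriv c j x u)"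
  have "(\<Sum>j\<in>UNIV. (C' $ i $ j - C $ i $ j) *\<^sub>R frame_deriv c j x u) = 0" for i
    using C' C[of i] by (simp add: scaleR_diff_left sum_subtractf)
  from frame_independent[OF chart_immersion.conormal_nz[OF immersion[OF assms(1)] assms(2)] this]
  show "C' = C" by (simp add: vec_eq_iff)
qed (use C in blast)

lemma weingarten:
  assumes "c \<in> A" "u \<in> fst c"
  shows "frame_deriv c i Y u = - (\<Sum>j\<in>UNIV. B c u $ i $ j *\<^sub>R frame_deriv c j x u)"
proof -
  have "\<exists>a. frame_deriv c i Y u = (\<Sum>j\<in>UNIV. a j *\<^sub>R frame_deriv c j x u)" for i
    using tangent_decomposition[OF chart_immersion.conormal_nz[OF immersion[OF assms(1)] assms(2)], of "frame_deriv c i Y u"]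
      normal_Y[OF assms] unfolding affine_normal_at_def by metis
  then obtain a where a: "\<And>i. frame_deriv c i Y u = (\<Sum>j\<in>UNIV. a i j *\<^sub>R frame_deriv c j x u)"
    by metis
  have C: "frame_deriv c i Y u = - (\<Sum>j\<in>UNIV. (\<chi> i j. - a i j) $ i $ j *\<^sub>R frame_deriv c j x u)" for i
    by (simp add: a sum_negf)
  show ?thesis unfolding shape_matrixI[OF assms C] by (rule C)
qed

text \<open>Differentiating <N, Y_i> = 0 gives (B h)_ij = -<N, Y_ij>, which is symmetric because
  second derivatives of Y commute. This is the Ricci equation.\<close>

lemma shape_second_form_symmetric:
  assumes c: "c \<in> A" and u: "u \<in> fst c"
  shows "transpose (B c u ** second_form c x u) = B c u ** second_form c x u"
proof -
  interpret x: convex_chart c x by (rule convex_chart[OF c])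
  have "(B c u ** x.h u) $ i $ j = - (x.N u \<bullet> x.D j (x.D i (Y)) u)" for i j
  proof -
    have "x.D j (\<lambda>v. x.N v \<bullet> x.D i (Y) v) u = x.D j (\<lambda>_. 0) u"
      using normal_Y[OF c] by (intro x.D_eq[OF u]) (simp add: affine_normal_at_def)
    then have "x.N u \<bullet> x.D j (x.D i (Y)) u = - (x.D j x.N u \<bullet> x.D i (Y) u)"
      using x.frame_deriv_inner[OF u x.smooth_differentiable[OF x.smooth_conormal u]
          x.smooth_differentiable[OF x.smooth_frame_deriv[OF smooth_Y[OF c], of i] u], of j]
      by (simp add: x.frame_deriv_const eq_neg_iff_add_eq_0)
    then show ?thesis
      by (simp add: weingarten[OF c u] inner_sum_right x.second_form_conormal[OF u] sum_negf matrix_matrix_mult_def)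
  qed
  then show ?thesis
    unfolding vec_eq_iff transpose_def by (simp add: x.frame_deriv_commute[OF smooth_Y[OF c] u])
qed

text \<open>The inner product is \<nu> h instead of h, since h is negative definite in charts of the
  opposite orientation.\<close>

lemma shape_diagonalization:
  assumes c: "c \<in> A" and u: "u \<in> fst c"
  obtains S :: "real ^ 'n ^ 'n" and d where "invertible S"
    "S ** ((N c x u \<bullet> Y u) *\<^sub>R second_form c x u) ** transpose S = mat 1"
    "S ** B c u = diag d ** S"
proof -
  interpret x: convex_chart c x by (rule convex_chart[OF c])
  let ?K = "(x.N u \<bullet> Y u) *\<^sub>R x.h u"
  have "transpose (a *\<^sub>R K) = a *\<^sub>R transpose K" for a and K :: "real ^ 'n ^ 'n"
    by (simp add: transpose_def vec_eq_iff)
  moreover have "B c u ** (a *\<^sub>R K) = a *\<^sub>R (B c u ** K)" for a and K :: "real ^ 'n ^ 'n"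
    by (simp add: vec_eq_iff matrix_matrix_mult_def sum_distrib_left mult.left_commute)
  ultimately have "transpose ?K = ?K" "transpose (B c u ** ?K) = B c u ** ?K"
    using x.second_form_symmetric[OF u] shape_second_form_symmetric[OF c u] by simp_all
  moreover have "positive_definite ?K" using normal_Y[OF c u] by (simp add: affine_normal_at_def)
  ultimately show ?thesis using simultaneous_diagonalization[of ?K "B c u"] that by metis
qed

lemma frame_change:
  assumes "c \<in> A" "c' \<in> A" "u \<in> fst c" "u \<in> fst c'" "chart_smooth c' f"
  shows "frame_deriv c i f u = (\<Sum>k\<in>UNIV. frame_deriv c i (snd c') u $ k *\<^sub>R frame_deriv c' k f u)"
  using chart_change(2)[OF chart_domain[OF manifold assms(1)] chart_domain[OF manifold assms(2)] order_refl
      overlap[OF manifold assms(1,2)] _ transition_differentiable[OF manifold assms(1,2)]]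
    chart_domain.smooth_differentiable[OF chart_domain[OF manifold assms(2)] assms(5,4)] assms(3,4) by blast

text \<open>Y_i is expanded in the second frame in two ways: through the chain rule for Y, and
  through the Weingarten equation followed by the chain rule for x.\<close>

lemma shape_matrix_similar:
  assumes c: "c \<in> A" "c' \<in> A" and u: "u \<in> fst c" "u \<in> fst c'"
  obtains J where "invertible J" "J ** B c' u = B c u ** J"
proof -
  define J where "J = (\<chi> i k. frame_deriv c i (snd c') u $ k)"
  have x: "frame_deriv c i x u = (\<Sum>k\<in>UNIV. J $ i $ k *\<^sub>R frame_deriv c' k x u)" for i
    using frame_change[OF c u chart_immersion.smooth_x[OF immersion[OF c(2)]]] by (simp add: J_def)
  have Y: "frame_deriv c i Y u = (\<Sum>k\<in>UNIV. J $ i $ k *\<^sub>R frame_deriv c' k Y u)" for i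
    using frame_change[OF c u smooth_Y[OF c(2)]] by (simp add: J_def)
  have "N c x u = det J *\<^sub>R N c' x u" by (rule conormal_frame_change) (rule x)
  then have "det J \<noteq> 0" using chart_immersion.conormal_nz[OF immersion[OF c(1)] u(1)] by auto
  moreover have "(J ** B c' u) $ i $ l = (B c u ** J) $ i $ l" for i l
  proof -
    have "(\<Sum>l\<in>UNIV. (J ** B c' u) $ i $ l *\<^sub>R frame_deriv c' l x u) = - frame_deriv c i Y u"
      unfolding Y weingarten[OF c(2) u(2)]
      by (simp add: matrix_matrix_mult_def scaleR_sum_left scaleR_sum_right sum_negf)
        (rule sum.swap)
    moreover have "(\<Sum>l\<in>UNIV. (B c u ** J) $ i $ l *\<^sub>R frame_deriv c' l x u) = - frame_deriv c i Y u"
      unfolding weingarten[OF c(1) u(1)] x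
      by (simp add: matrix_matrix_mult_def scaleR_sum_left scaleR_sum_right)
        (rule sum.swap)
    ultimately have "(\<Sum>l\<in>UNIV. ((J ** B c' u) $ i $ l - (B c u ** J) $ i $ l) *\<^sub>R frame_deriv c' l x u) = 0"
      by (simp add: scaleR_diff_left sum_subtractf)
    from frame_independent[OF chart_immersion.conormal_nz[OF immersion[OF c(2)] u(2)] this, of l]
    show ?thesis by simp
  qed
  ultimately have "invertible J" "J ** B c' u = B c u ** J"
    by (simp_all add: invertible_det_nz vec_eq_iff)
  then show ?thesis by (rule that)
qed

section \<open>Frame, conormal and second form of a parallel map\<close>

lemma parallel_eq: "X m = (\<lambda>u. x u + m *\<^sub>R Y u)"
  by (simp add: parallel_map_def fun_eq_iff)

lemma smooth_parallel: "c \<in> A \<Longrightarrow> chart_smooth c (X m)"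
  unfolding parallel_eq
  by (intro chart_domain.smooth_add chart_domain.smooth_scaleR chart_domain.smooth_const chart_domain[OF manifold]
      chart_immersion.smooth_x immersion smooth_Y)

lemma parallel_frame:
  assumes c: "c \<in> A" and u: "u \<in> fst c"
  shows "frame_deriv c i (X m) u = (\<Sum>k\<in>UNIV. P m c u $ i $ k *\<^sub>R frame_deriv c k x u)"
proof -
  interpret x: convex_chart c x by (rule convex_chart[OF c])
  have Y: "chart_differentiable c Y u" by (rule x.smooth_differentiable[OF smooth_Y[OF c] u])
  have "x.D i (\<lambda>v. x v + m *\<^sub>R Y v) u = x.D i x u + m *\<^sub>R x.D i (Y) u"
    using x.differentiable_add(2)[OF x.smooth_differentiable[OF x.smooth_x u]
        x.differentiable_bounded_linear[OF bounded_linear_scaleR_right Y]]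
      x.frame_deriv_bounded_linear[OF bounded_linear_scaleR_right Y] by simp
  also have "\<dots> = (\<Sum>k\<in>UNIV. P m c u $ i $ k *\<^sub>R x.D k x u)"
    by (simp add: weingarten[OF c u] mat_def scaleR_diff_left sum_subtractf scaleR_sum_right if_distribR
        if_distrib[of "\<lambda>a. a *\<^sub>R _"] cong: if_cong)
  finally show ?thesis by (simp add: parallel_eq)
qed

lemma parallel_conormal:
  "c \<in> A \<Longrightarrow> u \<in> fst c \<Longrightarrow> N c (X m) u = det (P m c u) *\<^sub>R N c x u"
  by (rule conormal_frame_change) (rule parallel_frame)

text \<open>The conormal of \<open>x\<close> annihilates the new frame as well, and only its value
  at \<open>u\<close> is rescaled; hence det P is not differentiated and h is simply multiplied by P
  from the left.\<close>

lemma parallel_second_form: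
  assumes c: "c \<in> A" and u: "u \<in> fst c" and imm: "chart_immersion c (X m)"
  shows "second_form c (X m) u = det (P m c u) *\<^sub>R (P m c u ** second_form c x u)"
proof -
  interpret x: convex_chart c x by (rule convex_chart[OF c])
  interpret p: chart_immersion c "X m" by (rule imm)
  have "p.h u $ i $ j = - det (P m c u) * (x.D j x.N u \<bullet> x.D i (X m) u)" for i j
  proof (rule p.second_form_via_conormal[OF subset_refl x.open_image u x.smooth_differentiable[OF x.smooth_conormal u] _
        parallel_conormal[OF c u]])
    show "x.N v \<bullet> x.D i (X m) v = 0" if "v \<in> fst c" for v i
      by (simp add: parallel_frame[OF c that] inner_sum_right)
  qed
  then show ?thesis
    by (simp add: vec_eq_iff parallel_frame[OF c u] inner_sum_right x.second_form_conormal[OF u] sum_negf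
        matrix_matrix_mult_def)
qed

lemma parallel_immersion_iff:
  assumes "c \<in> A"
  shows "chart_immersion c (X m) \<longleftrightarrow> (\<forall>u\<in>fst c. det (P m c u) \<noteq> 0)"
proof -
  have "chart_immersion c (X m) \<longleftrightarrow> (\<forall>u\<in>fst c. N c (X m) u \<noteq> 0)"
    using chart_domain[OF manifold assms] smooth_parallel[OF assms]
    by (auto simp: chart_immersion_def chart_immersion_axioms_def)
  then show ?thesis
    using chart_immersion.conormal_nz[OF immersion[OF assms]] by (simp add: parallel_conormal[OF assms])
qed

end

section \<open>Parallel hypersurfaces\<close>

context convex_hypersurface
begin

lemma charpoly_diag:
  assumes "c \<in> A" "u \<in> fst c"
  obtains S :: "real ^ 'n ^ 'n" and d where "invertible S"
    "S ** ((N c x u \<bullet> Y u) *\<^sub>R second_form c x u) ** transpose S = mat 1"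
    "S ** B c u = diag d ** S" "proots (charpoly (B c u)) = image_mset d (mset_set UNIV)"
    "\<And>m. det (P m c u) = (\<Prod>i\<in>UNIV. 1 - m * d i)"
proof -
  obtain S :: "real ^ 'n ^ 'n" and d where S: "invertible S"
    "S ** ((N c x u \<bullet> Y u) *\<^sub>R second_form c x u) ** transpose S = mat 1"
    "S ** B c u = diag d ** S"
    by (rule shape_diagonalization[OF assms])
  have "det (P m c u) = (\<Prod>i\<in>UNIV. 1 - m * d i)" for m
    using det_similar[OF S(1,3), of 1 m] det_diag_combination[of 1 m d] by simp
  moreover have "proots (charpoly (B c u)) = image_mset d (mset_set UNIV)"
    by (simp only: charpoly_similar_diag[OF S(1,3)] proots_linear_factors)
  ultimately show ?thesis using that S by blast
qed

lemma charpoly_chart_independent: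
  assumes "c \<in> A" "c' \<in> A" "u \<in> fst c" "u \<in> fst c'"
  shows "charpoly (B c u) = charpoly (B c' u)"
proof (rule poly_ext)
  fix t
  obtain J where J: "invertible J" "J ** B c' u = B c u ** J" by (rule shape_matrix_similar[OF assms])
  show "poly (charpoly (B c u)) t = poly (charpoly (B c' u)) t"
    using det_similar[OF J, of t 1] by (simp add: poly_charpoly)
qed

text \<open>The two differentials differ by the row action of \<open>P\<close>, which is onto when
  \<open>P\<close> is invertible.\<close>

lemma tangent_space_parallel:
  assumes "u \<in> topspace M" "det (P m (chart_at A u) u) \<noteq> 0"
  shows "tangent_space A (X m) u = tangent_space A x u"
proof -
  define c where "c = chart_at A u"
  have c: "c \<in> A" "u \<in> fst c" using chart_at[OF manifold assms(1)] by (simp_all add: c_def)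
  interpret x: convex_chart c x by (rule convex_chart[OF c(1)])
  have x: "differential c x u v = (\<Sum>k\<in>UNIV. v $ k *\<^sub>R x.D k x u)" for v
    by (rule differential_frame[OF x.smooth_differentiable[OF x.smooth_x c(2)]])
  have "differential c (X m) u v = differential c x u (v v* P m c u)" for v
  proof -
    have "differential c (X m) u v = (\<Sum>i\<in>UNIV. v $ i *\<^sub>R x.D i (X m) u)"
      by (rule differential_frame[OF x.smooth_differentiable[OF smooth_parallel[OF c(1)] c(2)]])
    also have "\<dots> = (\<Sum>k\<in>UNIV. (v v* P m c u) $ k *\<^sub>R x.D k x u)"
      unfolding parallel_frame[OF c] vector_matrix_mult_def
      by (simp add: scaleR_sum_right scaleR_sum_left mult.commute) (rule sum.swap)
    finally show ?thesis by (simp add: x)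
  qed
  moreover have "invertible (P m c u)" using assms(2) by (simp add: c_def invertible_det_nz)
  then obtain Q where "Q ** P m c u = mat 1" by (auto simp: invertible_def)
  then have "w = (w v* Q) v* P m c u" for w by (simp add: vector_matrix_mul_assoc)
  ultimately show ?thesis
    unfolding tangent_space_def c_def[symmetric] by (auto simp: image_def) metis
qed

end

text \<open>The condition \<open>small\<close> keeps all eigenvalues of \<open>1 - mB\<close>
  positive, so the parallel map is convex and not merely immersed.\<close>

locale constant_curvatures = convex_hypersurface +
  fixes \<Lambda> :: "'b \<Rightarrow> real" and m :: real
  assumes curvatures: "u \<in> topspace M \<Longrightarrow> affine_principal_curvatures A x u = image_mset \<Lambda> (mset_set UNIV)"
    and small: "0 < 1 - m * \<Lambda> i"
begin

text \<open>The local eigenvalues \<open>d\<close> agree with \<Lambda> only up to a reordering that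
  may depend on the point and the chart, so they are compared as multisets and through symmetric
  functions.\<close>

lemma diagonalization:
  assumes "c \<in> A" "u \<in> fst c"
  obtains S :: "real ^ 'b ^ 'b" and d where "invertible S"
    "S ** ((N c x u \<bullet> Y u) *\<^sub>R second_form c x u) ** transpose S = mat 1"
    "S ** B c u = diag d ** S" "image_mset d (mset_set UNIV) = image_mset \<Lambda> (mset_set UNIV)"
    "\<And>i. 0 < 1 - m * d i" "det (P m c u) = (\<Prod>i\<in>UNIV. 1 - m * \<Lambda> i)"
proof -
  have u: "u \<in> topspace M" using topspace_iff[OF manifold] assms by blast
  obtain S :: "real ^ 'b ^ 'b" and d where S: "invertible S"
    "S ** ((N c x u \<bullet> Y u) *\<^sub>R second_form c x u) ** transpose S = mat 1"
    "S ** B c u = diag d ** S" "proots (charpoly (B c u)) = image_mset d (mset_set UNIV)"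
    "\<And>m. det (P m c u) = (\<Prod>i\<in>UNIV. 1 - m * d i)"
    by (rule charpoly_diag[OF assms]) blast
  have "charpoly (B c u) = charpoly (B (chart_at A u) u)"
    using charpoly_chart_independent assms chart_at[OF manifold u] by blast
  then have d: "image_mset d (mset_set UNIV) = image_mset \<Lambda> (mset_set UNIV)"
    using curvatures[OF u] S(4) by (simp add: affine_principal_curvatures_def)
  have "0 < 1 - m * d i" for i
  proof -
    have "d i \<in># image_mset \<Lambda> (mset_set UNIV)" unfolding d[symmetric] by simp
    then show ?thesis using small by auto
  qed
  moreover have "(\<Prod>i\<in>UNIV. 1 - m * d i) = (\<Prod>i\<in>UNIV. 1 - m * \<Lambda> i)"
  proof -
    have "(\<Prod>i\<in>UNIV. 1 - m * f i) = prod_mset (image_mset (\<lambda>l. 1 - m * l) (image_mset f (mset_set UNIV)))"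
      for f :: "'b \<Rightarrow> real" by (simp add: prod_unfold_prod_mset image_mset.compositionality o_def)
    then show ?thesis by (simp only: d)
  qed
  ultimately show ?thesis using that[of S d] S d by simp
qed

definition \<kappa> where "\<kappa> = (\<Prod>i\<in>UNIV. 1 - m * \<Lambda> i)"

lemma kappa_pos: "0 < \<kappa>" unfolding \<kappa>_def using small by (simp add: prod_pos)

lemma det_P: "c \<in> A \<Longrightarrow> u \<in> fst c \<Longrightarrow> det (P m c u) = \<kappa>"
  by (metis diagonalization \<kappa>_def)

lemma parallel_immersion: "c \<in> A \<Longrightarrow> chart_immersion c (X m)"
  using kappa_pos by (simp add: parallel_immersion_iff det_P)

lemma parallel_second_form': "c \<in> A \<Longrightarrow> u \<in> fst c \<Longrightarrow> second_form c (X m) u = \<kappa> *\<^sub>R (P m c u ** second_form c x u)"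
  by (simp add: parallel_second_form parallel_immersion det_P)

text \<open>The congruence by \<open>S\<close> sends \<nu> h to the identity and conjugates
  \<open>P\<close> to a diagonal matrix, hence sends the product to the positive diagonal 1 - m
  d_i.\<close>

lemma positive_definite_P:
  assumes "c \<in> A" "u \<in> fst c"
  shows "positive_definite ((N c x u \<bullet> Y u) *\<^sub>R (P m c u ** second_form c x u))"
proof -
  let ?K = "(N c x u \<bullet> Y u) *\<^sub>R second_form c x u"
  obtain S :: "real ^ 'b ^ 'b" and d where S: "invertible S" "S ** ?K ** transpose S = mat 1"
    "S ** B c u = diag d ** S" "\<And>i. 0 < 1 - m * d i"
    by (rule diagonalization[OF assms]) blast
  have "S ** P m c u = diag (\<lambda>i. 1 - m * d i) ** S"
    by (simp add: mult_mat_1_minus S(3) vec_eq_iff diag_mult_nth algebra_simps)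
  then have "S ** (P m c u ** ?K) ** transpose S = diag (\<lambda>i. 1 - m * d i)"
    using S(2) by (metis matrix_mul_assoc matrix_mul_rid)
  then have "positive_definite (P m c u ** ?K)"
    using positive_definite_congruence[OF S(1), of "P m c u ** ?K"]
      positive_definite_diag[of "\<lambda>i. 1 - m * d i"] S(4) by simp
  moreover have "P m c u ** ?K = (N c x u \<bullet> Y u) *\<^sub>R (P m c u ** second_form c x u)"
    by (simp add: vec_eq_iff matrix_matrix_mult_def sum_distrib_left mult.left_commute)
  ultimately show ?thesis by simp
qed

lemma parallel_convex: "locally_strongly_convex A (X m)"
  unfolding locally_strongly_convex_def hypersurface_iff[OF manifold]
proof (intro conjI ballI)
  fix c u assume c: "c \<in> A" "u \<in> fst c"
  let ?n = "N c x u \<bullet> Y u"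
  let ?Q = "P m c u ** second_form c x u"
  have n: "?n \<noteq> 0" by (rule affine_normal_at_nonzero(1)[OF normal_Y[OF c]])
  have pd: "positive_definite (?n *\<^sub>R ?Q)" by (rule positive_definite_P[OF c])
  have *: "positive_definite (a *\<^sub>R ?Q)" if "0 < a * ?n" for a
  proof -
    have "a *\<^sub>R ?Q = (a * ?n / ?n\<^sup>2) *\<^sub>R (?n *\<^sub>R ?Q)" using n by (simp add: power2_eq_square)
    moreover have "0 < a * ?n / ?n\<^sup>2" using that n by simp
    ultimately show ?thesis using pd positive_definite_scaleR by metis
  qed
  show "positive_definite (second_form c (X m) u) \<or> positive_definite (- second_form c (X m) u)"
  proof (cases "0 < ?n")
    case True
    then have "positive_definite (\<kappa> *\<^sub>R ?Q)" using kappa_pos by (intro *) simp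
    then show ?thesis by (simp add: parallel_second_form'[OF c])
  next
    case False
    then have "positive_definite ((- \<kappa>) *\<^sub>R ?Q)" using kappa_pos n by (intro *) (simp add: mult_pos_neg)
    then show ?thesis by (simp add: parallel_second_form'[OF c])
  qed
qed (rule parallel_immersion)

definition \<rho> where "\<rho> = \<kappa> powr (- 1 / (real CARD('b) + 2))"

lemma rho_pos: "0 < \<rho>" using kappa_pos by (simp add: \<rho>_def)

lemma rho_power: "\<kappa> * \<rho> ^ (CARD('b) + 2) = 1"
proof -
  have "\<rho> ^ (CARD('b) + 2) = \<rho> powr real (CARD('b) + 2)" by (rule powr_realpow[OF rho_pos, symmetric])
  also have "\<dots> = \<kappa> powr (- 1 / (real CARD('b) + 2) * real (CARD('b) + 2))" by (simp only: \<rho>_def powr_powr)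
  also have "- 1 / (real CARD('b) + 2) * real (CARD('b) + 2) = - 1" by simp
  finally show ?thesis using kappa_pos by (simp add: powr_minus)
qed

lemma affine_normal_at_parallel:
  assumes c: "c \<in> A" and u: "u \<in> fst c"
  shows "affine_normal_at c (X m) (\<lambda>v. \<rho> *\<^sub>R Y v) u"
proof -
  interpret x: convex_chart c x by (rule convex_chart[OF c])
  let ?n = "N c x u \<bullet> Y u"
  have nu: "N c (X m) u \<bullet> (\<rho> *\<^sub>R Y u) = \<kappa> * \<rho> * ?n"
    by (simp add: parallel_conormal[OF c u] det_P[OF c u])
  have "(\<kappa> * \<rho> * ?n) *\<^sub>R second_form c (X m) u = (\<kappa> * \<kappa> * \<rho>) *\<^sub>R (?n *\<^sub>R (P m c u ** second_form c x u))"
    by (simp add: parallel_second_form'[OF c u] mult_ac)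
  moreover have "0 < \<kappa> * \<kappa> * \<rho>" using kappa_pos rho_pos by simp
  ultimately have 1: "positive_definite ((\<kappa> * \<rho> * ?n) *\<^sub>R second_form c (X m) u)"
    using positive_definite_P[OF c u] by (simp only: positive_definite_scaleR)
  have h: "det (second_form c x u) = ?n ^ (CARD('b) + 2)"
    using normal_Y[OF c u] unfolding affine_normal_at_def by blast
  have "det (second_form c (X m) u) = \<kappa> ^ CARD('b) * \<kappa> * ?n ^ (CARD('b) + 2)"
    unfolding parallel_second_form'[OF c u] det_scaleR det_mul det_P[OF c u] h by (simp only: mult.assoc)
  \<comment> \<open>Inserting the factor \<kappa> \<rho>^(n+2) = 1 raises \<kappa>^(n+1) to the full
    power \<kappa>^(n+2).\<close>
  also have "\<dots> = \<kappa> ^ CARD('b) * \<kappa> * (\<kappa> * \<rho> ^ (CARD('b) + 2)) * ?n ^ (CARD('b) + 2)"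
    by (simp only: rho_power mult_1_right)
  also have "\<dots> = (\<kappa> * \<rho> * ?n) ^ (CARD('b) + 2)"
    by (simp only: power_mult_distrib power_add power2_eq_square mult_ac)
  finally have 2: "det (second_form c (X m) u) = (\<kappa> * \<rho> * ?n) ^ (CARD('b) + 2)" .
  have "x.D i (\<lambda>v. \<rho> *\<^sub>R Y v) u = \<rho> *\<^sub>R x.D i Y u" for i
    by (rule x.frame_deriv_bounded_linear[OF bounded_linear_scaleR_right x.smooth_differentiable[OF smooth_Y[OF c] u]])
  then have 3: "N c (X m) u \<bullet> x.D i (\<lambda>v. \<rho> *\<^sub>R Y v) u = 0" for i
    using normal_Y[OF c u] by (simp add: parallel_conormal[OF c u] affine_normal_at_def)
  show ?thesis unfolding affine_normal_at_def nu using 1 2 3 by blast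
qed

lemma parallel_affine_normal:
  assumes c: "c \<in> A" and u: "u \<in> fst c"
  shows "affine_normal A (X m) u = \<rho> *\<^sub>R Y u"
proof (rule affine_normal_unique[OF manifold parallel_convex c u])
  interpret x: convex_chart c x by (rule convex_chart[OF c])
  show "chart_smooth c (\<lambda>v. \<rho> *\<^sub>R Y v)" by (intro x.smooth_scaleR x.smooth_const smooth_Y[OF c])
qed (rule affine_normal_at_parallel[OF c])

lemma parallel_equiaffine: "equiaffine_parallel_hypersurface M A x (\<lambda>_. m)"
  unfolding equiaffine_parallel_hypersurface_def affine_parallel_hypersurface_def
proof (intro conjI ballI parallel_convex)
  show "smooth_map A (\<lambda>_. m)"
    unfolding smooth_map_iff_chart_smooth using chart_domain.smooth_const[OF chart_domain[OF manifold]] by blast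
next
  fix u assume u: "u \<in> topspace M"
  then have c: "chart_at A u \<in> A" "u \<in> fst (chart_at A u)" using chart_at[OF manifold u] by auto
  show "affine_parallel (tangent_space A (X m) u) (tangent_space A x u)"
    using tangent_space_parallel[OF u, of m] det_P[OF c] kappa_pos
    by (simp add: affine_parallel_def exI[of _ 0])
  have "affine_normal_line A x u = (\<lambda>y. - (m *\<^sub>R Y u) + y) ` affine_normal_line A (X m) u"
  proof -
    have "\<exists>s. x u + t *\<^sub>R Y u = - (m *\<^sub>R Y u) + (X m u + s *\<^sub>R \<rho> *\<^sub>R Y u)" for t
      using rho_pos by (intro exI[of _ "t / \<rho>"]) (simp add: parallel_map_def)
    moreover have "\<exists>t. - (m *\<^sub>R Y u) + (X m u + s *\<^sub>R \<rho> *\<^sub>R Y u) = x u + t *\<^sub>R Y u" for s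
      by (intro exI[of _ "s * \<rho>"]) (simp add: parallel_map_def)
    ultimately show ?thesis
      unfolding affine_normal_line_def parallel_affine_normal[OF c] by blast
  qed
  then show "affine_parallel (affine_normal_line A (X m) u) (affine_normal_line A x u)"
    unfolding affine_parallel_def by blast
qed

text \<open>Expanding the derivative of \<rho> Y in the old frame gives C P = \<rho> B for the new
  shape matrix C. Conjugation by \<open>S\<close> makes its diagonal \<rho> d_i / (1 - m d_i), whose
  sum depends only on the multiset of the d_i.\<close>

lemma parallel_mean_curvature:
  assumes u: "u \<in> topspace M"
  shows "affine_mean_curvature A (X m) u = \<rho> * (\<Sum>i\<in>UNIV. \<Lambda> i / (1 - m * \<Lambda> i)) / real CARD('b)"
proof -
  define c where "c = chart_at A u"
  have c: "c \<in> A" "u \<in> fst c" using chart_at[OF manifold u] by (simp_all add: c_def)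
  interpret x: convex_chart c x by (rule convex_chart[OF c(1)])
  interpret p: convex_hypersurface M A "X m" by (rule convex_hypersurface.intro[OF manifold parallel_convex])
  obtain S :: "real ^ 'b ^ 'b" and d where S: "invertible S"
    "S ** B c u = diag d ** S" "image_mset d (mset_set UNIV) = image_mset \<Lambda> (mset_set UNIV)"
    "\<And>i. 0 < 1 - m * d i"
    by (rule diagonalization[OF c]) blast
  let ?P = "P m c u" and ?C = "shape_matrix A c (X m) u"
  have "(?C ** ?P) $ i $ k = (\<rho> *\<^sub>R B c u) $ i $ k" for i k
  proof -
    have "x.D i (affine_normal A (X m)) u = x.D i (\<lambda>v. \<rho> *\<^sub>R Y v) u"
      by (rule x.D_eq[OF c(2) parallel_affine_normal[OF c(1)]])
    also have "\<dots> = \<rho> *\<^sub>R x.D i Y u"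
      by (rule x.frame_deriv_bounded_linear[OF bounded_linear_scaleR_right x.smooth_differentiable[OF smooth_Y[OF c(1)] c(2)]])
    also have "\<dots> = - (\<Sum>k\<in>UNIV. (\<rho> *\<^sub>R B c u) $ i $ k *\<^sub>R x.D k x u)"
      by (simp add: weingarten[OF c] scaleR_sum_right)
    finally have 1: "x.D i (affine_normal A (X m)) u = - (\<Sum>k\<in>UNIV. (\<rho> *\<^sub>R B c u) $ i $ k *\<^sub>R x.D k x u)" .
    have "x.D i (affine_normal A (X m)) u = - (\<Sum>k\<in>UNIV. (?C ** ?P) $ i $ k *\<^sub>R x.D k x u)"
      unfolding p.weingarten[OF c] parallel_frame[OF c]
      by (simp add: matrix_matrix_mult_def scaleR_sum_left scaleR_sum_right) (rule sum.swap)
    with 1 have "(\<Sum>k\<in>UNIV. ((?C ** ?P) $ i $ k - (\<rho> *\<^sub>R B c u) $ i $ k) *\<^sub>R x.D k x u) = 0"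
      by (simp add: scaleR_diff_left sum_subtractf)
    from frame_independent[OF x.conormal_nz[OF c(2)] this, of k] show ?thesis by simp
  qed
  then have CP: "?C ** ?P = \<rho> *\<^sub>R B c u" by (simp add: vec_eq_iff)
  define E where "E = diag (\<lambda>i. d i / (1 - m * d i))"
  have "S ** ?C ** ?P = \<rho> *\<^sub>R (diag d ** S)"
    unfolding matrix_mul_assoc[symmetric] CP S(2)[symmetric]
    by (simp add: vec_eq_iff matrix_matrix_mult_def sum_distrib_left mult.left_commute)
  moreover have "(\<rho> *\<^sub>R (E ** S)) ** ?P = \<rho> *\<^sub>R (diag d ** S)"
  proof -
    have "(E ** (S ** ?P)) $ i $ j = (diag d ** S) $ i $ j" for i j
      using S(4)[of i] unfolding mult_mat_1_minus S(2) E_def diag_mult_nth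
      by (simp add: diag_mult_nth field_simps)
    then have "E ** (S ** ?P) = diag d ** S" by (simp add: vec_eq_iff)
    moreover have "(\<rho> *\<^sub>R (E ** S)) ** ?P = \<rho> *\<^sub>R (E ** (S ** ?P))"
      unfolding matrix_mul_assoc
      by (simp add: vec_eq_iff matrix_matrix_mult_def[of _ ?P] sum_distrib_left mult.assoc)
    ultimately show ?thesis by simp
  qed
  moreover obtain Q where Q: "?P ** Q = mat 1"
    using det_P[OF c] kappa_pos invertible_det_nz[of ?P] by (auto simp: invertible_def)
  \<comment> \<open>Both products with \<open>?P\<close> on the right agree; cancelling the
    invertible \<open>?P\<close> avoids writing down its inverse.\<close>
  ultimately have SC: "S ** ?C = \<rho> *\<^sub>R (E ** S)"
    by (metis matrix_mul_assoc matrix_mul_rid)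
  obtain T where T: "S ** T = mat 1" "T ** S = mat 1" using S(1) by (auto simp: invertible_def)
  have "trace ?C = trace (T ** (S ** ?C))" by (simp add: matrix_mul_assoc T)
  also have "\<dots> = trace (S ** ?C ** T)" by (rule trace_mul_sym)
  also have "S ** ?C ** T = \<rho> *\<^sub>R (E ** (S ** T))"
    unfolding SC matrix_mul_assoc by (simp add: vec_eq_iff matrix_matrix_mult_def[of _ T] sum_distrib_left mult.assoc)
  also have "trace \<dots> = \<rho> * (\<Sum>i\<in>UNIV. d i / (1 - m * d i))"
    by (simp add: T trace_def E_def diag_def sum_distrib_left)
  also have "(\<Sum>i\<in>UNIV. d i / (1 - m * d i)) = (\<Sum>i\<in>UNIV. \<Lambda> i / (1 - m * \<Lambda> i))"
  proof -
    have "(\<Sum>i\<in>UNIV. f i / (1 - m * f i)) = sum_mset (image_mset (\<lambda>l. l / (1 - m * l)) (image_mset f (mset_set UNIV)))"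
      for f :: "'b \<Rightarrow> real" by (simp add: sum_unfold_sum_mset image_mset.compositionality o_def)
    then show ?thesis by (simp only: S(3))
  qed
  finally show ?thesis by (simp add: affine_mean_curvature_def c_def)
qed

end

section \<open>The two implications\<close>

context convex_hypersurface
begin

lemma constant_curvatures_imp_isoparametric:
  assumes "constant_affine_principal_curvatures M A x"
  shows "equiaffine_isoparametric M A x"
proof -
  obtain \<Lambda> :: "'n \<Rightarrow> real" where L: "\<And>u. u \<in> topspace M \<Longrightarrow>
      affine_principal_curvatures A x u = image_mset \<Lambda> (mset_set UNIV)"
    using assms unfolding constant_affine_principal_curvatures_def by blast
  \<comment> \<open>The sum bounds every |\<Lambda>_i| and the summand 1 excludes a zero
    denominator, so |m| < \<delta> gives |m \<Lambda>_i| < 1.\<close>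
  define \<delta> where "\<delta> = 1 / (1 + (\<Sum>i\<in>UNIV. \<bar>\<Lambda> i\<bar>))"
  have s: "0 \<le> (\<Sum>i\<in>UNIV. \<bar>\<Lambda> i\<bar>)" by (simp add: sum_nonneg)
  have "constant_curvatures M A x \<Lambda> m" if m: "- \<delta> < m" "m < \<delta>" for m
  proof unfold_locales
    fix i
    have "\<bar>m * \<Lambda> i\<bar> \<le> \<bar>m\<bar> * (\<Sum>i\<in>UNIV. \<bar>\<Lambda> i\<bar>)"
      unfolding abs_mult by (intro mult_left_mono member_le_sum) auto
    also have "\<dots> \<le> \<bar>m\<bar> * (1 + (\<Sum>i\<in>UNIV. \<bar>\<Lambda> i\<bar>))" by (simp add: distrib_left)
    also have "\<dots> < 1"
    proof -
      have "\<bar>m\<bar> < \<delta>" using m by linarith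
      moreover have "0 < 1 + (\<Sum>i\<in>UNIV. \<bar>\<Lambda> i\<bar>)" using s by linarith
      ultimately show ?thesis by (simp add: \<delta>_def less_divide_eq)
    qed
    finally show "0 < 1 - m * \<Lambda> i" by linarith
  qed (rule L)
  note cc = this
  show ?thesis
    unfolding equiaffine_isoparametric_def
  proof (rule conjI[OF lsc], rule exI[of _ \<delta>], intro conjI allI impI)
    show "\<delta> > 0" unfolding \<delta>_def using s by (intro divide_pos_pos) linarith+
  next
    fix m assume m: "- \<delta> < m \<and> m < \<delta>"
    interpret cc: constant_curvatures M A x \<Lambda> m using cc m by blast
    show "equiaffine_parallel_hypersurface M A x (\<lambda>_. m)" by (rule cc.parallel_equiaffine)
    show "\<exists>L. \<forall>u\<in>topspace M. affine_mean_curvature A (X m) u = L"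
      using cc.parallel_mean_curvature by blast
  qed
qed

lemma parallel_det_constant:
  assumes conn: "connected_space M" and par: "equiaffine_parallel_hypersurface M A x (\<lambda>_. m)"
  obtains k where "\<And>c u. c \<in> A \<Longrightarrow> u \<in> fst c \<Longrightarrow> det (P m c u) = k"
proof -
  have lsc': "locally_strongly_convex A (X m)"
    and lines: "\<And>u. u \<in> topspace M \<Longrightarrow> affine_parallel (affine_normal_line A (X m) u) (affine_normal_line A x u)"
    using par by (auto simp: equiaffine_parallel_hypersurface_def affine_parallel_hypersurface_def)
  interpret p: convex_hypersurface M A "X m" by (rule convex_hypersurface.intro[OF manifold lsc'])
  let ?Z = "affine_normal A (X m)"
  \<comment> \<open>Parallel lines give proportionality only point by point; regularity of the
    factor has to be recovered afterwards.\<close>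
  have "\<forall>u\<in>topspace M. \<exists>r. ?Z u = r *\<^sub>R Y u"
    using lines affine_parallel_lines unfolding affine_normal_line_def by blast
  then obtain r where r: "\<And>u. u \<in> topspace M \<Longrightarrow> ?Z u = r u *\<^sub>R Y u" by metis
  have inM: "u \<in> topspace M" if "c \<in> A" "u \<in> fst c" for c u
    using that topspace_iff[OF manifold] by blast
  have det: "det (P m c u) * r u ^ (CARD('n) + 2) = 1" and dr: "frame_deriv c i r u = 0"
    and sr: "chart_smooth c r"
    if c: "c \<in> A" "u \<in> fst c" for c u i
  proof -
    interpret x: convex_chart c x by (rule convex_chart[OF c(1)])
    let ?d = "det (P m c u)" and ?n = "N c x u \<bullet> Y u"
    have nz: "N c x v \<bullet> Y v \<noteq> 0" if "v \<in> fst c" for v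
      by (rule affine_normal_at_nonzero(1)[OF normal_Y[OF c(1) that]])
    have d: "?d \<noteq> 0" using parallel_immersion_iff[OF c(1)] p.immersion[OF c(1)] c(2) by blast
    have "second_form c (X m) u = ?d *\<^sub>R (P m c u ** second_form c x u)"
      by (rule parallel_second_form[OF c p.immersion[OF c(1)]])
    then have "det (second_form c (X m) u) = ?d ^ CARD('n) * (?d * ?n ^ (CARD('n) + 2))"
      using normal_Y[OF c] by (simp only: det_scaleR det_mul affine_normal_at_def)
    moreover have "det (second_form c (X m) u) = (?d * r u * ?n) ^ (CARD('n) + 2)"
      using p.normal_Y[OF c] unfolding affine_normal_at_def parallel_conormal[OF c] r[OF inM[OF c]]
      by (simp only: inner_scaleR_left inner_scaleR_right mult_ac)
    \<comment> \<open>The nonzero determinant of the new second form is split off on both sides; the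
      remaining factor must be 1.\<close>
    moreover have "\<dots> = ?d ^ CARD('n) * (?d * ?n ^ (CARD('n) + 2)) * (?d * r u ^ (CARD('n) + 2))"
      by (simp only: power_mult_distrib power_add power2_eq_square mult_ac)
    ultimately have "?d ^ CARD('n) * (?d * ?n ^ (CARD('n) + 2)) =
        ?d ^ CARD('n) * (?d * ?n ^ (CARD('n) + 2)) * (?d * r u ^ (CARD('n) + 2))" by (simp only:)
    moreover have "?d ^ CARD('n) * (?d * ?n ^ (CARD('n) + 2)) \<noteq> 0" using d nz[OF c(2)] by simp
    ultimately show "?d * r u ^ (CARD('n) + 2) = 1" by (simp only: mult_cancel_left1 simp_thms)
    \<comment> \<open>The factor is a quotient of two smooth pairings with the conormal of
      \<open>x\<close>, whose denominator \<nu> never vanishes.\<close>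
    show sr: "chart_smooth c r"
    proof (rule x.smooth_cong)
      show "chart_smooth c (\<lambda>v. (N c x v \<bullet> ?Z v) * inverse (N c x v \<bullet> Y v))"
        by (intro x.smooth_mult x.smooth_inverse x.smooth_inner x.smooth_conormal smooth_Y p.smooth_Y c(1) nz)
      show "(N c x v \<bullet> ?Z v) * inverse (N c x v \<bullet> Y v) = r v" if "v \<in> fst c" for v
        using nz[OF that] r[OF inM[OF c(1) that]] by simp
    qed
    have "x.D i ?Z u = x.D i (\<lambda>v. r v *\<^sub>R Y v) u"
      by (rule x.D_eq[OF c(2)]) (rule r[OF inM[OF c(1)]])
    also have "\<dots> = r u *\<^sub>R x.D i Y u + x.D i r u *\<^sub>R Y u"
      by (rule x.frame_deriv_scaleR[OF c(2) x.smooth_differentiable[OF sr c(2)]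
            x.smooth_differentiable[OF smooth_Y[OF c(1)] c(2)]])
    \<comment> \<open>The transversal part of the derivative of r Y is r_i \<nu>; tangency for the
      parallel hypersurface, whose conormal is a nonzero multiple of N, makes it vanish.\<close>
    finally have "N c x u \<bullet> x.D i ?Z u = x.D i r u * ?n"
      using normal_Y[OF c] by (simp add: inner_add_right affine_normal_at_def)
    moreover have "N c x u \<bullet> x.D i ?Z u = 0"
      using p.normal_Y[OF c] d by (simp add: affine_normal_at_def parallel_conormal[OF c])
    ultimately show "x.D i r u = 0" using nz[OF c(2)] by simp
  qed
  have const: "r u = r v" if "u \<in> topspace M" "v \<in> topspace M" for u v
  proof (rule connected_space_locally_constant[OF conn that])
    fix u assume "u \<in> topspace M"
    then obtain c where c: "c \<in> A" "u \<in> fst c" using topspace_iff[OF manifold] by blast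
    interpret chart_domain c by (rule chart_domain[OF manifold c(1)])
    obtain e where e: "e > 0" "\<And>v. v \<in> fst c \<Longrightarrow> snd c v \<in> ball (snd c u) e \<Longrightarrow> r v = r u"
      by (rule locally_constant[OF c(2) smooth_differentiable[OF sr[OF c]] dr[OF c(1)]], assumption, assumption) (rule that)
    let ?W = "{v \<in> fst c. snd c v \<in> ball (snd c u) e}"
    have "openin M ?W" by (rule openin_chart_preimage[OF manifold c(1) open_ball])
    moreover have "u \<in> ?W" using c(2) e(1) by simp
    moreover have "\<forall>v\<in>?W. r v = r u" by (intro ballI e(2)) simp_all
    ultimately show "\<exists>W. openin M W \<and> u \<in> W \<and> (\<forall>v\<in>W. r v = r u)"
      by (intro exI[of _ ?W] conjI)
  qed
  show ?thesis
  proof (cases "topspace M = {}")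
    case True
    then show ?thesis using that[of 0] inM by blast
  next
    case False
    then obtain u0 where u0: "u0 \<in> topspace M" by blast
    show ?thesis
    proof (rule that)
      fix c u assume c: "c \<in> A" "u \<in> fst c"
      have "det (P m c u) * r u0 ^ (CARD('n) + 2) = 1"
        using det[OF c] const[OF inM[OF c] u0] by simp
      then show "det (P m c u) = inverse (r u0 ^ (CARD('n) + 2))" by (metis inverse_unique mult.commute)
    qed
  qed
qed

lemma isoparametric_imp_constant_curvatures:
  assumes conn: "connected_space M" and iso: "equiaffine_isoparametric M A x"
  shows "constant_affine_principal_curvatures M A x"
proof (cases "topspace M = {}")
  case True
  then show ?thesis by (simp add: constant_affine_principal_curvatures_def)
next
  case False
  then obtain u0 where u0: "u0 \<in> topspace M" by blast
  let ?B = "\<lambda>u. B (chart_at A u) u"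
  obtain \<delta> where \<delta>: "\<delta> > 0" "\<And>m. - \<delta> < m \<Longrightarrow> m < \<delta> \<Longrightarrow> equiaffine_parallel_hypersurface M A x (\<lambda>_. m)"
    using iso unfolding equiaffine_isoparametric_def by blast
  have "charpoly (?B u) = charpoly (?B u0)" if u: "u \<in> topspace M" for u
  proof -
    \<comment> \<open>For t > 1/\<delta> the distance m = 1/t is admissible, and the characteristic
      polynomial at t equals t^n det(1 - mB), hence is the same at both points. These t form an
      infinite set of roots of the difference.\<close>
    have "poly (charpoly (?B u) - charpoly (?B u0)) t = 0" if t: "t > 1 / \<delta>" for t
    proof -
      have "0 < 1 / \<delta>" using \<delta>(1) by simp
      then have t0: "t > 0" using t by linarith
      have "1 / t < \<delta>" using t t0 \<delta>(1) by (simp add: field_simps)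
      moreover have "- \<delta> < 1 / t" using t0 \<delta>(1) by (smt (verit) divide_pos_pos)
      ultimately obtain k where k: "\<And>c u. c \<in> A \<Longrightarrow> u \<in> fst c \<Longrightarrow> det (P (1 / t) c u) = k"
        using parallel_det_constant[OF conn \<delta>(2)] by metis
      have "poly (charpoly (?B v)) t = t ^ CARD('n) * k" if "v \<in> topspace M" for v
      proof -
        have "t *\<^sub>R mat 1 - ?B v = t *\<^sub>R P (1 / t) (chart_at A v) v"
          using t0 by (simp add: scaleR_diff_right)
        then show ?thesis
          using k[of "chart_at A v" v] chart_at[OF manifold that] by (simp add: poly_charpoly det_scaleR)
      qed
      then show ?thesis using u u0 by simp
    qed
    then have "{1 / \<delta><..} \<subseteq> {t. poly (charpoly (?B u) - charpoly (?B u0)) t = 0}" by auto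
    then have "infinite {t. poly (charpoly (?B u) - charpoly (?B u0)) t = 0}"
      using infinite_Ioi infinite_super by blast
    then show ?thesis using poly_roots_finite[of "charpoly (?B u) - charpoly (?B u0)"] by auto
  qed
  moreover have "chart_at A u0 \<in> A" "u0 \<in> fst (chart_at A u0)" using chart_at[OF manifold u0] by auto
  \<comment> \<open>Diagonalizability at one point shows that the common characteristic polynomial
    has n real roots, which are the required constants.\<close>
  then obtain d :: "'n \<Rightarrow> real" where "proots (charpoly (?B u0)) = image_mset d (mset_set UNIV)"
    by (rule charpoly_diag) blast
  ultimately have "\<forall>u\<in>topspace M. affine_principal_curvatures A x u = image_mset d (mset_set UNIV)"
    by (simp add: affine_principal_curvatures_def)
  then show ?thesis unfolding constant_affine_principal_curvatures_def by blast
qed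

end

theorem theorem1p2:
  fixes M :: "'a topology"
    and A :: "('a, 'n::finite) chart set"
    and x :: "'a \<Rightarrow> real ^ ('n option)"
  assumes "smooth_manifold M A"
    and "connected_space M"
    and "locally_strongly_convex A x"
  shows "equiaffine_isoparametric M A x \<longleftrightarrow> constant_affine_principal_curvatures M A x"
proof -
  interpret convex_hypersurface M A x by (rule convex_hypersurface.intro[OF assms(1,3)])
  show ?thesis
    using constant_curvatures_imp_isoparametric isoparametric_imp_constant_curvatures[OF assms(2)] by blast
qed

end
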